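(* Let $G\colon\mathbb{R}^n\times\mathbb{R}^n\times[0,\infty)\to[0,\infty)$ be a generalized Young function satisfying (H1), (H2) and (H3) (as defined in the context). Let $u\in C^2_c(\mathbb{R}^n)$. Then $$\limsup_{s\uparrow1}\,[[u]]_{s,G}\le\|\nabla u\|_{H_0},$$ where $$H_0(x,t)=\int_0^1\int_{\mathbb{S}^{n-1}}G(x,x,t|w_n|r)\,dS_w\,\frac{dr}{r},$$ and $[[\cdot]]_{s,G}$ and $\|\nabla u\|_{H_0}$ are the Luxemburg-type quantities defined in the context.
   Context: Let $n\ge 1$ be an integer and $s\in(0,1)$. A generalized Young function is a function $G\colon\mathbb{R}^n\times\mathbb{R}^n\times[0,\infty)\to[0,\infty)$ of the form $G(x,y,t)=\int_0^t g(x,y,\tau)\,d\tau$, where $g\colon\mathbb{R}^n\times\mathbb{R}^n\times[0,\infty)\to[0,\infty)$ satisfies, for every $(x,y)$: (i) $g(x,y,0)=0$ and $g(x,y,t)>0$ for $t>0$; (ii) $t\mapsto g(x,y,t)$ is nondecreasing on $[0,\infty)$; (iii) $t\mapsto g(x,y,t)$ is right continuous on $[0,\infty)$ and $\lim_{t\to\infty}g(x,y,t)=\infty$. It is understood that $(x,y)\mapsto G(x,y,t)$ is measurable for each $t$. Hypotheses: (H1) there exist constants $0<C_1\le C_2<\infty$ such that $C_1\le G(x,y,1)\le C_2$ for all $x,y\in\mathbb{R}^n$; (H2) for every $x\in\mathbb{R}^n$ and $t\ge0$, the map $y\mapsto G(x,y,t)$ is continuous on $\mathbb{R}^n$; (H3)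 there exist constants $1<p^-\le p^+<\infty$ such that $p^-\le \frac{t\,g(x,y,t)}{G(x,y,t)}\le p^+$ for all $x,y\in\mathbb{R}^n$ and $t>0$. $\mathbb{S}^{n-1}$ is the unit sphere of $\mathbb{R}^n$, $dS$ is its $(n-1)$-dimensional Hausdorff (surface) measure, and $w_n$ is the $n$-th coordinate of $w\in\mathbb{S}^{n-1}$. $C^2_c(\mathbb{R}^n)$ is the space of real-valued compactly supported $C^2$ functions. Define $$\mathcal{J}_{s,G}(u)=\iint_{\mathbb{R}^n\times\mathbb{R}^n}G\left(x,y,\frac{|u(x)-u(y)|}{|x-y|^s}\right)\frac{dx\,dy}{|x-y|^n},\qquad [[u]]_{s,G}=\inf\left\{\lambda>0:\ (1-s)\,\mathcal{J}_{s,G}\left(\frac{u}{\lambda}\right)\le1\right\},$$ $$\|\nabla u\|_{H_0}=\inf\left\{\lambda>0:\ \int_{\mathbb{R}^n}H_0\left(x,\frac{|\nabla u(x)|}{\lambda}\right)dx\le1\right\}.$$ *)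

theory Defs
  imports "HOL-Analysis.Analysis"
begin

section \<open>Hausdorff measure\<close>

definition hausdorff_weight :: "nat \<Rightarrow> 'a::metric_space set \<Rightarrow> ennreal" where
  "hausdorff_weight m C =
     (if C = {} then 0 else ennreal (unit_ball_vol (real m) * (diameter C / 2) ^ m))"

text \<open>Coverings are by bounded sets only, because \<^const>\<open>diameter\<close> carries no information for
  unbounded ones; these are not admissible for the size bound anyway. The power has a natural
  number as exponent, so that for \<open>m = 0\<close> every nonempty set has weight \<open>1\<close> (also
  singletons, as \<open>0 ^ 0 = 1\<close>), and the measure of dimension \<open>0\<close> is the counting measure.\<close>

definition hausdorff_content :: "nat \<Rightarrow> real \<Rightarrow> 'a::metric_space set \<Rightarrow> ennreal" where
  "hausdorff_content m \<delta> A =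
     (INF C\<in>{C :: nat \<Rightarrow> 'a set. A \<subseteq> (\<Union>i. C i) \<and> (\<forall>i. bounded (C i) \<and> diameter (C i) \<le> \<delta>)}.
        \<Sum>i. hausdorff_weight m (C i))"

definition hausdorff_outer :: "nat \<Rightarrow> 'a::metric_space set \<Rightarrow> ennreal" where
  "hausdorff_outer m A = (SUP \<delta>\<in>{0<..}. hausdorff_content m \<delta> A)"

definition hausdorff_measure :: "nat \<Rightarrow> 'a::metric_space measure" where
  "hausdorff_measure m = measure_of UNIV (sets borel) (hausdorff_outer m)"

text \<open>\<^const>\<open>measure_of\<close> yields the null measure unless its argument is countably
  additive, so the following lemmas check that it is: \<^const>\<open>hausdorff_outer\<close> is a metric
  outer measure, and hence a measure on the Borel sets.\<close>

lemma hausdorff_weight_empty [simp]: "hausdorff_weight m {} = 0"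
  by (simp add: hausdorff_weight_def)

lemma hausdorff_content_le:
  assumes "A \<subseteq> (\<Union>i. C i)" "\<And>i. bounded (C i)" "\<And>i. diameter (C i) \<le> \<delta>"
  shows "hausdorff_content m \<delta> A \<le> (\<Sum>i. hausdorff_weight m (C i))"
  unfolding hausdorff_content_def using assms by (intro INF_lower) auto

lemma hausdorff_content_mono: "A \<subseteq> B \<Longrightarrow> hausdorff_content m \<delta> A \<le> hausdorff_content m \<delta> B"
  unfolding hausdorff_content_def by (intro INF_superset_mono) auto

lemma hausdorff_content_antimono:
  "\<delta> \<le> \<epsilon> \<Longrightarrow> hausdorff_content m \<epsilon> A \<le> hausdorff_content m \<delta> A"
  unfolding hausdorff_content_def by (intro INF_superset_mono) (auto intro: order_trans)

lemma hausdorff_content_UN: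
  fixes A :: "nat \<Rightarrow> 'a::metric_space set"
  shows "hausdorff_content m \<delta> (\<Union>i. A i) \<le> (\<Sum>i. hausdorff_content m \<delta> (A i))"
proof (cases "(\<Sum>i. hausdorff_content m \<delta> (A i)) = \<infinity>")
  case False
  show ?thesis
  proof (rule ennreal_le_epsilon)
    fix e :: real assume e: "0 < e"
    have fin: "hausdorff_content m \<delta> (A i) \<noteq> top" for i
      using ennreal_suminf_lessD[of "\<lambda>i. hausdorff_content m \<delta> (A i)" top] False
      by (auto simp: top.not_eq_extremum)
    define d where "d i = e * (1/2) ^ Suc i" for i
    have d: "d i > 0" for i using e by (simp add: d_def)
    have "d sums e"
      using sums_mult[OF power_half_series, of e] by (simp add: d_def[abs_def])
    then have d_sum: "(\<Sum>i. ennreal (d i)) = ennreal e"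
      using d by (intro suminf_ennreal_eq) (auto intro: less_imp_le)
    have "\<exists>C. A i \<subseteq> (\<Union>j. C j) \<and> (\<forall>j. bounded (C j) \<and> diameter (C j) \<le> \<delta>) \<and>
        (\<Sum>j. hausdorff_weight m (C j)) < hausdorff_content m \<delta> (A i) + ennreal (d i)" for i
    proof -
      have "hausdorff_content m \<delta> (A i) < hausdorff_content m \<delta> (A i) + ennreal (d i)"
        using fin[of i] d[of i] by (cases "hausdorff_content m \<delta> (A i)")
          (auto simp: ennreal_less_iff simp flip: ennreal_plus)
      then show ?thesis
        unfolding hausdorff_content_def[of m \<delta> "A i"] INF_less_iff
        by (auto simp: hausdorff_content_def)
    qed
    then obtain C where C: "\<And>i. A i \<subseteq> (\<Union>j. C i j)" "\<And>i j. bounded (C i j)"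
        "\<And>i j. diameter (C i j) \<le> \<delta>"
        "\<And>i. (\<Sum>j. hausdorff_weight m (C i j)) < hausdorff_content m \<delta> (A i) + ennreal (d i)"
      by metis
    let ?D = "\<lambda>k. case_prod C (prod_decode k)"
    have cov: "(\<Union>i. A i) \<subseteq> (\<Union>k. ?D k)"
    proof
      fix x assume "x \<in> (\<Union>i. A i)"
      then obtain i j where "x \<in> C i j" using C(1) by blast
      then show "x \<in> (\<Union>k. ?D k)" by (intro UN_I[of "prod_encode (i, j)"]) simp_all
    qed
    have "hausdorff_content m \<delta> (\<Union>i. A i) \<le> (\<Sum>k. hausdorff_weight m (?D k))"
      using cov C(2,3) by (intro hausdorff_content_le) (auto split: prod.split)
    also have "\<dots> = (\<Sum>i. \<Sum>j. hausdorff_weight m (C i j))"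
      by (rule suminf_ennreal_2dimen[where f = "\<lambda>p. hausdorff_weight m (case_prod C p)"]) simp
    also have "\<dots> \<le> (\<Sum>i. hausdorff_content m \<delta> (A i) + ennreal (d i))"
      using C(4) by (intro suminf_le) (auto intro: less_imp_le)
    also have "\<dots> = (\<Sum>i. hausdorff_content m \<delta> (A i)) + (\<Sum>i. ennreal (d i))"
      by (intro suminf_add[symmetric]) auto
    also have "\<dots> = (\<Sum>i. hausdorff_content m \<delta> (A i)) + ennreal e"
      by (simp only: d_sum)
    finally show "hausdorff_content m \<delta> (\<Union>i. A i) \<le> (\<Sum>i. hausdorff_content m \<delta> (A i)) + ennreal e" .
  qed
qed simp

lemma hausdorff_outer_mono: "A \<subseteq> B \<Longrightarrow> hausdorff_outer m A \<le> hausdorff_outer m B"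
  unfolding hausdorff_outer_def by (intro SUP_mono) (auto intro: hausdorff_content_mono)

lemma hausdorff_outer_empty [simp]: "hausdorff_outer m {} = 0"
proof -
  have "hausdorff_content m \<delta> ({} :: 'a set) \<le> 0" if "\<delta> > 0" for \<delta>
    using hausdorff_content_le[of "{}" "\<lambda>_. {} :: 'a set" \<delta> m] that by simp
  then show ?thesis by (auto simp: hausdorff_outer_def intro!: SUP_eq_const)
qed

lemma hausdorff_outer_UN:
  "hausdorff_outer m (\<Union>i::nat. A i) \<le> (\<Sum>i. hausdorff_outer m (A i))"
  unfolding hausdorff_outer_def[of m "\<Union>i. A i"]
proof (rule SUP_least)
  fix \<delta> :: real assume "\<delta> \<in> {0<..}"
  then have "(\<Sum>i. hausdorff_content m \<delta> (A i)) \<le> (\<Sum>i. hausdorff_outer m (A i))"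
    unfolding hausdorff_outer_def by (intro suminf_le) (auto intro: SUP_upper)
  with hausdorff_content_UN show "hausdorff_content m \<delta> (\<Union>i. A i) \<le> (\<Sum>i. hausdorff_outer m (A i))"
    by (rule order_trans)
qed

lemma outer_measure_space_hausdorff: "outer_measure_space (Pow UNIV) (hausdorff_outer m)"
  by (auto simp: outer_measure_space_def positive_def increasing_def countably_subadditive_def
      intro: hausdorff_outer_mono hausdorff_outer_UN)

lemma hausdorff_outer_Un: "hausdorff_outer m (A \<union> B) \<le> hausdorff_outer m A + hausdorff_outer m B"
  using hausdorff_outer_UN[of m "binaryset A B"]
  by (simp add: UN_binaryset_eq suminf_binaryset_eq)

lemma hausdorff_outer_separated:
  fixes A B :: "'a::metric_space set"
  assumes d: "d > 0" and sep: "\<And>x y. x \<in> A \<Longrightarrow> y \<in> B \<Longrightarrow> d \<le> dist x y"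
  shows "hausdorff_outer m A + hausdorff_outer m B \<le> hausdorff_outer m (A \<union> B)"
proof -
  have *: "hausdorff_content m \<delta> A + hausdorff_content m \<delta> B \<le> hausdorff_content m \<delta> (A \<union> B)"
    if "0 < \<delta>" "\<delta> < d" for \<delta>
    unfolding hausdorff_content_def[of m \<delta> "A \<union> B"]
  proof (rule INF_greatest, clarsimp)
    fix C :: "nat \<Rightarrow> 'a set"
    assume C: "A \<subseteq> (\<Union>i. C i)" "B \<subseteq> (\<Union>i. C i)" "\<forall>i. bounded (C i) \<and> diameter (C i) \<le> \<delta>"
    define CA where "CA i = (if C i \<inter> A = {} then {} else C i)" for i
    define CB where "CB i = (if C i \<inter> B = {} then {} else C i)" for i
    have "hausdorff_content m \<delta> A \<le> (\<Sum>i. hausdorff_weight m (CA i))"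
      using C that unfolding CA_def by (intro hausdorff_content_le) (auto, blast)
    moreover have "hausdorff_content m \<delta> B \<le> (\<Sum>i. hausdorff_weight m (CB i))"
      using C that unfolding CB_def by (intro hausdorff_content_le) (auto, blast)
    ultimately have "hausdorff_content m \<delta> A + hausdorff_content m \<delta> B
        \<le> (\<Sum>i. hausdorff_weight m (CA i)) + (\<Sum>i. hausdorff_weight m (CB i))"
      by (rule add_mono)
    also have "\<dots> = (\<Sum>i. hausdorff_weight m (CA i) + hausdorff_weight m (CB i))"
      by (intro suminf_add) auto
    also have "\<dots> \<le> (\<Sum>i. hausdorff_weight m (C i))"
    proof (intro suminf_le)
      fix i
      have "C i \<inter> A = {} \<or> C i \<inter> B = {}"
      proof (rule ccontr)
        assume "\<not> ?thesis"
        then obtain x y where "x \<in> C i" "x \<in> A" "y \<in> C i" "y \<in> B" by blast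
        then have "d \<le> dist x y" "dist x y \<le> diameter (C i)"
          using sep C(3) by (auto intro: diameter_bounded_bound)
        with C(3) that show False by (meson leD order_trans)
      qed
      then show "hausdorff_weight m (CA i) + hausdorff_weight m (CB i) \<le> hausdorff_weight m (C i)"
        by (auto simp: CA_def CB_def)
    qed auto
    finally show "hausdorff_content m \<delta> A + hausdorff_content m \<delta> B \<le> (\<Sum>i. hausdorff_weight m (C i))" .
  qed
  have "hausdorff_outer m A + hausdorff_outer m B =
      (SUP \<delta>\<in>{0<..}. hausdorff_content m \<delta> A + hausdorff_content m \<delta> B)"
    unfolding hausdorff_outer_def
  proof (rule SUP_add_directed_ennreal[symmetric])
    fix i j :: real assume "i \<in> {0<..}" "j \<in> {0<..}"
    then show "\<exists>k\<in>{0<..}. hausdorff_content m i A + hausdorff_content m j B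
        \<le> hausdorff_content m k A + hausdorff_content m k B"
      by (intro bexI[of _ "min i j"] add_mono hausdorff_content_antimono) auto
  qed
  also have "\<dots> \<le> hausdorff_outer m (A \<union> B)"
  proof (rule SUP_least)
    fix \<delta> :: real assume \<delta>: "\<delta> \<in> {0<..}"
    let ?k = "min \<delta> (d / 2)"
    have "hausdorff_content m \<delta> A + hausdorff_content m \<delta> B
        \<le> hausdorff_content m ?k A + hausdorff_content m ?k B"
      by (intro add_mono hausdorff_content_antimono) auto
    also have "\<dots> \<le> hausdorff_content m ?k (A \<union> B)"
      using \<delta> d by (intro *) auto
    also have "\<dots> \<le> hausdorff_outer m (A \<union> B)"
      unfolding hausdorff_outer_def using \<delta> d by (intro SUP_upper) auto
    finally show "hausdorff_content m \<delta> A + hausdorff_content m \<delta> B \<le> hausdorff_outer m (A \<union> B)" .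
  qed
  finally show ?thesis .
qed

lemma hausdorff_outer_infdist:
  assumes "a < b" "\<And>x. x \<in> A \<Longrightarrow> infdist x F \<le> a" "\<And>x. x \<in> B \<Longrightarrow> b \<le> infdist x F"
  shows "hausdorff_outer m A + hausdorff_outer m B \<le> hausdorff_outer m (A \<union> B)"
proof (rule hausdorff_outer_separated[of "b - a"])
  fix x y assume "x \<in> A" "y \<in> B"
  then have "infdist x F \<le> a" "b \<le> infdist y F" using assms by auto
  with infdist_triangle[of y F x] show "b - a \<le> dist x y" by (simp add: dist_commute)
qed (use assms in auto)

lemma closed_hausdorff_measurable:
  fixes F :: "'a::metric_space set"
  assumes F: "closed F" "F \<noteq> {}"
  shows "hausdorff_outer m (X \<inter> F) + hausdorff_outer m (X - F) \<le> hausdorff_outer m X"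
proof (cases "hausdorff_outer m X = top")
  case False
  let ?h = "hausdorff_outer m"
  define A where "A n = {x \<in> X. 1 / real (Suc n) \<le> infdist x F}" for n
  define R where "R n = A (Suc n) - A n" for n
  have R: "1 / real (Suc (Suc n)) \<le> infdist x F" "infdist x F < 1 / real (Suc n)" "x \<in> X"
    if "x \<in> R n" for x n
    using that by (auto simp: R_def A_def)
  have half: "(\<Sum>k<N. ?h (R (2 * k + p))) \<le> ?h (\<Union>k<N. R (2 * k + p))" for N p
  proof (induction N)
    case (Suc N)
    have "(\<Sum>k<Suc N. ?h (R (2 * k + p))) \<le> ?h (R (2 * N + p)) + ?h (\<Union>k<N. R (2 * k + p))"
      using Suc by (simp add: add.commute add_left_mono)
    also have "\<dots> \<le> ?h (R (2 * N + p) \<union> (\<Union>k<N. R (2 * k + p)))"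
    proof (cases "N = 0")
      case N: False
      show ?thesis
      proof (rule hausdorff_outer_infdist[where F = F and a = "1 / real (2 * N + p + 1)"
            and b = "1 / real (2 * N + p)"])
        fix x assume "x \<in> (\<Union>k<N. R (2 * k + p))"
        then obtain k where k: "k < N" "x \<in> R (2 * k + p)" by auto
        have "1 / real (2 * N + p) \<le> 1 / real (Suc (Suc (2 * k + p)))"
          using k(1) by (intro divide_left_mono) auto
        also have "\<dots> \<le> infdist x F" using R[OF k(2)] by simp
        finally show "1 / real (2 * N + p) \<le> infdist x F" .
      qed (use N in \<open>auto dest!: R(2) simp: field_simps\<close>)
    qed simp
    also have "R (2 * N + p) \<union> (\<Union>k<N. R (2 * k + p)) = (\<Union>k<Suc N. R (2 * k + p))"
      by (auto simp: lessThan_Suc)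
    finally show ?case .
  qed simp
  have half': "(\<Sum>k<N. ?h (R (2 * k + p))) \<le> ?h X" for N p
    
    by (rule order_trans[OF half]) (use R(3) in \<open>blast intro: hausdorff_outer_mono\<close>)
  have "(\<Sum>k. ?h (R k)) \<le> ?h X + ?h X"
  proof (rule suminf_le_const)
    fix N
    have "(\<Sum>k<N. ?h (R k)) \<le> (\<Sum>k<N * 2. ?h (R k))"
      by (intro sum_mono2) auto
    also have "\<dots> = (\<Sum>k<N. ?h (R (2 * k)) + ?h (R (2 * k + 1)))"
      by (induction N) (auto simp: algebra_simps)
    also have "\<dots> \<le> ?h X + ?h X"
      using half'[of 0 N] half'[of 1 N] by (simp add: sum.distrib add_mono)
    finally show "(\<Sum>k<N. ?h (R k)) \<le> ?h X + ?h X" .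
  qed simp
  also have "\<dots> < top" using False by (simp add: top.not_eq_extremum)
  finally have fin: "(\<Sum>k. ?h (R k)) \<noteq> top" by simp
  have le: "?h (X \<inter> F) + ?h (X - F) \<le> ?h X + (\<Sum>k. ?h (R (k + n)))" for n
  proof -
    have "X - F \<subseteq> A n \<union> (\<Union>k. R (k + n))"
    proof
      fix x assume x: "x \<in> X - F"
      then have "infdist x F > 0"
        using F by (intro infdist_pos_not_in_closed) auto
      then obtain j where "1 / real (Suc j) < infdist x F"
        using reals_Archimedean by (metis inverse_eq_divide)
      then have "x \<in> A j" using x by (auto simp: A_def)
      then have ex: "\<exists>j. x \<in> A j" ..
      define j where "j = (LEAST j. x \<in> A j)"
      have xj: "x \<in> A j" unfolding j_def by (rule LeastI_ex[OF ex])
      have mono: "A i \<subseteq> A k" if "i \<le> k" for i k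
      proof -
        have "1 / real (Suc k) \<le> 1 / real (Suc i)" using that by (intro divide_left_mono) auto
        then show ?thesis by (auto simp: A_def)
      qed
      show "x \<in> A n \<union> (\<Union>k. R (k + n))"
      proof (cases "j \<le> n")
        case False
        then obtain i where i: "j = Suc i" "n \<le> i" by (cases j) auto
        then have "x \<notin> A i" using not_less_Least[of i "\<lambda>j. x \<in> A j"] by (auto simp: j_def)
        then have "x \<in> R ((i - n) + n)" using xj i by (auto simp: R_def)
        then show ?thesis by blast
      qed (use xj mono in auto)
    qed
    then have "?h (X - F) \<le> ?h (A n \<union> (\<Union>k. R (k + n)))" by (rule hausdorff_outer_mono)
    also have "\<dots> \<le> ?h (A n) + (\<Sum>k. ?h (R (k + n)))"
      by (rule order_trans[OF hausdorff_outer_Un]) (intro add_left_mono hausdorff_outer_UN)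
    finally have "?h (X \<inter> F) + ?h (X - F) \<le> (?h (X \<inter> F) + ?h (A n)) + (\<Sum>k. ?h (R (k + n)))"
      by (simp add: add.assoc add_left_mono)
    also have "?h (X \<inter> F) + ?h (A n) \<le> ?h ((X \<inter> F) \<union> A n)"
      by (rule hausdorff_outer_infdist[where F = F and a = 0 and b = "1 / real (Suc n)"])
        (auto simp: A_def)
    also have "\<dots> \<le> ?h X" by (rule hausdorff_outer_mono) (auto simp: A_def)
    finally show ?thesis by (simp add: add_right_mono)
  qed
  define r where "r k = enn2real (?h (R k))" for k
  have Rr: "?h (R k) = ennreal (r k)" for k
  proof -
    have "?h (R k) < top"
      using fin by (intro ennreal_suminf_lessD[of "\<lambda>k. ?h (R k)"]) (simp add: top.not_eq_extremum)
    then show ?thesis by (simp add: r_def)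
  qed
  have r0: "0 \<le> r k" for k by (simp add: r_def)
  have sr: "summable r"
  proof (rule summable_suminf_not_top[OF r0])
    show "(\<Sum>k. ennreal (r k)) \<noteq> top" using fin unfolding Rr .
  qed
  have "(\<lambda>n. \<Sum>k. r (k + n)) \<longlonglongrightarrow> 0"
    using suminf_exist_split2[OF sr] .
  then have "(\<lambda>n. ennreal (\<Sum>k. r (k + n))) \<longlonglongrightarrow> ennreal 0" by (rule tendsto_ennrealI)
  moreover have "(\<Sum>k. ?h (R (k + n))) = ennreal (\<Sum>k. r (k + n))" for n
    unfolding Rr using r0 summable_ignore_initial_segment[OF sr] by (intro suminf_ennreal2) auto
  ultimately have "(\<lambda>n. ?h X + (\<Sum>k. ?h (R (k + n)))) \<longlonglongrightarrow> ?h X + 0"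
    by (intro tendsto_add) auto
  then show ?thesis using le by (intro LIMSEQ_le_const[of _ "?h X"]) auto
qed simp

lemma measure_space_hausdorff:
  "measure_space UNIV (sets borel) (hausdorff_outer m :: 'a::metric_space set \<Rightarrow> ennreal)"
proof -
  let ?L = "lambda_system UNIV (Pow UNIV) (hausdorff_outer m :: 'a set \<Rightarrow> ennreal)"
  interpret P: sigma_algebra UNIV "Pow UNIV :: 'a set set" by (rule sigma_algebra_Pow)
  have L: "measure_space UNIV ?L (hausdorff_outer m)"
    by (rule P.caratheodory_lemma) (rule outer_measure_space_hausdorff)
  then interpret L: sigma_algebra UNIV ?L by (simp add: measure_space_def)
  have "F \<in> ?L" if "closed F" for F :: "'a set"
  proof (cases "F = {}")
    case False
    have "hausdorff_outer m (X \<inter> F) + hausdorff_outer m (X - F) = hausdorff_outer m X" for X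
      using closed_hausdorff_measurable[OF that False, of m X]
        hausdorff_outer_Un[of m "X \<inter> F" "X - F"] by (auto intro!: antisym simp: Int_Diff_Un)
    then show ?thesis by (subst P.lambda_system_eq) auto
  qed (use L.empty_sets in auto)
  then have "sigma_sets UNIV (Collect closed) \<subseteq> ?L"
    by (intro L.sigma_sets_subset) auto
  then have "sets (borel :: 'a measure) \<subseteq> ?L"
    by (simp add: borel_eq_closed)
  moreover have "countably_additive ?L (hausdorff_outer m)"
    using L by (simp only: measure_space_def)
  ultimately have "countably_additive (sets borel) (hausdorff_outer m :: 'a set \<Rightarrow> ennreal)"
    unfolding countably_additive_def by (meson order_trans subsetD)
  then show ?thesis
    using sets.sigma_algebra_axioms[of "borel :: 'a measure"]
    by (simp add: measure_space_def positive_def)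
qed

lemma sets_hausdorff_measure [measurable_cong, simp]: "sets (hausdorff_measure m) = sets borel"
  and space_hausdorff_measure [simp]: "space (hausdorff_measure m) = UNIV"
  by (simp_all add: hausdorff_measure_def sets.sigma_sets_eq[of borel, simplified])

lemma emeasure_hausdorff_measure:
  "A \<in> sets borel \<Longrightarrow> emeasure (hausdorff_measure m) A = hausdorff_outer m A"
  using measure_space_hausdorff[of m]
  by (intro emeasure_measure_of[OF hausdorff_measure_def]) (auto simp: measure_space_def)


section \<open>Generalized Young functions\<close>

text \<open>Functions on \<open>[0,\<infinity>)\<close> are rendered as functions on the reals of which only the values at
  nonnegative arguments are constrained and used.\<close>

definition generalized_young ::
    "('a::euclidean_space \<Rightarrow> 'a \<Rightarrow> real \<Rightarrow> real) \<Rightarrow> ('a \<Rightarrow> 'a \<Rightarrow> real \<Rightarrow> real) \<Rightarrow> bool" where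
  "generalized_young g G \<longleftrightarrow>
     (\<forall>x y. g x y 0 = 0 \<and> (\<forall>t>0. g x y t > 0)) \<and>
     (\<forall>x y. mono_on {0..} (g x y)) \<and>
     (\<forall>x y. (\<forall>t\<ge>0. continuous (at_right t) (g x y)) \<and> filterlim (g x y) at_top at_top) \<and>
     (\<forall>x y. \<forall>t\<ge>0. G x y t = integral {0..t} (g x y)) \<and>
     (\<forall>t\<ge>0. (\<lambda>(x, y). G x y t) \<in> borel_measurable lebesgue)"

definition cond_H1 :: "('a::euclidean_space \<Rightarrow> 'a \<Rightarrow> real \<Rightarrow> real) \<Rightarrow> bool" where
  "cond_H1 G \<longleftrightarrow> (\<exists>C1 C2. 0 < C1 \<and> C1 \<le> C2 \<and> (\<forall>x y. C1 \<le> G x y 1 \<and> G x y 1 \<le> C2))"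

definition cond_H2 :: "('a::euclidean_space \<Rightarrow> 'a \<Rightarrow> real \<Rightarrow> real) \<Rightarrow> bool" where
  "cond_H2 G \<longleftrightarrow> (\<forall>x. \<forall>t\<ge>0. continuous_on UNIV (\<lambda>y. G x y t))"

definition cond_H3 ::
    "('a::euclidean_space \<Rightarrow> 'a \<Rightarrow> real \<Rightarrow> real) \<Rightarrow> ('a \<Rightarrow> 'a \<Rightarrow> real \<Rightarrow> real) \<Rightarrow> bool" where
  "cond_H3 g G \<longleftrightarrow> (\<exists>pm pp. 1 < pm \<and> pm \<le> pp \<and>
     (\<forall>x y. \<forall>t>0. pm \<le> t * g x y t / G x y t \<and> t * g x y t / G x y t \<le> pp))"


section \<open>Test functions and gradient\<close>

definition C2_compact_support :: "('a::euclidean_space \<Rightarrow> real) \<Rightarrow> bool" where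
  "C2_compact_support u \<longleftrightarrow> compact (closure {x. u x \<noteq> 0}) \<and>
     (\<exists>(u' :: 'a \<Rightarrow> 'a \<Rightarrow>\<^sub>L real) (u'' :: 'a \<Rightarrow> 'a \<Rightarrow>\<^sub>L 'a \<Rightarrow>\<^sub>L real).
        (\<forall>x. (u has_derivative blinfun_apply (u' x)) (at x)) \<and>
        (\<forall>x. (u' has_derivative blinfun_apply (u'' x)) (at x)) \<and>
        continuous_on UNIV u'')"

definition gradient :: "('a::euclidean_space \<Rightarrow> real) \<Rightarrow> 'a \<Rightarrow> 'a" where
  "gradient u x = (THE D. GDERIV u x :> D)"


section \<open>Energies and Luxemburg quantities\<close>

text \<open>All integrands are nonnegative, so the integrals and the Luxemburg quantities take values in
  \<open>[0,\<infinity>]\<close>; in particular, the infimum of the empty set is \<open>\<infinity>\<close>. The quotients at \<open>x = y\<close>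
  (where division by zero returns zero) only concern a null set.\<close>

definition energy ::
    "real \<Rightarrow> (real^'n \<Rightarrow> real^'n \<Rightarrow> real \<Rightarrow> real) \<Rightarrow> (real^'n \<Rightarrow> real) \<Rightarrow> ennreal" where
  "energy s G u = (\<integral>\<^sup>+ (x, y).
     ennreal (G x y (\<bar>u x - u y\<bar> / norm (x - y) powr s) / norm (x - y) ^ CARD('n)) \<partial>lebesgue)"

definition luxemburg_frac ::
    "real \<Rightarrow> (real^'n \<Rightarrow> real^'n \<Rightarrow> real \<Rightarrow> real) \<Rightarrow> (real^'n \<Rightarrow> real) \<Rightarrow> ennreal" where
  "luxemburg_frac s G u =
     Inf {ennreal l | l. 0 < l \<and> ennreal (1 - s) * energy s G (\<lambda>x. u x / l) \<le> 1}"

text \<open>The index type \<open>'n\<close> carries no order; the coordinate called the \<open>n\<close>-th one is a parameter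
  \<open>k\<close>, so that a statement for all \<open>k\<close> covers every enumeration of the coordinates.\<close>

definition H0 ::
    "'n \<Rightarrow> (real^'n \<Rightarrow> real^'n \<Rightarrow> real \<Rightarrow> real) \<Rightarrow> real^'n \<Rightarrow> real \<Rightarrow> ennreal" where
  "H0 k G x t =
     (\<integral>\<^sup>+ r\<in>{0<..<1}. (\<integral>\<^sup>+ w\<in>sphere 0 1. ennreal (G x x (t * \<bar>w $ k\<bar> * r))
        \<partial>hausdorff_measure (CARD('n) - 1)) * ennreal (1 / r) \<partial>lebesgue)"

definition luxemburg_grad :: "(real^'n \<Rightarrow> real \<Rightarrow> ennreal) \<Rightarrow> (real^'n \<Rightarrow> real) \<Rightarrow> ennreal" where
  "luxemburg_grad H u =
     Inf {ennreal l | l. 0 < l \<and> (\<integral>\<^sup>+ x. H x (norm (gradient u x) / l) \<partial>lebesgue) \<le> 1}"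

end

theory Submission
  imports Defs
begin

text \<open>Write \<open>y = x + r w\<close> with \<open>0 < r\<close> and \<open>norm w = 1\<close>. Near the diagonal the quotient
  \<open>\<bar>u x - u y\<bar> / r powr s\<close> is about \<open>\<bar>\<nabla>u x \<bullet> w\<bar> * r powr (1 - s)\<close>, and the kernel
  \<open>dy / norm (x - y) ^ n\<close> is \<open>dr / r\<close> times the surface measure. The substitution
  \<open>\<rho> = r powr (1 - s)\<close> turns \<open>(1 - s) dr / r\<close> into \<open>d\<rho> / \<rho>\<close> and keeps the interval \<open>(0, 1)\<close>; for a
  fixed \<open>\<rho> < 1\<close> the radius \<open>r = \<rho> powr (1 / (1 - s))\<close> tends to \<open>0\<close> as \<open>s\<close> increases to \<open>1\<close>. So
  continuity of \<open>G\<close> in its second and third arguments and dominated convergence give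
  \<open>(1 - s) * energy s G u \<longlonglongrightarrow> \<integral>\<integral>\<integral> G x x (\<rho> * \<bar>\<nabla>u x \<bullet> w\<bar>) dS d\<rho>/\<rho> dx\<close> (\<open>energy_tendsto\<close>). The pairs at
  distance more than \<open>1\<close> have an energy that is bounded uniformly in \<open>s \<ge> 1 / 2\<close>, so the factor
  \<open>1 - s\<close> removes them.

  The bound that dominates comes from the growth condition: the ratio \<open>t * g / G\<close> is bounded, so
  \<open>G\<close> satisfies a doubling condition, and \<open>G x y\<close> is Lipschitz on every bounded interval with
  a constant that does not depend on \<open>x\<close> and \<open>y\<close> (\<open>young_lipschitz\<close>).

  To pass from energies to Luxemburg quantities, let \<open>l\<close> be admissible for \<open>\<nabla>u\<close> and \<open>l < m\<close>.
  As \<open>G x y\<close> is convex and vanishes at \<open>0\<close>, the limit for \<open>u / m\<close> is at most \<open>l / m < 1\<close>, so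
  \<open>m\<close> is admissible for \<open>u\<close> for all \<open>s\<close> close to \<open>1\<close>.

  Polar coordinates hold almost by construction for the cone measure, which gives a Borel set \<open>A\<close> of
  directions \<open>n\<close> times the Lebesgue measure of the solid cone over \<open>A\<close>. The function \<open>H0\<close> is however
  defined with the Hausdorff measure of dimension \<open>n - 1\<close>, and what the inequality needs is that the
  cone measure is at most the Hausdorff measure (\<open>cone_measure_le_hausdorff\<close>). A piece \<open>C\<close> of the
  sphere of small diameter \<open>d\<close> is almost flat: a thin shell over \<open>C\<close>, projected to the tangent
  hyperplane, covers a set of diameter about \<open>d\<close>, and the isodiametric inequality in dimension
  \<open>n - 1\<close> bounds the measure of that set by the one of a ball of diameter \<open>d\<close>, which is exactly the
  weight of \<open>C\<close> in the definition of the Hausdorff measure. The isodiametric inequality follows by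
  Steiner symmetrization in all coordinates: this changes neither the measure nor a bound on
  the diameter, and ends with a set that is symmetric about the origin, hence contained in the ball of
  half the diameter as radius.\<close>

section \<open>The isodiametric inequality\<close>

lemma emeasure_lborel_le_bound:
  fixes A :: "real set"
  assumes "A \<in> sets lborel" "\<And>s t. s \<in> A \<Longrightarrow> t \<in> A \<Longrightarrow> \<bar>s - t\<bar> \<le> d" "0 \<le> d"
  shows "emeasure lborel A \<le> ennreal d"
proof (cases "A = {}")
  case False
  then obtain a where a: "a \<in> A" by blast
  have bdd: "bdd_below A"
    by (rule bdd_belowI[of _ "a - d"]) (use assms(2)[OF a] in force)
  have "A \<subseteq> {Inf A..Inf A + d}"
  proof
    fix t assume t: "t \<in> A"
    have "t - d \<le> Inf A"
      using False by (intro cInf_greatest) (use assms(2)[OF t] in force)+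
    then show "t \<in> {Inf A..Inf A + d}" using cInf_lower[OF t bdd] by auto
  qed
  then have "emeasure lborel A \<le> emeasure lborel {Inf A..Inf A + d}"
    by (intro emeasure_mono) auto
  then show ?thesis using assms(3) by simp
qed simp

text \<open>A set lies in the interval between its infimum and its supremum, so \<open>A\<close> and \<open>B\<close> have lengths
  more than \<open>2 * \<bar>s\<bar>\<close> and \<open>2 * \<bar>t\<bar>\<close>. The two distances between opposite ends add up to at least the
  sum of the lengths, so one of them exceeds \<open>\<bar>s\<bar> + \<bar>t\<bar>\<close>. This is why Steiner symmetrization does
  not increase the diameter.\<close>

lemma sections_far_apart:
  fixes A B :: "real set"
  assumes meas: "A \<in> sets lborel" "B \<in> sets lborel"
    and s: "ennreal (2 * \<bar>s\<bar>) < emeasure lborel A" and t: "ennreal (2 * \<bar>t\<bar>) < emeasure lborel B"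
  shows "\<exists>a\<in>A. \<exists>b\<in>B. \<bar>s - t\<bar> \<le> \<bar>a - b\<bar>"
proof (rule ccontr)
  assume "\<not> ?thesis"
  then have lt: "\<bar>a - b\<bar> < \<bar>s - t\<bar>" if "a \<in> A" "b \<in> B" for a b
    using that by (meson not_le)
  have "A \<noteq> {}" "B \<noteq> {}" using s t by auto
  then obtain a0 b0 where ab: "a0 \<in> A" "b0 \<in> B" by blast
  have bA: "bdd_above A" "bdd_below A"
    by (rule bdd_aboveI[of _ "b0 + \<bar>s - t\<bar>"] bdd_belowI[of _ "b0 - \<bar>s - t\<bar>"]; use lt[OF _ ab(2)] in force)+
  have bB: "bdd_above B" "bdd_below B"
    by (rule bdd_aboveI[of _ "a0 + \<bar>s - t\<bar>"] bdd_belowI[of _ "a0 - \<bar>s - t\<bar>"]; use lt[OF ab(1)] in force)+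
  have 1: "Sup A - Inf B \<le> \<bar>s - t\<bar>"
  proof -
    have "Sup A \<le> b + \<bar>s - t\<bar>" if "b \<in> B" for b
      using \<open>A \<noteq> {}\<close> by (intro cSup_least) (use lt[OF _ that] in force)+
    then have "Sup A - \<bar>s - t\<bar> \<le> Inf B"
      using \<open>B \<noteq> {}\<close> by (intro cInf_greatest) force+
    then show ?thesis by simp
  qed
  have 2: "Sup B - Inf A \<le> \<bar>s - t\<bar>"
  proof -
    have "Sup B \<le> a + \<bar>s - t\<bar>" if "a \<in> A" for a
      using \<open>B \<noteq> {}\<close> by (intro cSup_least) (use lt[OF that] in force)+
    then have "Sup B - \<bar>s - t\<bar> \<le> Inf A"
      using \<open>A \<noteq> {}\<close> by (intro cInf_greatest) force+
    then show ?thesis by simp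
  qed
  have le: "2 * \<bar>r\<bar> < Sup C - Inf C"
    if "C \<in> sets lborel" "ennreal (2 * \<bar>r\<bar>) < emeasure lborel C" "bdd_above C" "bdd_below C" "C \<noteq> {}" for C and r :: real
  proof -
    have *: "C \<subseteq> {Inf C..Sup C}" using that by (auto intro: cInf_lower cSup_upper)
    then have "emeasure lborel C \<le> emeasure lborel {Inf C..Sup C}" by (intro emeasure_mono) auto
    also have "\<dots> = ennreal (Sup C - Inf C)" using * that(5) by (subst emeasure_lborel_Icc) auto
    finally have "ennreal (2 * \<bar>r\<bar>) < ennreal (Sup C - Inf C)" using that(2) by (rule order_less_le_trans[rotated])
    then show ?thesis by (simp add: ennreal_less_iff)
  qed
  from le[OF meas(1) s bA \<open>A \<noteq> {}\<close>] le[OF meas(2) t bB \<open>B \<noteq> {}\<close>] 1 2 show False by linarith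
qed

lemma emeasure_symmetric_interval:
  "emeasure lborel {t::real. ennreal (2 * \<bar>t\<bar>) < c} = c"
proof (cases c)
  case (real r)
  then have "{t::real. ennreal (2 * \<bar>t\<bar>) < c} = {-(r/2)<..<r/2}"
    by (auto simp: ennreal_less_iff)
  then show ?thesis using real by simp
qed simp

abbreviation lborel_PiM :: "'i set \<Rightarrow> ('i \<Rightarrow> real) measure" where
  "lborel_PiM I \<equiv> Pi\<^sub>M I (\<lambda>_. lborel)"

abbreviation diam_le :: "'i set \<Rightarrow> real \<Rightarrow> ('i \<Rightarrow> real) set \<Rightarrow> bool" where
  "diam_le I D K \<equiv> (\<forall>x\<in>K. \<forall>y\<in>K. (\<Sum>i\<in>I. (x i - y i)\<^sup>2) \<le> D\<^sup>2)"

definition flip_coords :: "'i set \<Rightarrow> 'i set \<Rightarrow> ('i \<Rightarrow> real) \<Rightarrow> 'i \<Rightarrow> real" where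
  "flip_coords I T x = (\<lambda>i\<in>I. if i \<in> T then - x i else x i)"

definition flip_invariant :: "'i set \<Rightarrow> 'i set \<Rightarrow> ('i \<Rightarrow> real) set \<Rightarrow> bool" where
  "flip_invariant I J K \<longleftrightarrow> (\<forall>T\<subseteq>J. \<forall>x\<in>K. flip_coords I T x \<in> K)"

text \<open>Every section in direction \<open>i\<close> is replaced by the open interval of the same length centred at
  \<open>0\<close>. With an open interval the condition also excludes the points over empty sections.\<close>

definition steiner :: "'i set \<Rightarrow> 'i \<Rightarrow> ('i \<Rightarrow> real) set \<Rightarrow> ('i \<Rightarrow> real) set" where
  "steiner I i K = {x \<in> space (lborel_PiM I).
     ennreal (2 * \<bar>x i\<bar>) < emeasure lborel {t. x(i := t) \<in> K}}"

context
  fixes I :: "'i set" and i :: 'i and K :: "('i \<Rightarrow> real) set"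
  assumes I: "finite I" "i \<in> I" and K[measurable]: "K \<in> sets (lborel_PiM I)"
begin

lemma upd_measurable: "(\<lambda>(x, t). x(i := t)) \<in> lborel_PiM I \<Otimes>\<^sub>M lborel \<rightarrow>\<^sub>M lborel_PiM I"
proof -
  have "(\<lambda>p. (fst p)(i := snd p)) \<in> lborel_PiM I \<Otimes>\<^sub>M lborel \<rightarrow>\<^sub>M lborel_PiM I"
    by (rule measurable_fun_upd[where J = I]) (use I in auto)
  then show ?thesis by (simp add: case_prod_unfold)
qed

lemma section_measurable:
  assumes "x \<in> space (lborel_PiM I)" shows "{t. x(i := t) \<in> K} \<in> sets lborel"
proof -
  have "(\<lambda>t. (x, t)) \<in> lborel \<rightarrow>\<^sub>M lborel_PiM I \<Otimes>\<^sub>M lborel" using assms by simp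
  from measurable_compose[OF this upd_measurable]
  have "(\<lambda>t. x(i := t)) \<in> lborel \<rightarrow>\<^sub>M lborel_PiM I" by simp
  from measurable_sets[OF this K] show ?thesis by (simp add: vimage_def)
qed

lemma section_emeasure_measurable:
  "(\<lambda>x. emeasure lborel {t. x(i := t) \<in> K}) \<in> borel_measurable (lborel_PiM I)"
proof -
  have "{p \<in> space (lborel_PiM I \<Otimes>\<^sub>M lborel). (\<lambda>(x, t). x(i := t)) p \<in> K} \<in> sets (lborel_PiM I \<Otimes>\<^sub>M lborel)"
    using measurable_sets[OF upd_measurable K] by (simp add: vimage_def Int_def conj_commute)
  from lborel.measurable_emeasure_Pair[OF this]
  show ?thesis
    by (rule measurable_cong[THEN iffD1, rotated]) (auto simp: space_pair_measure vimage_def)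
qed

lemma steiner_measurable: "steiner I i K \<in> sets (lborel_PiM I)"
proof -
  have "(\<lambda>x. x i) \<in> borel_measurable (lborel_PiM I)"
    using measurable_component_singleton[OF I(2), of "\<lambda>_. lborel :: real measure"] by simp
  then have "(\<lambda>x. ennreal (2 * \<bar>x i\<bar>)) \<in> borel_measurable (lborel_PiM I)" by simp
  then show ?thesis unfolding steiner_def
    using section_emeasure_measurable by (rule borel_measurable_less)
qed

lemma emeasure_eq_sections:
  assumes L: "L \<in> sets (lborel_PiM I)"
  shows "emeasure (lborel_PiM I) L =
    (\<integral>\<^sup>+x. emeasure lborel {t. x(i := t) \<in> L} \<partial>lborel_PiM (I - {i}))"
proof -
  interpret product_sigma_finite "\<lambda>_::'i. lborel :: real measure" by standard
  have ins: "insert i (I - {i}) = I" using I by auto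
  have "emeasure (lborel_PiM I) L = (\<integral>\<^sup>+x. indicator L x \<partial>lborel_PiM (insert i (I - {i})))"
    unfolding ins using L by (rule nn_integral_indicator[symmetric])
  also have "\<dots> = (\<integral>\<^sup>+x. \<integral>\<^sup>+t. indicator L (x(i := t)) \<partial>lborel \<partial>lborel_PiM (I - {i}))"
    by (rule product_nn_integral_insert) (use I L ins in auto)
  also have "\<dots> = (\<integral>\<^sup>+x. emeasure lborel {t. x(i := t) \<in> L} \<partial>lborel_PiM (I - {i}))"
  proof (rule nn_integral_cong)
    fix x assume x: "x \<in> space (lborel_PiM (I - {i}))"
    have "(\<lambda>t. (x, t)) \<in> lborel \<rightarrow>\<^sub>M lborel_PiM (I - {i}) \<Otimes>\<^sub>M lborel" using x by simp
    from measurable_compose[OF this measurable_add_dim[of i]]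
    have "(\<lambda>t. x(i := t)) \<in> lborel \<rightarrow>\<^sub>M lborel_PiM I" unfolding ins by simp
    from measurable_sets[OF this L] have "{t. x(i := t) \<in> L} \<in> sets lborel" by (simp add: vimage_def)
    then show "(\<integral>\<^sup>+t. indicator L (x(i := t)) \<partial>lborel) = emeasure lborel {t. x(i := t) \<in> L}"
      by (simp add: nn_integral_indicator[symmetric] indicator_def[abs_def] del: nn_integral_indicator)
  qed
  finally show ?thesis .
qed

lemma emeasure_steiner: "emeasure (lborel_PiM I) (steiner I i K) = emeasure (lborel_PiM I) K"
  unfolding emeasure_eq_sections[OF steiner_measurable] emeasure_eq_sections[OF K]
proof (rule nn_integral_cong)
  fix x assume "x \<in> space (lborel_PiM (I - {i}))"
  then have "x(i := t) \<in> space (lborel_PiM I)" for t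
    using I by (auto simp: space_PiM PiE_iff extensional_def)
  then have "{t. x(i := t) \<in> steiner I i K} =
      {t. ennreal (2 * \<bar>t\<bar>) < emeasure lborel {t. x(i := t) \<in> K}}"
    by (simp add: steiner_def)
  then show "emeasure lborel {t. x(i := t) \<in> steiner I i K} = emeasure lborel {t. x(i := t) \<in> K}"
    by (simp add: emeasure_symmetric_interval)
qed

lemma diam_steiner:
  assumes "diam_le I D K"
  shows "diam_le I D (steiner I i K)"
proof (intro ballI)
  fix x y assume x: "x \<in> steiner I i K" and y: "y \<in> steiner I i K"
  obtain a b where ab: "x(i := a) \<in> K" "y(i := b) \<in> K" "\<bar>x i - y i\<bar> \<le> \<bar>a - b\<bar>"
    using sections_far_apart[of "{t. x(i := t) \<in> K}" "{t. y(i := t) \<in> K}" "x i" "y i"] x y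
      section_measurable unfolding steiner_def by auto
  have "(\<Sum>j\<in>I. (x j - y j)\<^sup>2) = (x i - y i)\<^sup>2 + (\<Sum>j\<in>I-{i}. (x j - y j)\<^sup>2)"
    using I by (simp add: sum.remove)
  also have "\<dots> \<le> (a - b)\<^sup>2 + (\<Sum>j\<in>I-{i}. (x j - y j)\<^sup>2)"
    using ab(3) by (simp add: abs_le_square_iff)
  also have "\<dots> = (\<Sum>j\<in>I. ((x(i := a)) j - (y(i := b)) j)\<^sup>2)"
    using I by (simp add: sum.remove)
  also have "\<dots> \<le> D\<^sup>2" using assms ab by blast
  finally show "(\<Sum>j\<in>I. (x j - y j)\<^sup>2) \<le> D\<^sup>2" .
qed

text \<open>Symmetrization in a new direction keeps the symmetries obtained before, because a flip of other
  coordinates maps sections to sections. After all coordinates the set is invariant under all flips, in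
  particular under the reflection in the origin.\<close>

lemma flip_invariant_steiner:
  assumes "flip_invariant I J K"
  shows "flip_invariant I (insert i J) (steiner I i K)"
  unfolding flip_invariant_def
proof (intro allI impI ballI)
  fix T x assume T: "T \<subseteq> insert i J" and x: "x \<in> steiner I i K"
  have ext: "x \<in> extensional I" using x by (auto simp: steiner_def space_PiM PiE_iff)
  let ?T = "T - {i}"
  have *: "(flip_coords I T x)(i := t) = flip_coords I ?T (x(i := t))"
    "x(i := t) = flip_coords I ?T (flip_coords I ?T (x(i := t)))" for t
    using ext I by (auto simp: flip_coords_def fun_eq_iff extensional_def)
  have "(flip_coords I T x)(i := t) \<in> K \<longleftrightarrow> x(i := t) \<in> K" for t
    using assms T unfolding flip_invariant_def
    by (metis *(1) *(2) Diff_subset_conv insert_is_Un)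
  moreover have "\<bar>flip_coords I T x i\<bar> = \<bar>x i\<bar>" using I by (simp add: flip_coords_def)
  moreover have "flip_coords I T x \<in> space (lborel_PiM I)"
    by (auto simp: flip_coords_def space_PiM)
  ultimately show "flip_coords I T x \<in> steiner I i K"
    using x by (simp add: steiner_def)
qed

end

text \<open>The index set is arbitrary because the inequality is used on a hyperplane, whose
  dimension \<open>n - 1\<close> is not the dimension of a given type; for the empty index set both sides are
  \<open>1\<close>.\<close>

theorem isodiametric_inequality:
  assumes I: "finite I" and K: "K \<in> sets (lborel_PiM I)" and diam: "diam_le I D K" and D: "D \<ge> 0"
    and ne: "K \<noteq> {}"
  shows "emeasure (lborel_PiM I) K \<le> ennreal (unit_ball_vol (card I) * (D / 2) ^ card I)"
proof -
  have "\<exists>L\<in>sets (lborel_PiM I). emeasure (lborel_PiM I) L = emeasure (lborel_PiM I) K \<and> diam_le I D L \<and> flip_invariant I J L"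
    if "finite J" "J \<subseteq> I" for J
    using that
  proof (induction J)
    case empty
    have "flip_coords I {} x = x" if "x \<in> K" for x
      using that sets.sets_into_space[OF K] by (auto simp: flip_coords_def space_PiM PiE_iff fun_eq_iff extensional_def)
    then show ?case using K diam by (intro bexI[of _ K]) (auto simp: flip_invariant_def)
  next
    case (insert i J)
    then obtain L where L: "L \<in> sets (lborel_PiM I)" "emeasure (lborel_PiM I) L = emeasure (lborel_PiM I) K"
      "diam_le I D L" "flip_invariant I J L" by auto
    have i: "i \<in> I" using insert.prems by simp
    note st = I i L(1)
    show ?case
    proof (intro bexI conjI)
      show "emeasure (lborel_PiM I) (steiner I i L) = emeasure (lborel_PiM I) K"
        using emeasure_steiner[OF st] L(2) by simp
    qed (rule diam_steiner[OF st L(3)] flip_invariant_steiner[OF st L(4)] steiner_measurable[OF st])+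
  qed
  from this[OF I order_refl] obtain L where L: "L \<in> sets (lborel_PiM I)" "emeasure (lborel_PiM I) L = emeasure (lborel_PiM I) K"
      "diam_le I D L" "flip_invariant I I L" by blast
  have sub: "sqrt (\<Sum>i\<in>I. (x i)\<^sup>2) \<le> D / 2" if x: "x \<in> L" for x
  proof -
    \<comment> \<open>A point and its reflection in the origin are at distance at most \<open>D\<close>.\<close>
    have "flip_coords I I x \<in> L" using L(4) x by (auto simp: flip_invariant_def)
    with L(3) x have "(\<Sum>i\<in>I. (x i - flip_coords I I x i)\<^sup>2) \<le> D\<^sup>2" by blast
    moreover have "(\<Sum>i\<in>I. (x i - flip_coords I I x i)\<^sup>2) = (\<Sum>i\<in>I. 4 * (x i)\<^sup>2)"
      by (intro sum.cong) (auto simp: flip_coords_def power2_eq_square)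
    ultimately have "(\<Sum>i\<in>I. (x i)\<^sup>2) \<le> (D / 2)\<^sup>2"
      by (simp flip: sum_distrib_left add: power_divide)
    then show ?thesis using D by (intro real_le_lsqrt) auto
  qed
  \<comment> \<open>Larger radii are positive also when \<open>D = 0\<close>, where the ball is degenerate.\<close>
  have bound: "emeasure (lborel_PiM I) K \<le> ennreal (unit_ball_vol (card I) * r ^ card I)" if "D / 2 < r" for r
  proof -
    have "emeasure (lborel_PiM I) L \<le> emeasure (lborel_PiM I) ({f. sqrt (\<Sum>i\<in>I. (f i)\<^sup>2) \<le> r} \<inter> space (lborel_PiM I))"
      using sub sets.sets_into_space[OF L(1)] that by (intro emeasure_mono) (force intro: order_trans, measurable)
    also have "\<dots> = ennreal (unit_ball_vol (card I) * r ^ card I)"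
      using that D I by (intro emeasure_cball_aux) auto
    finally show ?thesis using L(2) by simp
  qed
  have lim: "((\<lambda>r. ennreal (unit_ball_vol (card I) * r ^ card I)) \<longlongrightarrow>
      ennreal (unit_ball_vol (card I) * (D / 2) ^ card I)) (at_right (D / 2))"
    by (intro tendsto_intros)
  show ?thesis
    by (rule tendsto_lowerbound[OF lim]) (auto intro!: eventually_mono[OF eventually_at_right_less] bound)
qed

section \<open>The cone measure and polar coordinates\<close>

lemma nn_integral_lborel_shift:
  fixes f :: "'a::euclidean_space \<Rightarrow> ennreal"
  assumes [measurable]: "f \<in> borel_measurable borel"
  shows "(\<integral>\<^sup>+x. f (c + x) \<partial>lborel) = (\<integral>\<^sup>+x. f x \<partial>lborel)"
proof -
  have "(\<integral>\<^sup>+x. f x \<partial>lborel) = (\<integral>\<^sup>+x. f x \<partial>distr lborel borel ((+) c))"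
    by (simp add: lborel_distr_plus)
  also have "\<dots> = (\<integral>\<^sup>+x. f (c + x) \<partial>lborel)" by (rule nn_integral_distr) auto
  finally show ?thesis ..
qed

lemma nn_integral_lborel_scale:
  fixes f :: "'a::euclidean_space \<Rightarrow> ennreal"
  assumes [measurable]: "f \<in> borel_measurable borel" and c: "c \<noteq> 0"
  shows "(\<integral>\<^sup>+x. f x \<partial>lborel) = ennreal (\<bar>c\<bar> ^ DIM('a)) * (\<integral>\<^sup>+x. f (c *\<^sub>R x) \<partial>lborel)"
proof -
  have "(\<integral>\<^sup>+x. f x \<partial>lborel) =
      (\<integral>\<^sup>+x. f x \<partial>density (distr lborel borel (\<lambda>x. 0 + c *\<^sub>R x)) (\<lambda>_. \<bar>c\<bar> ^ DIM('a)))"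
    using lborel_affine[OF c, of "0 :: 'a"] by simp
  also have "\<dots> = (\<integral>\<^sup>+x. ennreal (\<bar>c\<bar> ^ DIM('a)) * f (c *\<^sub>R x) \<partial>lborel)"
    by (subst nn_integral_density) (auto simp: nn_integral_distr)
  also have "\<dots> = ennreal (\<bar>c\<bar> ^ DIM('a)) * (\<integral>\<^sup>+x. f (c *\<^sub>R x) \<partial>lborel)"
    by (rule nn_integral_cmult) auto
  finally show ?thesis .
qed

lemma nn_integral_lborel_reflect:
  fixes f :: "'a::euclidean_space \<Rightarrow> ennreal"
  assumes [measurable]: "f \<in> borel_measurable borel"
  shows "(\<integral>\<^sup>+x. f (c - x) \<partial>lborel) = (\<integral>\<^sup>+x. f x \<partial>lborel)"
  using nn_integral_lborel_scale[of "\<lambda>x. f (c - x)" "-1"] nn_integral_lborel_shift[of f c] by simp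

lemma orthogonal_transformation_measurable:
  "orthogonal_transformation f \<Longrightarrow> f \<in> borel_measurable borel"
  for f :: "'a::euclidean_space \<Rightarrow> 'a"
  by (intro borel_measurable_continuous_onI linear_continuous_on)
    (simp add: orthogonal_transformation_linear linear_conv_bounded_linear[symmetric])

text \<open>The image measure is translation invariant, and two such measures \<open>\<mu>\<close> and \<open>\<lambda>\<close> are
  proportional: integrating \<open>indicator A x * indicator B (x + y)\<close> over \<open>x\<close> and \<open>y\<close> in both orders gives
  \<open>\<mu> A * \<lambda> B = \<mu> B * \<lambda> A\<close>. Since the unit ball is mapped to itself, the factor is \<open>1\<close>.\<close>

lemma lborel_distr_orthogonal:
  fixes f :: "'a::euclidean_space \<Rightarrow> 'a"
  assumes f: "orthogonal_transformation f"
  shows "distr lborel borel f = lborel"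
proof -
  have lin: "linear f" using f by (rule orthogonal_transformation_linear)
  note [measurable] = orthogonal_transformation_measurable[OF f]
  have *: "emeasure (distr lborel borel f) A * emeasure lborel B =
      emeasure (distr lborel borel f) B * emeasure lborel A"
    if [measurable]: "A \<in> sets borel" "B \<in> sets borel" for A B :: "'a set"
  proof -
    have "emeasure (distr lborel borel f) A * emeasure lborel B =
        (\<integral>\<^sup>+z. indicator A (f z) * emeasure lborel B \<partial>lborel)"
      by (subst nn_integral_multc) (auto simp: nn_integral_indicator[symmetric] nn_integral_distr simp del: nn_integral_indicator)
    also have "\<dots> = (\<integral>\<^sup>+z. indicator A (f z) * (\<integral>\<^sup>+y. indicator B (f z + y) \<partial>lborel) \<partial>lborel)"
      by (intro nn_integral_cong, subst nn_integral_lborel_shift) auto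
    also have "\<dots> = (\<integral>\<^sup>+z. \<integral>\<^sup>+y. indicator A (f z) * indicator B (f z + y) \<partial>lborel \<partial>lborel)"
      by (intro nn_integral_cong nn_integral_cmult[symmetric]) auto
    also have "\<dots> = (\<integral>\<^sup>+y. \<integral>\<^sup>+z. indicator A (f z) * indicator B (f z + y) \<partial>lborel \<partial>lborel)"
      by (rule lborel_pair.Fubini'[symmetric]) measurable
    also have "\<dots> = (\<integral>\<^sup>+y. \<integral>\<^sup>+z. indicator A (f z - y) * indicator B (f z) \<partial>lborel \<partial>lborel)"
    proof (rule nn_integral_cong)
      fix y
      obtain w where w: "f w = y" using orthogonal_transformation_surj[OF f] by (metis surj_def)
      have "(\<integral>\<^sup>+z. indicator A (f z) * indicator B (f z + y) \<partial>lborel) =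
          (\<integral>\<^sup>+z. indicator A (f (-w + z)) * indicator B (f (-w + z) + y) \<partial>lborel)"
        by (rule nn_integral_lborel_shift[symmetric, of "\<lambda>z. indicator A (f z) * indicator B (f z + y)"]) measurable
      then show "(\<integral>\<^sup>+z. indicator A (f z) * indicator B (f z + y) \<partial>lborel) =
          (\<integral>\<^sup>+z. indicator A (f z - y) * indicator B (f z) \<partial>lborel)"
        using lin by (simp add: linear_add linear_diff linear_neg w del: mult_indicator_subset)
    qed
    also have "\<dots> = (\<integral>\<^sup>+z. \<integral>\<^sup>+y. indicator A (f z - y) * indicator B (f z) \<partial>lborel \<partial>lborel)"
      by (rule lborel_pair.Fubini') measurable
    also have "\<dots> = (\<integral>\<^sup>+z. (\<integral>\<^sup>+y. indicator A (f z - y) \<partial>lborel) * indicator B (f z) \<partial>lborel)"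
      by (intro nn_integral_cong nn_integral_multc) auto
    also have "\<dots> = (\<integral>\<^sup>+z. emeasure lborel A * indicator B (f z) \<partial>lborel)"
      by (intro nn_integral_cong, subst nn_integral_lborel_reflect) auto
    also have "\<dots> = emeasure (distr lborel borel f) B * emeasure lborel A"
      by (subst nn_integral_cmult) (auto simp: nn_integral_indicator[symmetric] nn_integral_distr mult.commute simp del: nn_integral_indicator)
    finally show ?thesis .
  qed
  show ?thesis
  proof (rule measure_eqI)
    fix A assume "A \<in> sets (distr lborel borel f)"
    then have [measurable]: "A \<in> sets borel" by simp
    have "f -` cball 0 1 = cball 0 1" using orthogonal_transformation_norm[OF f] by auto
    then have "emeasure (distr lborel borel f) (cball 0 1) = emeasure lborel (cball 0 1 :: 'a set)"
      by (simp add: emeasure_distr)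
    with *[of A "cball 0 1"]
    have "emeasure (distr lborel borel f) A * emeasure lborel (cball 0 1 :: 'a set) =
        emeasure lborel A * emeasure lborel (cball 0 1 :: 'a set)"
      by (simp add: mult.commute)
    then show "emeasure (distr lborel borel f) A = emeasure lborel A"
      by (subst (asm) (1 2) mult.commute, subst (asm) ennreal_mult_cancel_left)
        (use unit_ball_vol_pos[of "real DIM('a)"] in \<open>auto simp: emeasure_cball simp del: unit_ball_vol_pos\<close>)
  qed simp
qed

text \<open>The surface measure of the unit sphere, as the normalized image of Lebesgue measure on the
  punctured unit ball. It lives on the whole space and is concentrated on the sphere.\<close>

definition cone_measure :: "'a::euclidean_space measure" where
  "cone_measure = distr (density lborel (\<lambda>x. of_nat DIM('a) * indicator {x. 0 < norm x \<and> norm x \<le> 1} x)) borel sgn"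

lemma sets_cone_measure [measurable_cong, simp]: "sets cone_measure = sets borel"
  and space_cone_measure [simp]: "space cone_measure = UNIV"
  by (simp_all add: cone_measure_def)

definition trunc_cone :: "real \<Rightarrow> 'a::euclidean_space set \<Rightarrow> 'a set" where
  "trunc_cone R A = {x. 0 < norm x \<and> norm x \<le> R \<and> sgn x \<in> A}"

lemma trunc_cone_measurable [measurable]:
  assumes [measurable]: "A \<in> sets borel" shows "trunc_cone R A \<in> sets borel"
  unfolding trunc_cone_def by measurable

lemma emeasure_cone_measure:
  fixes A :: "'a::euclidean_space set"
  assumes [measurable]: "A \<in> sets borel"
  shows "emeasure cone_measure A = of_nat DIM('a) * emeasure lborel (trunc_cone 1 A)"
proof -
  have [measurable]: "sgn -` A \<in> sets borel"
    using measurable_sets_borel[OF borel_measurable_sgn assms] .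
  have "emeasure cone_measure A =
      (\<integral>\<^sup>+x. (of_nat DIM('a) * indicator {x. 0 < norm x \<and> norm x \<le> 1} x) * indicator (sgn -` A) x \<partial>lborel)"
    unfolding cone_measure_def by (subst emeasure_distr) (auto simp: emeasure_density simp del: zero_less_norm_iff)
  also have "\<dots> = (\<integral>\<^sup>+x. of_nat DIM('a) * indicator (trunc_cone 1 A) x \<partial>lborel)"
    by (intro nn_integral_cong) (auto simp: indicator_def trunc_cone_def)
  also have "\<dots> = of_nat DIM('a) * emeasure lborel (trunc_cone 1 A)"
    by (subst nn_integral_cmult) auto
  finally show ?thesis .
qed

lemma finite_cone_measure: "emeasure (cone_measure :: 'a::euclidean_space measure) UNIV < \<infinity>"
proof -
  have "emeasure lborel (trunc_cone 1 UNIV :: 'a set) \<le> emeasure lborel (cball 0 1 :: 'a set)"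
    by (intro emeasure_mono) (auto simp: trunc_cone_def)
  also have "\<dots> < \<infinity>" by (simp add: emeasure_cball)
  finally show ?thesis by (simp add: emeasure_cone_measure ennreal_mult_less_top of_nat_less_top)
qed

interpretation cone_measure: finite_measure cone_measure
  by standard (use finite_cone_measure in \<open>simp add: less_top\<close>)

lemma AE_cone_measure_sphere: "AE w in cone_measure. norm (w :: 'a::euclidean_space) = 1"
proof (rule AE_I)
  have "trunc_cone 1 {w::'a. norm w \<noteq> 1} = {}" by (auto simp: trunc_cone_def norm_sgn)
  then show "emeasure cone_measure {w::'a. norm w \<noteq> 1} = 0"
    by (subst emeasure_cone_measure) simp_all
qed auto

lemma distr_cone_measure_orthogonal:
  fixes f :: "'a::euclidean_space \<Rightarrow> 'a"
  assumes f: "orthogonal_transformation f"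
  shows "distr cone_measure borel f = cone_measure"
proof (rule measure_eqI)
  note [measurable] = orthogonal_transformation_measurable[OF f]
  fix A assume "A \<in> sets (distr cone_measure borel f)"
  then have [measurable]: "A \<in> sets borel" by simp
  have lin: "linear f" using f by (rule orthogonal_transformation_linear)
  have [measurable]: "f -` A \<in> sets borel" using measurable_sets_borel[of f borel A] by measurable
  have "emeasure (distr cone_measure borel f) A = of_nat DIM('a) * emeasure lborel (trunc_cone 1 (f -` A))"
    by (simp add: emeasure_distr emeasure_cone_measure)
  also have "trunc_cone 1 (f -` A) = f -` trunc_cone 1 A"
    using orthogonal_transformation_norm[OF f]
    by (simp add: trunc_cone_def sgn_div_norm linear_cmul[OF lin] vimage_def del: zero_less_norm_iff)
  also have "emeasure lborel (f -` trunc_cone 1 A) = emeasure (distr lborel borel f) (trunc_cone 1 A)"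
    by (simp add: emeasure_distr)
  finally show "emeasure (distr cone_measure borel f) A = emeasure cone_measure A"
    by (simp add: lborel_distr_orthogonal[OF f] emeasure_cone_measure)
qed simp

lemma emeasure_trunc_cone:
  fixes A :: "'a::euclidean_space set"
  assumes [measurable]: "A \<in> sets borel" and R: "0 < R"
  shows "emeasure lborel (trunc_cone R A) = ennreal (R ^ DIM('a)) * emeasure lborel (trunc_cone 1 A)"
proof -
  have "emeasure lborel (trunc_cone R A) = ennreal (\<bar>R\<bar> ^ DIM('a)) * (\<integral>\<^sup>+x. indicator (trunc_cone R A) (R *\<^sub>R x) \<partial>lborel)"
    using nn_integral_lborel_scale[of "indicator (trunc_cone R A)" R] R by simp
  also have "(\<lambda>x. indicator (trunc_cone R A) (R *\<^sub>R x)) = (indicator (trunc_cone 1 A) :: 'a \<Rightarrow> ennreal)"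
    using R by (auto simp: trunc_cone_def indicator_def fun_eq_iff sgn_scaleR zero_less_mult_iff)
  finally show ?thesis using R by simp
qed

lemma nn_integral_power_Icc:
  assumes "0 \<le> R" "0 < n"
  shows "(\<integral>\<^sup>+r. ennreal (r ^ (n - 1)) * indicator {0..R} r \<partial>lborel) = ennreal (R ^ n / n)"
proof -
  have "(\<integral>\<^sup>+r. ennreal (r ^ (n - 1)) * indicator {0..R} r \<partial>lborel) = ennreal (R ^ n / n - 0 ^ n / n)"
  proof (rule nn_integral_FTC_Icc)
    fix x :: real assume "x \<in> {0..R}"
    show "((\<lambda>r. r ^ n / real n) has_real_derivative x ^ (n - 1)) (at x)"
      using assms by (auto intro!: derivative_eq_intros)
  qed (use assms in auto)
  then show ?thesis using assms by (simp add: zero_power)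
qed

text \<open>On a product \<open>{..r} \<times> B\<close> both measures are given by the Lebesgue measure of the cone over \<open>B\<close>
  truncated at height \<open>r\<close>, which is proportional to \<open>r ^ n\<close>.\<close>

lemma polar_product:
  "density lborel (\<lambda>r. indicator {0<..} r * ennreal (r ^ (DIM('a) - 1))) \<Otimes>\<^sub>M cone_measure =
   distr (density lborel (indicator (- {0}))) (borel \<Otimes>\<^sub>M borel) (\<lambda>x::'a::euclidean_space. (norm x, sgn x))"
  (is "?M1 \<Otimes>\<^sub>M ?M2 = ?D")
proof (rule pair_measure_eqI)
  show "sigma_finite_measure ?M1"
    by (subst sigma_finite_measure.sigma_finite_iff_density_finite) (auto intro: lborel.sigma_finite_measure_axioms simp: indicator_def)
  show "sigma_finite_measure ?M2" ..
  show "sets (?M1 \<Otimes>\<^sub>M ?M2) = sets ?D" by (simp cong: sets_pair_measure_cong)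
next
  fix A :: "real set" and B :: "'a set"
  assume "A \<in> sets ?M1" "B \<in> sets ?M2"
  then have [measurable]: "A \<in> sets borel" "B \<in> sets borel" by auto
  let ?L = "density lborel (\<lambda>r. emeasure ?M2 B * (indicator {0<..} r * ennreal (r ^ (DIM('a) - 1))))"
  let ?R = "distr (density lborel (indicator {x. x \<noteq> 0 \<and> sgn x \<in> B})) borel norm"
  have R: "emeasure ?R S = emeasure lborel {x. x \<noteq> 0 \<and> sgn x \<in> B \<and> norm x \<in> S}"
    if [measurable]: "S \<in> sets borel" for S
  proof -
    have [measurable]: "norm -` S \<in> sets (borel :: 'a measure)"
      by (rule measurable_sets_borel[OF borel_measurable_norm that])
    have "emeasure ?R S = (\<integral>\<^sup>+x. indicator {x. x \<noteq> 0 \<and> sgn x \<in> B} x * indicator (norm -` S) x \<partial>lborel)"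
      by (subst emeasure_distr) (auto simp: emeasure_density)
    also have "\<dots> = (\<integral>\<^sup>+x. indicator {x. x \<noteq> 0 \<and> sgn x \<in> B \<and> norm x \<in> S} x \<partial>lborel)"
      by (intro nn_integral_cong) (auto simp: indicator_def)
    finally show ?thesis by (simp add: nn_integral_indicator)
  qed
  have "?L = ?R"
  proof (rule measure_eqI_generator_eq[where E = "range atMost" and \<Omega> = UNIV and A = "\<lambda>n. {..real n}"])
    show "Int_stable (range (atMost :: real \<Rightarrow> _))"
      by (auto simp: Int_stable_def min_def intro!: image_eqI[of _ _ "min _ _"])
    have LR: "emeasure ?L {..r} = emeasure ?R {..r} \<and> emeasure ?R {..r} \<noteq> \<infinity>" for r
    proof (cases "0 < r")
      case True
      have "emeasure ?L {..r} = (\<integral>\<^sup>+x. emeasure ?M2 B * (ennreal (x ^ (DIM('a) - 1)) * indicator {0..r} x) \<partial>lborel)"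
        by (subst emeasure_density, simp, simp, rule nn_integral_cong_AE)
          (use AE_lborel_singleton[of 0] in \<open>auto elim!: eventually_mono simp: indicator_def\<close>)
      also have "\<dots> = emeasure ?M2 B * ennreal (r ^ DIM('a) / real DIM('a))"
        using True by (subst nn_integral_cmult, measurable, subst nn_integral_power_Icc) auto
      also have "\<dots> = ennreal (r ^ DIM('a)) * emeasure lborel (trunc_cone 1 B)"
      proof -
        have "of_nat DIM('a) * ennreal (r ^ DIM('a) / real DIM('a)) = ennreal (r ^ DIM('a))"
          using True by (simp add: ennreal_of_nat_eq_real_of_nat ennreal_mult[symmetric])
        moreover have "emeasure ?M2 B * e = (of_nat DIM('a) * e) * emeasure lborel (trunc_cone 1 B)" for e
          by (simp only: emeasure_cone_measure[OF \<open>B \<in> sets borel\<close>] mult_ac)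
        ultimately show ?thesis by (simp only:)
      qed
      also have "\<dots> = emeasure lborel (trunc_cone r B)" using True by (intro emeasure_trunc_cone[symmetric]) auto
      also have "\<dots> = emeasure ?R {..r}" by (subst R) (auto simp: trunc_cone_def intro!: arg_cong[where f = "emeasure lborel"])
      finally have "emeasure ?L {..r} = emeasure ?R {..r}" .
      moreover have "emeasure lborel (trunc_cone r B) \<le> emeasure lborel (cball 0 r :: 'a set)"
        by (intro emeasure_mono) (auto simp: trunc_cone_def)
      then have "emeasure lborel (trunc_cone r B) \<noteq> \<infinity>" using True by (auto simp: emeasure_cball top_unique)
      ultimately show ?thesis using \<open>emeasure lborel (trunc_cone r B) = emeasure ?R {..r}\<close> by simp
    next
      case False
      have "emeasure ?L {..r} = (\<integral>\<^sup>+x. 0 \<partial>(lborel :: real measure))"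
        using False by (subst emeasure_density, simp, simp, intro nn_integral_cong) (auto simp: indicator_def)
      moreover have empty: "{x. x \<noteq> 0 \<and> sgn x \<in> B \<and> norm x \<in> {..r}} = {}"
        using False by (auto simp: not_less) (metis norm_le_zero_iff order_trans)
      then have "emeasure ?R {..r} = 0" using R[of "{..r}"] unfolding empty by simp
      ultimately show ?thesis by simp
    qed
    show "\<And>X. X \<in> range atMost \<Longrightarrow> emeasure ?L X = emeasure ?R X" using LR by auto
    show "\<And>i. emeasure ?L {..real i} \<noteq> \<infinity>" using LR by metis
    show "sets ?L = sigma_sets UNIV (range atMost)" "sets ?R = sigma_sets UNIV (range atMost)"
      by (simp_all add: borel_eq_atMost)
    show "(\<Union>i. {..real i}) = UNIV" using real_arch_simple by auto
  qed auto
  then have "emeasure ?L A = emeasure ?R A" by simp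
  moreover have "emeasure ?L A = emeasure ?M2 B * emeasure ?M1 A"
    by (simp add: emeasure_density nn_integral_cmult mult.assoc)
  moreover have "emeasure ?D (A \<times> B) = emeasure ?R A"
  proof -
    have [measurable]: "(\<lambda>x::'a. (norm x, sgn x)) -` (A \<times> B) \<in> sets borel"
      using measurable_sets[of "\<lambda>x::'a. (norm x, sgn x)" borel "borel \<Otimes>\<^sub>M borel" "A \<times> B"] by simp
    have "emeasure ?D (A \<times> B) = (\<integral>\<^sup>+x. indicator (- {0}) x * indicator ((\<lambda>x. (norm x, sgn x)) -` (A \<times> B)) x \<partial>lborel)"
      by (subst emeasure_distr) (auto simp: emeasure_density)
    also have "\<dots> = (\<integral>\<^sup>+x. indicator {x. x \<noteq> 0 \<and> sgn x \<in> B \<and> norm x \<in> A} x \<partial>lborel)"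
      by (intro nn_integral_cong) (auto simp: indicator_def)
    finally show ?thesis by (simp add: R nn_integral_indicator)
  qed
  ultimately show "emeasure ?M1 A * emeasure ?M2 B = emeasure ?D (A \<times> B)"
    by (simp add: mult.commute)
qed

lemma nn_integral_polar:
  fixes f :: "'a::euclidean_space \<Rightarrow> ennreal"
  assumes [measurable]: "f \<in> borel_measurable borel"
  shows "(\<integral>\<^sup>+x. f x \<partial>lborel) =
    (\<integral>\<^sup>+r. indicator {0<..} r * ennreal (r ^ (DIM('a) - 1)) * (\<integral>\<^sup>+w. f (r *\<^sub>R w) \<partial>cone_measure) \<partial>lborel)"
proof -
  let ?M1 = "density lborel (\<lambda>r. indicator {0<..} r * ennreal (r ^ (DIM('a) - 1)))"
  have "(\<integral>\<^sup>+x. f x \<partial>lborel) = (\<integral>\<^sup>+x. indicator (- {0}) x * f (norm x *\<^sub>R sgn x) \<partial>lborel)"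
    by (rule nn_integral_cong_AE) (use AE_lborel_singleton[of "0::'a"] in \<open>auto elim!: eventually_mono simp: sgn_div_norm\<close>)
  also have "\<dots> = (\<integral>\<^sup>+p. f (fst p *\<^sub>R snd p) \<partial>distr (density lborel (indicator (- {0}))) (borel \<Otimes>\<^sub>M borel) (\<lambda>x::'a. (norm x, sgn x)))"
    by (subst nn_integral_distr) (auto simp: nn_integral_density)
  also have "\<dots> = (\<integral>\<^sup>+p. f (fst p *\<^sub>R snd p) \<partial>(?M1 \<Otimes>\<^sub>M cone_measure))"
    by (simp only: polar_product)
  also have "\<dots> = (\<integral>\<^sup>+r. \<integral>\<^sup>+w. f (r *\<^sub>R w) \<partial>cone_measure \<partial>?M1)"
    by (subst cone_measure.nn_integral_fst[symmetric]) auto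
  also have "\<dots> = (\<integral>\<^sup>+r. indicator {0<..} r * ennreal (r ^ (DIM('a) - 1)) * (\<integral>\<^sup>+w. f (r *\<^sub>R w) \<partial>cone_measure) \<partial>lborel)"
    by (subst nn_integral_density) auto
  finally show ?thesis .
qed

text \<open>The substitution \<open>\<rho> = r powr \<alpha>\<close>. It is regular on intervals away from \<open>0\<close>, and these
  exhaust \<open>(0, 1]\<close>.\<close>

lemma nn_integral_radial_powr:
  fixes \<Phi> :: "real \<Rightarrow> ennreal"
  assumes [measurable]: "\<Phi> \<in> borel_measurable borel" and \<alpha>: "0 < \<alpha>"
  shows "(\<integral>\<^sup>+r\<in>{0<..1}. \<Phi> r * ennreal (\<alpha> / r) \<partial>lborel) =
    (\<integral>\<^sup>+\<rho>\<in>{0<..1}. \<Phi> (\<rho> powr (1 / \<alpha>)) * ennreal (1 / \<rho>) \<partial>lborel)"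
proof -
  define a where "a i = 1 / real (Suc (Suc i))" for i
  have a: "0 < a i" "a i < 1" for i by (auto simp: a_def)
  have a_mono: "a j \<le> a i" if "i \<le> j" for i j using that by (auto simp: a_def intro!: divide_left_mono)
  have a_lim: "\<exists>i. a i \<le> r" if pos: "0 < r" for r
  proof -
    obtain i where "1 / real (Suc i) < r" using reals_Archimedean[OF pos] by (auto simp: inverse_eq_divide)
    moreover have "a i \<le> 1 / real (Suc i)" unfolding a_def by (intro divide_left_mono) auto
    ultimately show ?thesis by (intro exI[of _ i]) linarith
  qed
  let ?F = "\<lambda>r. \<Phi> r * ennreal (\<alpha> / r)"
  let ?G = "\<lambda>\<rho>. \<Phi> (\<rho> powr (1 / \<alpha>)) * ennreal (1 / \<rho>)"
  have eq: "emeasure (density lborel ?F) {a i..1} = emeasure (density lborel ?G) {a i powr \<alpha>..1}" for i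
  proof -
    have "emeasure (density lborel ?G) {a i powr \<alpha>..1} = (\<integral>\<^sup>+\<rho>. ?G \<rho> * indicator {a i powr \<alpha>..1 powr \<alpha>} \<rho> \<partial>lborel)"
      by (simp add: emeasure_density)
    also have "\<dots> = (\<integral>\<^sup>+r. ?G (r powr \<alpha>) * ennreal (\<alpha> * r powr (\<alpha> - 1)) * indicator {a i..1} r \<partial>lborel)"
    proof (rule nn_integral_substitution_aux)
      fix r assume "r \<in> {a i..1}"
      with a(1)[of i] have "0 < r" by auto
      then show "((\<lambda>r. r powr \<alpha>) has_real_derivative \<alpha> * r powr (\<alpha> - 1)) (at r)"
        by (rule has_real_derivative_powr)
    next
      show "continuous_on {a i..1} (\<lambda>r. \<alpha> * r powr (\<alpha> - 1))"
        using a(1)[of i] by (intro continuous_intros) auto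
    qed (use \<alpha> a in auto)
    also have "\<dots> = (\<integral>\<^sup>+r. ?F r * indicator {a i..1} r \<partial>lborel)"
    proof (rule nn_integral_cong)
      fix r
      show "?G (r powr \<alpha>) * ennreal (\<alpha> * r powr (\<alpha> - 1)) * indicator {a i..1} r = ?F r * indicator {a i..1} r"
      proof (cases "r \<in> {a i..1}")
        case True
        with a(1)[of i] have r: "0 < r" by auto
        have "ennreal (1 / r powr \<alpha>) * ennreal (\<alpha> * r powr (\<alpha> - 1)) = ennreal (\<alpha> / r)"
          using r \<alpha> by (simp add: ennreal_mult[symmetric] powr_diff)
        then show ?thesis using r \<alpha> by (simp add: powr_powr mult.assoc)
      qed simp
    qed
    finally show ?thesis by (simp add: emeasure_density)
  qed
  have U: "{0<..1} = (\<Union>i. {a i..1})"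
    using a a_lim by (auto intro: less_le_trans[OF a(1)])
  have "(\<integral>\<^sup>+r\<in>{0<..1}. ?F r \<partial>lborel) = emeasure (density lborel ?F) {0<..1}"
    by (simp add: emeasure_density)
  also have "\<dots> = emeasure (density lborel ?F) (\<Union>i. {a i..1})" by (simp only: U)
  also have "\<dots> = (SUP i. emeasure (density lborel ?F) {a i..1})"
    by (rule SUP_emeasure_incseq[symmetric]) (auto simp: incseq_def intro: order_trans[OF a_mono])
  also have "\<dots> = (SUP i. emeasure (density lborel ?G) {a i powr \<alpha>..1})" by (simp only: eq)
  also have "\<dots> = emeasure (density lborel ?G) (\<Union>i. {a i powr \<alpha>..1})"
  proof (rule SUP_emeasure_incseq)
    have "a j powr \<alpha> \<le> a i powr \<alpha>" if "i \<le> j" for i j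
      using a_mono[OF that] a(1)[of j] \<alpha> by (intro powr_mono2) auto
    then show "incseq (\<lambda>i. {a i powr \<alpha>..1})" by (auto simp: incseq_def intro: order_trans)
  qed auto
  also have "(\<Union>i. {a i powr \<alpha>..1}) = {0<..1}"
  proof safe
    fix r :: real assume r: "r \<in> {0<..1}"
    then obtain i where "a i \<le> r powr (1 / \<alpha>)" using a_lim[of "r powr (1 / \<alpha>)"] by auto
    then have "a i powr \<alpha> \<le> (r powr (1 / \<alpha>)) powr \<alpha>" using a(1)[of i] \<alpha> by (intro powr_mono2) auto
    then show "r \<in> (\<Union>i. {a i powr \<alpha>..1})" using r \<alpha> by (auto simp: powr_powr intro!: exI[of _ i])
  next
    fix r i assume "r \<in> {a i powr \<alpha>..1}"
    moreover have "0 < a i powr \<alpha>" using a(1)[of i] by simp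
    ultimately show "r \<in> {0<..1}" by (auto intro: less_le_trans[of 0 "a i powr \<alpha>"] simp del: powr_gt_zero)
  qed
  also have "emeasure (density lborel ?G) {0<..1} = (\<integral>\<^sup>+\<rho>\<in>{0<..1}. ?G \<rho> \<partial>lborel)"
    by (simp add: emeasure_density)
  finally show ?thesis .
qed

text \<open>With \<open>\<alpha> = 1 - s\<close> this puts the part of the energy near the diagonal into the form in which
  the limit \<open>s \<longlonglongrightarrow> 1\<close> can be taken under the integral.\<close>

lemma nn_integral_punctured_ball_polar:
  fixes f :: "'a::euclidean_space \<Rightarrow> ennreal"
  assumes [measurable]: "f \<in> borel_measurable borel" and \<alpha>: "0 < \<alpha>"
  shows "(\<integral>\<^sup>+h\<in>{h. norm h \<le> 1}. f h * ennreal (\<alpha> / norm h ^ DIM('a)) \<partial>lborel) =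
    (\<integral>\<^sup>+\<rho>\<in>{0<..<1}. (\<integral>\<^sup>+w. f ((\<rho> powr (1 / \<alpha>)) *\<^sub>R w) \<partial>cone_measure) * ennreal (1 / \<rho>) \<partial>lborel)"
proof -
  let ?\<Phi> = "\<lambda>r. \<integral>\<^sup>+w. f (r *\<^sub>R w) \<partial>cone_measure"
  have [measurable]: "?\<Phi> \<in> borel_measurable borel" by measurable
  have "(\<integral>\<^sup>+h\<in>{h. norm h \<le> 1}. f h * ennreal (\<alpha> / norm h ^ DIM('a)) \<partial>lborel) =
    (\<integral>\<^sup>+r. indicator {0<..} r * ennreal (r ^ (DIM('a) - 1)) *
      (\<integral>\<^sup>+w. f (r *\<^sub>R w) * ennreal (\<alpha> / norm (r *\<^sub>R w) ^ DIM('a)) * indicator {h. norm h \<le> 1} (r *\<^sub>R w) \<partial>cone_measure) \<partial>lborel)"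
    by (rule nn_integral_polar) measurable
  also have "\<dots> = (\<integral>\<^sup>+r\<in>{0<..1}. ?\<Phi> r * ennreal (\<alpha> / r) \<partial>lborel)"
  proof (rule nn_integral_cong)
    fix r :: real
    show "indicator {0<..} r * ennreal (r ^ (DIM('a) - 1)) *
      (\<integral>\<^sup>+w. f (r *\<^sub>R w) * ennreal (\<alpha> / norm (r *\<^sub>R w) ^ DIM('a)) * indicator {h. norm h \<le> 1} (r *\<^sub>R w) \<partial>cone_measure) =
      ?\<Phi> r * ennreal (\<alpha> / r) * indicator {0<..1} r" (is "_ * _ * ?I = _")
    proof (cases "0 < r")
      case True
      have "?I = (\<integral>\<^sup>+w. f (r *\<^sub>R w) * (ennreal (\<alpha> / r ^ DIM('a)) * indicator {0<..1} r) \<partial>cone_measure)"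
        by (rule nn_integral_cong_AE, rule AE_mp[OF AE_cone_measure_sphere])
          (use True in \<open>auto intro!: AE_I2 simp: indicator_def\<close>)
      also have "\<dots> = ?\<Phi> r * (ennreal (\<alpha> / r ^ DIM('a)) * indicator {0<..1} r)"
        by (rule nn_integral_multc) measurable
      finally have I: "?I = ?\<Phi> r * (ennreal (\<alpha> / r ^ DIM('a)) * indicator {0<..1} r)" .
      have "r ^ DIM('a) = r * r ^ (DIM('a) - 1)" by (metis DIM_positive power_minus_mult mult.commute)
      then have "ennreal (r ^ (DIM('a) - 1)) * ennreal (\<alpha> / r ^ DIM('a)) = ennreal (\<alpha> / r)"
        using True \<alpha> by (simp add: ennreal_mult[symmetric])
      moreover have "p * (\<phi> * (q * i)) = \<phi> * (p * q) * i" for p q \<phi> i :: ennreal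
        by (simp only: mult_ac)
      ultimately show ?thesis unfolding I using True by simp
    qed simp
  qed
  also have "\<dots> = (\<integral>\<^sup>+\<rho>\<in>{0<..1}. ?\<Phi> (\<rho> powr (1 / \<alpha>)) * ennreal (1 / \<rho>) \<partial>lborel)"
    by (rule nn_integral_radial_powr) (use \<alpha> in measurable)
  also have "\<dots> = (\<integral>\<^sup>+\<rho>\<in>{0<..<1}. ?\<Phi> (\<rho> powr (1 / \<alpha>)) * ennreal (1 / \<rho>) \<partial>lborel)"
    by (rule nn_integral_cong_AE) (use AE_lborel_singleton[of "1::real"] in \<open>auto elim!: eventually_mono simp: indicator_def\<close>)
  finally show ?thesis .
qed

lemma nn_integral_tail_finite:
  "(\<integral>\<^sup>+h\<in>{h::'a::euclidean_space. 1 < norm h}. ennreal (norm h powr (-1/2) / norm h ^ DIM('a)) \<partial>lborel) < \<infinity>"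
proof -
  let ?\<sigma> = "emeasure (cone_measure :: 'a measure) UNIV"
  have "(\<integral>\<^sup>+h\<in>{h::'a. 1 < norm h}. ennreal (norm h powr (-1/2) / norm h ^ DIM('a)) \<partial>lborel) =
    (\<integral>\<^sup>+r. indicator {0<..} r * ennreal (r ^ (DIM('a) - 1)) *
      (\<integral>\<^sup>+w. ennreal (norm (r *\<^sub>R w) powr (-1/2) / norm (r *\<^sub>R w) ^ DIM('a)) * indicator {h::'a. 1 < norm h} (r *\<^sub>R w) \<partial>cone_measure) \<partial>lborel)"
    by (rule nn_integral_polar) measurable
  also have "\<dots> \<le> (\<integral>\<^sup>+r. ?\<sigma> * (ennreal (r powr (-3/2)) * indicator {1..} r) \<partial>lborel)"
  proof (rule nn_integral_mono)
    fix r :: real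
    show "indicator {0<..} r * ennreal (r ^ (DIM('a) - 1)) *
      (\<integral>\<^sup>+w. ennreal (norm (r *\<^sub>R w) powr (-1/2) / norm (r *\<^sub>R w) ^ DIM('a)) * indicator {h::'a. 1 < norm h} (r *\<^sub>R w) \<partial>cone_measure)
      \<le> ?\<sigma> * (ennreal (r powr (-3/2)) * indicator {1..} r)" (is "_ * _ * ?I \<le> _")
    proof (cases "0 < r")
      case True
      have "?I = (\<integral>\<^sup>+w. ennreal (r powr (-1/2) / r ^ DIM('a)) * indicator {1<..} r \<partial>(cone_measure :: 'a measure))"
        by (rule nn_integral_cong_AE, rule AE_mp[OF AE_cone_measure_sphere])
          (use True in \<open>auto intro!: AE_I2 simp: indicator_def\<close>)
      also have "\<dots> = (ennreal (r powr (-1/2) / r ^ DIM('a)) * indicator {1<..} r) * ?\<sigma>" by simp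
      finally have I: "?I = (ennreal (r powr (-1/2) / r ^ DIM('a)) * indicator {1<..} r) * ?\<sigma>" .
      have "r ^ DIM('a) = r * r ^ (DIM('a) - 1)" by (metis DIM_positive power_minus_mult mult.commute)
      moreover have "r powr (-3/2) = r powr (-1/2) / r"
        using True powr_diff[of r "-1/2" 1] by simp
      ultimately have "ennreal (r ^ (DIM('a) - 1)) * ennreal (r powr (-1/2) / r ^ DIM('a)) = ennreal (r powr (-3/2))"
        using True by (simp add: ennreal_mult[symmetric])
      then have "indicator {0<..} r * ennreal (r ^ (DIM('a) - 1)) * ?I =
          ?\<sigma> * (ennreal (r powr (-3/2)) * indicator {1<..} r)"
        unfolding I using True by (simp add: mult_ac)
      also have "\<dots> \<le> ?\<sigma> * (ennreal (r powr (-3/2)) * indicator {1..} r)"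
        by (intro mult_left_mono) (auto simp: indicator_def)
      finally show ?thesis .
    qed simp
  qed
  also have "\<dots> = ?\<sigma> * (\<integral>\<^sup>+r. ennreal (r powr (-3/2)) * indicator {1..} r \<partial>lborel)"
    by (rule nn_integral_cmult) measurable
  also have "(\<integral>\<^sup>+r. ennreal (r powr (-3/2)) * indicator {1..} r \<partial>lborel) = ennreal (0 - (- 2 * 1 powr (-1/2)))"
  proof (rule nn_integral_FTC_atLeast[where F = "\<lambda>r. - 2 * r powr (-1/2)" and T = 0])
    fix x :: real assume "1 \<le> x"
    then show "((\<lambda>r. - 2 * r powr (-1/2)) has_real_derivative x powr (-3/2)) (at x)"
      by (auto intro!: derivative_eq_intros)
  next
    have "((\<lambda>r::real. - 2 * r powr (-1/2)) \<longlongrightarrow> - 2 * 0) at_top"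
      by (intro tendsto_mult tendsto_const tendsto_neg_powr filterlim_ident) simp
    then show "((\<lambda>r::real. - 2 * r powr (-1/2)) \<longlongrightarrow> 0) at_top" by simp
  qed auto
  also have "?\<sigma> * \<dots> < \<infinity>" using finite_cone_measure[where 'a = 'a] by (simp add: ennreal_mult_less_top)
  finally show ?thesis .
qed

section \<open>The cone measure is at most the Hausdorff measure\<close>

abbreviation coords :: "('a::euclidean_space \<Rightarrow> real) \<Rightarrow> 'a" where
  "coords z \<equiv> (\<Sum>b\<in>Basis. z b *\<^sub>R b)"

lemma dist_coords: "(dist (coords z) (coords z' :: 'a::euclidean_space))\<^sup>2 = (\<Sum>b\<in>Basis. (z b - z' b)\<^sup>2)"
  by (subst euclidean_dist_l2) (simp add: L2_set_def dist_real_def sum_nonneg)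

lemma norm_coords: "(norm (coords z :: 'a::euclidean_space))\<^sup>2 = (\<Sum>b\<in>Basis. (z b)\<^sup>2)"
  using dist_coords[of z "\<lambda>_. 0"] by simp

text \<open>By Fubini in the direction \<open>e\<close>: the projection of \<open>S\<close> along \<open>e\<close> has pairwise distances at
  most \<open>D\<close>, so the isodiametric inequality bounds its measure, and all sections have length at most
  \<open>\<tau>\<close>. The projection of a Borel set need not be Borel, so it is replaced by the points with
  sections of positive length.\<close>

lemma emeasure_lborel_le_slab:
  fixes S :: "'a::euclidean_space set"
  assumes S [measurable]: "S \<in> sets borel" and e: "e \<in> Basis"
    and D: "0 \<le> D" "\<And>x y. x \<in> S \<Longrightarrow> y \<in> S \<Longrightarrow> dist x y \<le> D"
    and \<tau>: "0 \<le> \<tau>" "\<And>z t t'. coords (z(e := t)) \<in> S \<Longrightarrow> coords (z(e := t')) \<in> S \<Longrightarrow> \<bar>t - t'\<bar> \<le> \<tau>"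
  shows "emeasure lborel S \<le> ennreal \<tau> * ennreal (unit_ball_vol (DIM('a) - 1) * (D / 2) ^ (DIM('a) - 1))"
proof -
  let ?P = "lborel_PiM (Basis :: 'a set)" and ?Q = "lborel_PiM (Basis - {e})"
  define L where "L = {z \<in> space ?P. coords z \<in> S}"
  have ins: "insert e (Basis - {e}) = Basis" using e by auto
  have meas: "(\<lambda>z. coords z :: 'a) \<in> ?P \<rightarrow>\<^sub>M borel" by measurable
  have L [measurable]: "L \<in> sets ?P"
    unfolding L_def using measurable_sets[OF meas S] by (simp add: vimage_def Int_def conj_commute)
  have sec: "{t. z(e := t) \<in> L} = {t. coords (z(e := t)) \<in> S}" if "z \<in> space ?Q" for z
    using that e by (auto simp: L_def space_PiM PiE_iff extensional_def)
  have upd: "(\<lambda>(z, t). z(e := t)) \<in> ?Q \<Otimes>\<^sub>M lborel \<rightarrow>\<^sub>M ?P"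
    using measurable_add_dim[of e "Basis - {e}" "\<lambda>_. lborel"] unfolding ins .
  define m where "m z = emeasure lborel {t. z(e := t) \<in> L}" for z
  have prod: "{p \<in> space (?Q \<Otimes>\<^sub>M lborel). (\<lambda>(z, t). z(e := t)) p \<in> L} \<in> sets (?Q \<Otimes>\<^sub>M lborel)"
    using measurable_sets[OF upd L] by (simp add: vimage_def Int_def conj_commute)
  have m [measurable]: "m \<in> borel_measurable ?Q"
    unfolding m_def by (rule measurable_cong[THEN iffD1, OF _ lborel.measurable_emeasure_Pair[OF prod]])
      (auto simp: space_pair_measure vimage_def)
  have sec_meas: "{t. z(e := t) \<in> L} \<in> sets lborel" if z: "z \<in> space ?Q" for z
  proof -
    have "Pair z -` {p \<in> space (?Q \<Otimes>\<^sub>M lborel). (\<lambda>(z, t). z(e := t)) p \<in> L} \<in> sets lborel"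
      by (rule sets_Pair1[OF prod])
    then show ?thesis using z by (simp add: space_pair_measure vimage_def)
  qed
  define K where "K = {z \<in> space ?Q. 0 < m z}"
  have K [measurable]: "K \<in> sets ?Q" unfolding K_def by measurable
  have m_le: "m z \<le> ennreal \<tau> * indicator K z" if z: "z \<in> space ?Q" for z
  proof (cases "z \<in> K")
    case True
    have "m z \<le> ennreal \<tau>" unfolding m_def
      by (rule emeasure_lborel_le_bound[OF sec_meas[OF z] _ \<tau>(1)]) (use \<tau>(2) sec[OF z] in auto)
    with True show ?thesis by simp
  qed (use z in \<open>simp add: K_def\<close>)
  have K_le: "emeasure ?Q K \<le> ennreal (unit_ball_vol (DIM('a) - 1) * (D / 2) ^ (DIM('a) - 1))"
  proof (cases "K = {}")
    case False
    have K_ne: "\<exists>t. coords (z(e := t)) \<in> S" if "z \<in> K" for z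
    proof (rule ccontr)
      assume "\<not> ?thesis"
      then have "m z = 0" unfolding m_def using that by (subst sec) (auto simp: K_def)
      with that show False by (simp add: K_def)
    qed
    have "diam_le (Basis - {e}) D K"
    proof (intro ballI)
      fix z z' assume "z \<in> K" "z' \<in> K"
      then obtain t t' where "coords (z(e := t)) \<in> S" "coords (z'(e := t')) \<in> S"
        using K_ne by meson
      then have "(\<Sum>b\<in>Basis. ((z(e := t)) b - (z'(e := t')) b)\<^sup>2) \<le> D\<^sup>2"
        using D by (subst dist_coords[symmetric]) (auto intro!: power_mono)
      moreover have "(\<Sum>b\<in>Basis. ((z(e := t)) b - (z'(e := t')) b)\<^sup>2) =
          (t - t')\<^sup>2 + (\<Sum>b\<in>Basis - {e}. (z b - z' b)\<^sup>2)"
        using e by (subst sum.remove[of _ e]) auto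
      ultimately show "(\<Sum>b\<in>Basis - {e}. (z b - z' b)\<^sup>2) \<le> D\<^sup>2"
        using zero_le_power2[of "t - t'"] by linarith
    qed
    from isodiametric_inequality[OF _ K this D(1) False] show ?thesis
      using e by simp
  qed simp
  have "emeasure lborel S = emeasure ?P L"
    unfolding L_def by (subst lborel_eq) (simp add: emeasure_distr[OF meas] vimage_def Int_def conj_commute)
  also have "\<dots> = (\<integral>\<^sup>+z. m z \<partial>?Q)"
    unfolding m_def by (rule emeasure_eq_sections) (use e in auto)
  also have "\<dots> \<le> (\<integral>\<^sup>+z. ennreal \<tau> * indicator K z \<partial>?Q)"
    by (rule nn_integral_mono) (rule m_le)
  also have "\<dots> = ennreal \<tau> * emeasure ?Q K"
    by (rule nn_integral_cmult_indicator) measurable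
  also have "\<dots> \<le> ennreal \<tau> * ennreal (unit_ball_vol (DIM('a) - 1) * (D / 2) ^ (DIM('a) - 1))"
    by (intro mult_left_mono K_le) simp
  finally show ?thesis .
qed

text \<open>Points of the shell over \<open>C\<close> move by at most \<open>h\<close> when they are projected to the sphere, so the
  shell has diameter at most \<open>d + 2 * h\<close>. On a vertical line the square of the height varies by at most
  \<open>(1 + h)\<^sup>2 - 1\<close>, while the height itself is at least \<open>1 - \<delta>\<close>; this bounds the sections.\<close>

lemma trunc_cone_shell_le:
  fixes C :: "'a::euclidean_space set"
  assumes C [measurable]: "C \<in> sets borel" and sphere: "C \<subseteq> sphere 0 1" and e: "e \<in> Basis"
    and \<delta>: "\<delta> < 1" "\<And>w. w \<in> C \<Longrightarrow> dist w e \<le> \<delta>"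
    and d: "0 \<le> d" "\<And>w w'. w \<in> C \<Longrightarrow> w' \<in> C \<Longrightarrow> dist w w' \<le> d"
    and h: "0 < h"
  shows "emeasure lborel (trunc_cone (1 + h) C - trunc_cone 1 C) \<le>
    ennreal ((2 * h + h\<^sup>2) / (2 * (1 - \<delta>))) *
    ennreal (unit_ball_vol (DIM('a) - 1) * ((d + 2 * h) / 2) ^ (DIM('a) - 1))"
proof (rule emeasure_lborel_le_slab[OF _ e])
  let ?S = "trunc_cone (1 + h) C - trunc_cone 1 C"
  have S: "1 < norm x" "norm x \<le> 1 + h" "sgn x \<in> C" "x = norm x *\<^sub>R sgn x" if "x \<in> ?S" for x
    using that by (auto simp: trunc_cone_def sgn_div_norm)
  have near: "dist x (sgn x) \<le> h" if "x \<in> ?S" for x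
  proof -
    have "norm (sgn x) = 1" using S(3)[OF that] sphere by auto
    moreover have "x - sgn x = (norm x - 1) *\<^sub>R sgn x"
      using S(4)[OF that] by (simp add: algebra_simps)
    ultimately show ?thesis using S(1,2)[OF that] by (simp add: dist_norm)
  qed
  show "?S \<in> sets borel" by measurable
  show "0 \<le> d + 2 * h" using d h by simp
  show "dist x y \<le> d + 2 * h" if "x \<in> ?S" "y \<in> ?S" for x y
    using near[OF that(1)] near[OF that(2)] d(2)[OF S(3)[OF that(1)] S(3)[OF that(2)]]
      dist_triangle[of x y "sgn x"] dist_triangle[of "sgn x" y "sgn y"] dist_commute[of y "sgn y"] by linarith
  show "0 \<le> (2 * h + h\<^sup>2) / (2 * (1 - \<delta>))" using h \<delta>(1) by simp
  have height: "1 - \<delta> \<le> x \<bullet> e" if x: "x \<in> ?S" for x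
  proof -
    have "\<bar>(sgn x - e) \<bullet> e\<bar> \<le> norm (sgn x - e) * norm e" by (rule Cauchy_Schwarz_ineq2)
    also have "\<dots> \<le> \<delta>" using \<delta>(2)[OF S(3)[OF x]] e by (simp add: dist_norm)
    finally have *: "1 - \<delta> \<le> sgn x \<bullet> e" using e by (simp add: inner_diff_left)
    then have "0 \<le> (norm x - 1) * (sgn x \<bullet> e)" using \<delta>(1) S(1)[OF x] by (intro mult_nonneg_nonneg) auto
    moreover have "x \<bullet> e = norm x * (sgn x \<bullet> e)" by (subst S(4)[OF x]) simp
    ultimately show ?thesis using * by (simp add: algebra_simps)
  qed
  fix z t t' assume z: "coords (z(e := t)) \<in> ?S" and z': "coords (z(e := t')) \<in> ?S"
  have te: "coords (z(e := r)) \<bullet> e = r" for r using e by simp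
  have t: "1 - \<delta> \<le> t" "1 - \<delta> \<le> t'" using height[OF z] height[OF z'] by (simp_all only: te)
  have sq: "(norm (coords (z(e := r)) :: 'a))\<^sup>2 = r\<^sup>2 + (\<Sum>b\<in>Basis - {e}. (z b)\<^sup>2)" for r
    unfolding norm_coords using e by (subst sum.remove[of _ e]) auto
  have "1\<^sup>2 \<le> (norm (coords (z(e := t)) :: 'a))\<^sup>2" "(norm (coords (z(e := t)) :: 'a))\<^sup>2 \<le> (1 + h)\<^sup>2"
    "1\<^sup>2 \<le> (norm (coords (z(e := t')) :: 'a))\<^sup>2" "(norm (coords (z(e := t')) :: 'a))\<^sup>2 \<le> (1 + h)\<^sup>2"
    using S(1,2)[OF z] S(1,2)[OF z'] by (intro power_mono; simp)+
  then have "\<bar>t\<^sup>2 - t'\<^sup>2\<bar> \<le> (1 + h)\<^sup>2 - 1" unfolding sq by (simp add: abs_le_iff)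
  also have "t\<^sup>2 - t'\<^sup>2 = (t - t') * (t + t')" by (simp add: power2_eq_square algebra_simps)
  also have "\<bar>(t - t') * (t + t')\<bar> = \<bar>t - t'\<bar> * (t + t')" using t \<delta>(1) by (simp add: abs_mult)
  also have "(1 + h)\<^sup>2 - 1 = 2 * h + h\<^sup>2" by (simp add: power2_eq_square algebra_simps)
  finally have "\<bar>t - t'\<bar> * (t + t') \<le> 2 * h + h\<^sup>2" .
  moreover have "\<bar>t - t'\<bar> * (2 * (1 - \<delta>)) \<le> \<bar>t - t'\<bar> * (t + t')" using t by (intro mult_left_mono) auto
  ultimately show "\<bar>t - t'\<bar> \<le> (2 * h + h\<^sup>2) / (2 * (1 - \<delta>))"
    using \<delta>(1) by (simp add: pos_le_divide_eq)
qed

text \<open>By homogeneity the shell has measure \<open>((1 + h) ^ n - 1)\<close> times the one of the cone, which is at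
  least \<open>h\<close> times the cone measure of \<open>C\<close> by the inequality of Bernoulli. Dividing the bound for the
  shell by \<open>h\<close> and letting \<open>h\<close> tend to \<open>0\<close> gives the claim.\<close>

lemma cone_measure_le_near_pole:
  fixes C :: "'a::euclidean_space set"
  assumes C [measurable]: "C \<in> sets borel" and sphere: "C \<subseteq> sphere 0 1" and e: "e \<in> Basis"
    and \<delta>: "\<delta> < 1" "\<And>w. w \<in> C \<Longrightarrow> dist w e \<le> \<delta>"
    and d: "0 \<le> d" "\<And>w w'. w \<in> C \<Longrightarrow> w' \<in> C \<Longrightarrow> dist w w' \<le> d"
  shows "ennreal (1 - \<delta>) * emeasure cone_measure C \<le>
    ennreal (unit_ball_vol (DIM('a) - 1) * (d / 2) ^ (DIM('a) - 1))"
proof -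
  let ?n = "DIM('a)" and ?\<omega> = "unit_ball_vol (DIM('a) - 1)"
  have "emeasure lborel (trunc_cone 1 C) \<le> emeasure lborel (cball 0 1 :: 'a set)"
    by (intro emeasure_mono) (auto simp: trunc_cone_def)
  then have fin: "emeasure lborel (trunc_cone 1 C) < \<infinity>"
    by (rule order_le_less_trans) (simp add: emeasure_cball)
  then obtain L where L: "0 \<le> L" "emeasure lborel (trunc_cone 1 C) = ennreal L"
    by (cases "emeasure lborel (trunc_cone 1 C)") auto
  have bound: "?n * L * (1 - \<delta>) \<le> (1 + h / 2) * (?\<omega> * ((d + 2 * h) / 2) ^ (?n - 1))" if h: "0 < h" for h
  proof -
    let ?W = "?\<omega> * ((d + 2 * h) / 2) ^ (?n - 1)"
    have W: "0 \<le> ?W" using d h by simp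
    have "emeasure lborel (trunc_cone (1 + h) C - trunc_cone 1 C) =
        emeasure lborel (trunc_cone (1 + h) C) - emeasure lborel (trunc_cone 1 C)"
      using fin h by (intro emeasure_Diff) (auto simp: trunc_cone_def)
    also have "\<dots> = ennreal ((1 + h) ^ ?n * L - L)"
      using h L(1) by (subst emeasure_trunc_cone) (auto simp: L(2) ennreal_mult[symmetric] ennreal_minus)
    finally have "ennreal ((1 + h) ^ ?n * L - L) \<le> ennreal ((2 * h + h\<^sup>2) / (2 * (1 - \<delta>))) * ennreal ?W"
      using trunc_cone_shell_le[OF C sphere e \<delta> d h] by simp
    also have "\<dots> = ennreal ((2 * h + h\<^sup>2) / (2 * (1 - \<delta>)) * ?W)"
      using h \<delta>(1) W by (intro ennreal_mult[symmetric]) auto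
    finally have "(1 + h) ^ ?n * L - L \<le> (2 * h + h\<^sup>2) / (2 * (1 - \<delta>)) * ?W"
      using h \<delta>(1) W by (subst (asm) ennreal_le_iff) auto
    moreover have "(1 + ?n * h) * L \<le> (1 + h) ^ ?n * L"
      using h L(1) Bernoulli_inequality[of h ?n] by (intro mult_right_mono) auto
    ultimately have "?n * h * L \<le> (2 * h + h\<^sup>2) / (2 * (1 - \<delta>)) * ?W" by (simp add: algebra_simps)
    then have "?n * h * L * (1 - \<delta>) \<le> (2 * h + h\<^sup>2) / (2 * (1 - \<delta>)) * ?W * (1 - \<delta>)"
      using \<delta>(1) by (intro mult_right_mono) auto
    also have "\<dots> = h * ((1 + h / 2) * ?W)" using \<delta>(1) by (simp add: field_simps power2_eq_square)
    finally have "h * (?n * L * (1 - \<delta>)) \<le> h * ((1 + h / 2) * ?W)" by (simp add: mult_ac)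
    then show ?thesis using h by simp
  qed
  have lim: "((\<lambda>h. (1 + h / 2) * (?\<omega> * ((d + 2 * h) / 2) ^ (?n - 1))) \<longlongrightarrow>
      (1 + 0 / 2) * (?\<omega> * ((d + 2 * 0) / 2) ^ (?n - 1))) (at_right 0)"
    by (intro tendsto_intros) simp_all
  have "?n * L * (1 - \<delta>) \<le> (1 + 0 / 2) * (?\<omega> * ((d + 2 * 0) / 2) ^ (?n - 1))"
    by (rule tendsto_lowerbound[OF lim eventually_mono[OF eventually_at_right_less]]) (erule bound, simp)
  moreover have "ennreal (1 - \<delta>) * emeasure cone_measure C = ennreal (?n * L * (1 - \<delta>))"
    using L(1) \<delta>(1) by (simp add: emeasure_cone_measure L(2) ennreal_of_nat_eq_real_of_nat ennreal_mult[symmetric] mult_ac)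
  ultimately show ?thesis by (simp add: ennreal_leI)
qed

text \<open>A rotation takes a vector of the basis to \<open>p\<close>, and preserves both distances and the cone measure.\<close>

lemma cone_measure_le_cap:
  fixes C :: "(real^'n) set"
  assumes C [measurable]: "C \<in> sets borel" and sphere: "C \<subseteq> sphere 0 1" and p: "norm p = 1"
    and \<delta>: "\<delta> < 1" "\<And>w. w \<in> C \<Longrightarrow> dist w p \<le> \<delta>"
    and d: "0 \<le> d" "\<And>w w'. w \<in> C \<Longrightarrow> w' \<in> C \<Longrightarrow> dist w w' \<le> d"
  shows "ennreal (1 - \<delta>) * emeasure cone_measure C \<le>
    ennreal (unit_ball_vol (CARD('n) - 1) * (d / 2) ^ (CARD('n) - 1))"
proof -
  obtain e :: "real^'n" where e: "e \<in> Basis" using nonempty_Basis by blast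
  obtain f where f: "orthogonal_transformation f" "f e = p"
    using orthogonal_transformation_exists[of e p] e p by auto
  note [measurable] = orthogonal_transformation_measurable[OF f(1)]
  have iso: "dist (f x) (f y) = dist x y" for x y
    using orthogonal_transformation_isometry[of f] f(1) by (simp add: orthogonal_transformation_isometry)
  have meas: "f -` C \<in> sets borel" by (rule measurable_sets_borel[of f borel]) measurable
  have "emeasure cone_measure C = emeasure (distr cone_measure borel f) C"
    by (simp add: distr_cone_measure_orthogonal[OF f(1)])
  also have "\<dots> = emeasure cone_measure (f -` C)" by (simp add: emeasure_distr)
  finally have "emeasure cone_measure C = emeasure cone_measure (f -` C)" .
  moreover have "ennreal (1 - \<delta>) * emeasure cone_measure (f -` C) \<le>
    ennreal (unit_ball_vol (DIM(real^'n) - 1) * (d / 2) ^ (DIM(real^'n) - 1))"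
  proof (rule cone_measure_le_near_pole[OF meas _ e \<delta>(1) _ d(1)])
    show "f -` C \<subseteq> sphere 0 1" using sphere orthogonal_transformation_norm[OF f(1)] by auto
    show "dist w e \<le> \<delta>" if "w \<in> f -` C" for w using \<delta>(2)[of "f w"] that iso[of w e] f(2) by simp
    show "dist w w' \<le> d" if "w \<in> f -` C" "w' \<in> f -` C" for w w' using d(2)[of "f w" "f w'"] that iso[of w w'] by simp
  qed
  ultimately show ?thesis by simp
qed

text \<open>The sets of a covering need not be measurable; their closures are, and have the same
  diameters. The factor \<open>1 - \<delta>\<close> lost by flattening pieces of diameter at most \<open>\<delta>\<close> disappears in the
  limit.\<close>

lemma cone_measure_le_hausdorff:
  fixes A :: "(real^'n) set"
  assumes A [measurable]: "A \<in> sets borel" and sphere: "A \<subseteq> sphere 0 1"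
  shows "emeasure cone_measure A \<le> hausdorff_outer (CARD('n) - 1) A"
proof -
  let ?m = "CARD('n) - 1"
  have bound: "ennreal (1 - \<delta>) * emeasure cone_measure A \<le> hausdorff_outer ?m A" if \<delta>: "0 < \<delta>" "\<delta> < 1" for \<delta>
  proof -
    have "ennreal (1 - \<delta>) * emeasure cone_measure A \<le> hausdorff_content ?m \<delta> A"
      unfolding hausdorff_content_def
    proof (rule INF_greatest, clarsimp simp del: One_nat_def)
      fix C :: "nat \<Rightarrow> (real^'n) set"
      assume cov: "A \<subseteq> (\<Union>i. C i)" and C: "\<forall>i. bounded (C i) \<and> diameter (C i) \<le> \<delta>"
      define B where "B i = A \<inter> closure (C i)" for i
      have B [measurable]: "B i \<in> sets borel" for i unfolding B_def by measurable
      have "emeasure cone_measure A \<le> emeasure cone_measure (\<Union>i. B i)"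
        using cov closure_subset by (intro emeasure_mono) (auto simp: B_def, blast)
      also have "\<dots> \<le> (\<Sum>i. emeasure cone_measure (B i))"
        by (rule emeasure_subadditive_countably) auto
      finally have "ennreal (1 - \<delta>) * emeasure cone_measure A \<le> ennreal (1 - \<delta>) * (\<Sum>i. emeasure cone_measure (B i))"
        by (intro mult_left_mono) auto
      also have "\<dots> = (\<Sum>i. ennreal (1 - \<delta>) * emeasure cone_measure (B i))" by simp
      also have "\<dots> \<le> (\<Sum>i. hausdorff_weight ?m (C i))"
      proof (rule suminf_le)
        fix i
        show "ennreal (1 - \<delta>) * emeasure cone_measure (B i) \<le> hausdorff_weight ?m (C i)"
        proof (cases "B i = {}")
          case False
          then obtain p where p: "p \<in> B i" by blast
          have diam: "dist w w' \<le> diameter (C i)" if "w \<in> B i" "w' \<in> B i" for w w'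
            using that C diameter_bounded_bound[of "closure (C i)" w w']
            by (auto simp: B_def diameter_closure)
          have "ennreal (1 - \<delta>) * emeasure cone_measure (B i) \<le>
              ennreal (unit_ball_vol ?m * (diameter (C i) / 2) ^ ?m)"
          proof (rule cone_measure_le_cap)
            show "B i \<subseteq> sphere 0 1" using sphere by (auto simp: B_def)
            show "norm p = 1" using sphere p by (auto simp: B_def)
            show "dist w p \<le> \<delta>" if "w \<in> B i" for w using diam[OF that p] C by (meson order_trans)
          qed (use \<delta> diam C in \<open>auto intro: diameter_ge_0\<close>)
          moreover have "C i \<noteq> {}" using False by (auto simp: B_def)
          ultimately show ?thesis by (simp add: hausdorff_weight_def)
        qed simp
      qed auto
      finally show "ennreal (1 - \<delta>) * emeasure cone_measure A \<le> (\<Sum>i. hausdorff_weight ?m (C i))" .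
    qed
    also have "\<dots> \<le> hausdorff_outer ?m A"
      unfolding hausdorff_outer_def using \<delta> by (intro SUP_upper) auto
    finally show ?thesis .
  qed
  have lim: "((\<lambda>\<delta>. ennreal (1 - \<delta>) * emeasure cone_measure A) \<longlongrightarrow> ennreal (1 - 0) * emeasure cone_measure A) (at_right 0)"
    by (intro tendsto_mult_ennreal tendsto_intros) auto
  have "ennreal (1 - 0) * emeasure cone_measure A \<le> hausdorff_outer ?m A"
    by (rule tendsto_upperbound[OF lim eventually_mono[OF eventually_at_right_real[of 0 1]]])
      (use bound in auto)
  then show ?thesis by simp
qed

lemma nn_integral_cone_measure_le_hausdorff:
  fixes f :: "real^'n \<Rightarrow> ennreal"
  assumes [measurable]: "f \<in> borel_measurable borel"
  shows "(\<integral>\<^sup>+w. f w \<partial>cone_measure) \<le> (\<integral>\<^sup>+w\<in>sphere 0 1. f w \<partial>hausdorff_measure (CARD('n) - 1))"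
proof -
  let ?H = "hausdorff_measure (CARD('n) - 1) :: (real^'n) measure"
  let ?N = "density ?H (indicator (sphere 0 1))"
  have [measurable]: "sphere 0 1 \<in> sets (borel :: (real^'n) measure)" by (intro borel_closed) simp
  have "cone_measure \<le> ?N"
  proof (subst le_measure, simp, safe)
    fix A :: "(real^'n) set" assume "A \<in> sets cone_measure"
    then have [measurable]: "A \<in> sets borel" by simp
    have "emeasure cone_measure A = emeasure cone_measure (A \<inter> sphere 0 1)"
      by (rule emeasure_eq_AE) (use AE_cone_measure_sphere in \<open>auto elim!: eventually_mono\<close>)
    also have "\<dots> \<le> emeasure ?H (A \<inter> sphere 0 1)"
      by (subst emeasure_hausdorff_measure, measurable) (rule cone_measure_le_hausdorff, auto)
    also have "\<dots> = (\<integral>\<^sup>+w. indicator (sphere 0 1) w * indicator A w \<partial>?H)"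
      by (subst indicator_inter_arith[symmetric], subst nn_integral_indicator) (auto simp: Int_commute)
    also have "\<dots> = emeasure ?N A"
      by (rule emeasure_density[symmetric]) auto
    finally show "emeasure cone_measure A \<le> emeasure ?N A" .
  qed
  then have "(\<integral>\<^sup>+w. f w \<partial>cone_measure) \<le> (\<integral>\<^sup>+w. f w \<partial>?N)"
    by (intro nn_integral_mono_measure) simp
  also have "\<dots> = (\<integral>\<^sup>+w\<in>sphere 0 1. f w \<partial>?H)"
    by (subst nn_integral_density) (auto simp: mult.commute)
  finally show ?thesis .
qed

section \<open>Growth and continuity of generalized Young functions\<close>

lemma cond_H3_nonzero: "cond_H3 g G \<Longrightarrow> 0 < t \<Longrightarrow> G x y t \<noteq> 0"
  unfolding cond_H3_def by (smt (verit) div_by_0)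

text \<open>If \<open>g x y\<close> were not integrable, its integral \<open>G x y t\<close> would be \<open>0\<close>, and then so would the
  quotient \<open>t * g x y t / G x y t\<close>, which the growth condition bounds below by a number greater than
  \<open>1\<close>.\<close>

lemma young_integrable:
  assumes "generalized_young g G" "cond_H3 g G" "0 < t"
  shows "g x y integrable_on {0..t}"
proof (rule ccontr)
  assume "\<not> ?thesis"
  then have "G x y t = 0"
    using assms(1,3) not_integrable_integral by (auto simp: generalized_young_def)
  then show False using cond_H3_nonzero[OF assms(2,3)] by blast
qed

lemma young_increment:
  assumes Y: "generalized_young g G" and H3: "cond_H3 g G" and ab: "0 \<le> a" "a \<le> b"
  shows "(b - a) * g x y a \<le> G x y b - G x y a" "G x y b - G x y a \<le> (b - a) * g x y b"
proof -
  have G: "G x y t = integral {0..t} (g x y)" if "0 \<le> t" for t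
    using Y that by (auto simp: generalized_young_def)
  have mono: "g x y s \<le> g x y t" if "0 \<le> s" "s \<le> t" for s t
    using Y that unfolding generalized_young_def mono_on_def by auto
  show "(b - a) * g x y a \<le> G x y b - G x y a" "G x y b - G x y a \<le> (b - a) * g x y b"
  proof (atomize (full), cases "a = b")
    case False
    then have int: "g x y integrable_on {0..b}"
      using ab by (intro young_integrable[OF Y H3]) auto
    have "integral {0..a} (g x y) + integral {a..b} (g x y) = integral {0..b} (g x y)"
      by (rule Henstock_Kurzweil_Integration.integral_combine[OF ab int])
    then have eq: "G x y b - G x y a = integral {a..b} (g x y)" using ab by (simp add: G)
    have int': "g x y integrable_on {a..b}"
      by (rule integrable_subinterval_real[OF int]) (use ab in auto)
    have "integral {a..b} (\<lambda>_. g x y a) \<le> integral {a..b} (g x y)"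
      using int' ab by (intro integral_le) (auto intro: mono)
    moreover have "integral {a..b} (g x y) \<le> integral {a..b} (\<lambda>_. g x y b)"
      using int' ab by (intro integral_le) (auto intro: mono)
    ultimately show "(b - a) * g x y a \<le> G x y b - G x y a \<and> G x y b - G x y a \<le> (b - a) * g x y b"
      using ab by (simp add: eq)
  qed simp
qed

lemma young_zero: "generalized_young g G \<Longrightarrow> G x y 0 = 0"
  by (auto simp: generalized_young_def)

lemma young_density_nonneg: "generalized_young g G \<Longrightarrow> 0 \<le> t \<Longrightarrow> 0 \<le> g x y t"
  by (cases "t = 0") (auto simp: generalized_young_def intro: less_imp_le)

lemma young_mono:
  assumes "generalized_young g G" "cond_H3 g G" "0 \<le> a" "a \<le> b"
  shows "G x y a \<le> G x y b"
proof -
  have "0 \<le> (b - a) * g x y a"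
    using young_density_nonneg[OF assms(1,3)] assms(4) by (intro mult_nonneg_nonneg) auto
  then show ?thesis using young_increment(1)[OF assms, of x y] by linarith
qed

lemma young_nonneg: "generalized_young g G \<Longrightarrow> cond_H3 g G \<Longrightarrow> 0 \<le> t \<Longrightarrow> 0 \<le> G x y t"
  using young_mono[of g G 0 t x y] young_zero[of g G x y] by simp

text \<open>Convexity together with the value \<open>0\<close> at \<open>0\<close>, read off from the monotonicity of \<open>g\<close>: the mean
  of \<open>g\<close> over \<open>[0, \<theta> * t]\<close> is at most \<open>g (\<theta> * t)\<close>, and its mean over \<open>[\<theta> * t, t]\<close> is at least
  that.\<close>

lemma young_sublinear:
  assumes Y: "generalized_young g G" and H3: "cond_H3 g G" and t: "0 \<le> t" and \<theta>: "0 \<le> \<theta>" "\<theta> \<le> 1"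
  shows "G x y (\<theta> * t) \<le> \<theta> * G x y t"
proof -
  have le: "0 \<le> \<theta> * t" "\<theta> * t \<le> t" using t \<theta> by (auto intro: mult_left_le_one_le)
  have "G x y (\<theta> * t) \<le> \<theta> * t * g x y (\<theta> * t)"
    using young_increment(2)[OF Y H3 order_refl le(1), of x y] young_zero[OF Y] by simp
  then have "(1 - \<theta>) * G x y (\<theta> * t) \<le> (1 - \<theta>) * (\<theta> * t * g x y (\<theta> * t))"
    using \<theta> by (intro mult_left_mono) auto
  also have "\<dots> = \<theta> * ((t - \<theta> * t) * g x y (\<theta> * t))" by (simp add: algebra_simps)
  also have "\<dots> \<le> \<theta> * (G x y t - G x y (\<theta> * t))"
    using young_increment(1)[OF Y H3 le, of x y] \<theta> by (intro mult_left_mono) auto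
  finally show ?thesis by (simp add: algebra_simps)
qed

text \<open>From \<open>t * g \<le> p * G\<close> follows the doubling condition \<open>G (q * t) \<le> 2 * G t\<close> for
  \<open>q = 1 + 1 / (2 * p)\<close>: the increment over \<open>[t, q * t]\<close> is at most \<open>(q - 1) * p = 1 / 2\<close> times
  \<open>G (q * t)\<close>. Iteration starts from the bound on \<open>G x y 1\<close>.\<close>

lemma young_bounded:
  assumes Y: "generalized_young g G" and H1: "cond_H1 G" and H3: "cond_H3 g G" and T: "0 \<le> T"
  shows "\<exists>B. \<forall>x y. G x y T \<le> B"
proof -
  obtain C2 where C2: "\<And>x y. G x y 1 \<le> C2" using H1 by (auto simp: cond_H1_def)
  obtain p where p: "1 < p" "\<And>x y t. 0 < t \<Longrightarrow> t * g x y t / G x y t \<le> p"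
    using H3 unfolding cond_H3_def by (meson less_le_trans)
  have pos: "0 < G x y t" if "0 < t" for x y t
    using young_nonneg[OF Y H3, of t x y] cond_H3_nonzero[OF H3 that, of x y] that by simp
  have tg: "t * g x y t \<le> p * G x y t" if "0 < t" for x y t
    using p(2)[OF that, of x y] pos[OF that, of x y] by (simp add: pos_divide_le_eq)
  define q where "q = 1 + 1 / (2 * p)"
  have q: "1 < q" using p by (simp add: q_def)
  have double: "G x y (q * t) \<le> 2 * G x y t" if t: "0 < t" for x y t
  proof -
    have "G x y (q * t) - G x y t \<le> (q * t - t) * g x y (q * t)"
      using q t by (intro young_increment(2)[OF Y H3]) auto
    also have "\<dots> = (1 / (2 * p)) * (t * g x y (q * t))" by (simp add: q_def algebra_simps)
    also have "\<dots> \<le> (1 / (2 * p)) * ((q * t) * g x y (q * t))"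
      using q t p young_density_nonneg[OF Y, of "q * t" x y] by (intro mult_left_mono mult_right_mono) auto
    also have "\<dots> \<le> (1 / (2 * p)) * (p * G x y (q * t))"
      using q t p by (intro mult_left_mono tg) auto
    also have "\<dots> = G x y (q * t) / 2" using p by simp
    finally show ?thesis by simp
  qed
  have iter: "G x y (q ^ m) \<le> 2 ^ m * C2" for x y m
  proof (induction m)
    case (Suc m)
    have "G x y (q ^ Suc m) \<le> 2 * G x y (q ^ m)" using double[of "q ^ m" x y] q by simp
    with Suc show ?case by simp
  qed (use C2 in simp)
  obtain m where m: "T < q ^ m" using real_arch_pow[OF q] by blast
  then have "G x y T \<le> 2 ^ m * C2" for x y
    using young_mono[OF Y H3 T less_imp_le[OF m], of x y] iter[of x y m] by linarith
  then show ?thesis by blast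
qed

text \<open>On \<open>[0, T]\<close> the slope is at most \<open>g x y T\<close>, and \<open>T * g x y T\<close> is at most \<open>G x y (2 * T)\<close>.\<close>

lemma young_lipschitz:
  assumes Y: "generalized_young g G" and H1: "cond_H1 G" and H3: "cond_H3 g G" and T: "0 < T"
  shows "\<exists>K\<ge>0. \<forall>x y. \<forall>s\<in>{0..T}. \<forall>t\<in>{0..T}. \<bar>G x y s - G x y t\<bar> \<le> K * \<bar>s - t\<bar>"
proof -
  obtain B where B: "\<And>x y. G x y (2 * T) \<le> B"
    using young_bounded[OF Y H1 H3, of "2 * T"] T by auto
  have g: "g x y t \<le> B / T" if "0 \<le> t" "t \<le> T" for x y t
  proof -
    have "g x y t \<le> g x y T"
      using Y that T unfolding generalized_young_def mono_on_def by auto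
    moreover have "T * g x y T \<le> B"
      using young_increment(1)[OF Y H3, of T "2 * T" x y] young_nonneg[OF Y H3, of T x y] B[of x y] T by simp
    ultimately show ?thesis using T by (simp add: pos_le_divide_eq mult.commute order_trans[OF mult_left_mono])
  qed
  have K: "0 \<le> B / T" using g[of 0] young_density_nonneg[OF Y order_refl] T by (meson less_imp_le order_refl order_trans)
  have *: "\<bar>G x y s - G x y t\<bar> \<le> B / T * \<bar>s - t\<bar>" if "0 \<le> s" "s \<le> t" "t \<le> T" for x y s t
  proof -
    have "G x y t - G x y s \<le> (t - s) * g x y t" using that by (intro young_increment(2)[OF Y H3])
    also have "\<dots> \<le> (t - s) * (B / T)" using that by (intro mult_left_mono g) auto
    finally show ?thesis using young_mono[OF Y H3 that(1,2), of x y] that by (simp add: mult.commute)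
  qed
  show ?thesis
  proof (intro exI[of _ "B / T"] conjI allI ballI K)
    fix x y s t assume "s \<in> {0..T}" "t \<in> {0..T}"
    then show "\<bar>G x y s - G x y t\<bar> \<le> B / T * \<bar>s - t\<bar>"
      using *[of s t x y] *[of t s x y] by (cases "s \<le> t") (auto simp: abs_minus_commute)
  qed
qed

lemma young_linear_bound:
  assumes Y: "generalized_young g G" and H1: "cond_H1 G" and H3: "cond_H3 g G"
  shows "\<exists>K\<ge>0. \<forall>x y. \<forall>t\<in>{0..T}. G x y t \<le> K * t"
proof (cases "0 < T")
  case True
  then obtain K where K: "K \<ge> 0" "\<And>x y s t. s \<in> {0..T} \<Longrightarrow> t \<in> {0..T} \<Longrightarrow> \<bar>G x y s - G x y t\<bar> \<le> K * \<bar>s - t\<bar>"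
    using young_lipschitz[OF Y H1 H3 True] by blast
  then have "G x y t \<le> K * t" if "t \<in> {0..T}" for x y t
    using K(2)[of t 0 x y] that young_zero[OF Y, of x y] by (simp add: abs_le_iff)
  with \<open>K \<ge> 0\<close> show ?thesis by blast
next
  case False
  then have "t = 0" if "t \<in> {0..T}" for t using that by auto
  then show ?thesis using young_zero[OF Y] by (intro exI[of _ 0]) fastforce
qed

lemma young_continuous:
  assumes Y: "generalized_young g G" and H1: "cond_H1 G" and H3: "cond_H3 g G"
  shows "continuous_on {0..} (G x y)"
  unfolding continuous_on_def
proof
  fix t :: real assume t: "t \<in> {0..}"
  obtain K where K: "\<And>s t'. s \<in> {0..t + 1} \<Longrightarrow> t' \<in> {0..t + 1} \<Longrightarrow> \<bar>G x y s - G x y t'\<bar> \<le> K * \<bar>s - t'\<bar>"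
    using young_lipschitz[OF Y H1 H3, of "t + 1"] t
    by (metis add_pos_nonneg add.commute atLeast_iff zero_less_one)
  have "((\<lambda>s. G x y s - G x y t) \<longlongrightarrow> 0) (at t within {0..})"
  proof (rule Lim_null_comparison)
    have "\<forall>\<^sub>F s in at t within {0..}. s < t + 1"
      by (rule order_tendstoD(2)[OF tendsto_ident_at]) simp
    moreover have "\<forall>\<^sub>F s in at t within {0..}. s \<in> {0..}" by (simp add: eventually_at_filter)
    ultimately show "\<forall>\<^sub>F s in at t within {0..}. norm (G x y s - G x y t) \<le> K * \<bar>s - t\<bar>"
      by eventually_elim (use t in \<open>auto intro!: K\<close>)
    have "((\<lambda>s. K * \<bar>s - t\<bar>) \<longlongrightarrow> K * \<bar>t - t\<bar>) (at t within {0..})" by (intro tendsto_intros)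
    then show "((\<lambda>s. K * \<bar>s - t\<bar>) \<longlongrightarrow> 0) (at t within {0..})" by simp
  qed
  then show "(G x y \<longlongrightarrow> G x y t) (at t within {0..})" by (simp add: LIM_zero_iff)
qed

lemma young_tendsto:
  assumes Y: "generalized_young g G" and H1: "cond_H1 G" and H2: "cond_H2 G" and H3: "cond_H3 g G"
    and y: "Y' \<longlonglongrightarrow> y" and t: "T' \<longlonglongrightarrow> t" and nonneg: "\<And>i. 0 \<le> T' i"
  shows "(\<lambda>i. G x (Y' i) (T' i)) \<longlonglongrightarrow> G x y t"
proof -
  have t0: "0 \<le> t" using t nonneg by (intro LIMSEQ_le_const[OF t]) auto
  obtain M where M: "0 < M" "\<And>i. \<bar>T' i\<bar> \<le> M"
    using convergent_imp_Bseq[OF convergentI[OF t]] by (auto simp: Bseq_def)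
  then have tM: "t \<le> M" by (intro LIMSEQ_le_const2[OF t]) (auto simp: abs_le_iff)
  obtain K where K: "0 \<le> K" "\<And>x y s t. s \<in> {0..M} \<Longrightarrow> t \<in> {0..M} \<Longrightarrow> \<bar>G x y s - G x y t\<bar> \<le> K * \<bar>s - t\<bar>"
    using young_lipschitz[OF Y H1 H3 M(1)] by blast
  have "isCont (\<lambda>y. G x y t) y"
    using H2 t0 by (auto simp: cond_H2_def continuous_on_eq_continuous_at)
  then have 1: "(\<lambda>i. G x (Y' i) t) \<longlonglongrightarrow> G x y t" using y by (rule isCont_tendsto_compose)
  have lim: "(\<lambda>i. K * \<bar>T' i - t\<bar>) \<longlonglongrightarrow> K * \<bar>t - t\<bar>" by (intro tendsto_intros t)
  have "(\<lambda>i. G x (Y' i) (T' i) - G x (Y' i) t) \<longlonglongrightarrow> 0"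
  proof (rule Lim_null_comparison[OF always_eventually])
    show "\<forall>i. norm (G x (Y' i) (T' i) - G x (Y' i) t) \<le> K * \<bar>T' i - t\<bar>"
      unfolding real_norm_def using M nonneg t0 tM by (intro allI K) (auto simp: abs_le_iff)
  qed (use lim in simp)
  from tendsto_add[OF this 1] show ?thesis by simp
qed

text \<open>\<open>a\<close> is approximated by functions with countably many values, for which the composition is
  measurable piece by piece.\<close>

lemma borel_measurable_caratheodory:
  fixes \<Gamma> :: "'z \<Rightarrow> real \<Rightarrow> real"
  assumes \<Gamma>: "\<And>t. 0 \<le> t \<Longrightarrow> (\<lambda>z. \<Gamma> z t) \<in> borel_measurable M"
    and cont: "\<And>z. continuous_on {0..} (\<Gamma> z)"
    and a: "a \<in> borel_measurable M" "\<And>z. 0 \<le> a z"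
  shows "(\<lambda>z. \<Gamma> z (a z)) \<in> borel_measurable M"
proof (rule borel_measurable_LIMSEQ_real)
  let ?a = "\<lambda>i z. real (nat \<lfloor>real (Suc i) * a z\<rfloor>) / real (Suc i)"
  fix z
  have "(\<lambda>i. ?a i z) \<longlonglongrightarrow> a z"
  proof (rule real_tendsto_sandwich[of "\<lambda>i. a z - 1 / real (Suc i)" _ _ "\<lambda>i. a z"])
    have "(\<lambda>i. a z - 1 / real (Suc i)) \<longlonglongrightarrow> a z - 0"
      by (intro tendsto_diff tendsto_const LIMSEQ_Suc[OF lim_1_over_n])
    then show "(\<lambda>i. a z - 1 / real (Suc i)) \<longlonglongrightarrow> a z" by simp
    have *: "real (Suc i) * a z - 1 \<le> real (nat \<lfloor>real (Suc i) * a z\<rfloor>)"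
      "real (nat \<lfloor>real (Suc i) * a z\<rfloor>) \<le> real (Suc i) * a z" for i
      using a(2)[of z] by (auto simp: of_nat_nat intro: less_imp_le)
    show "\<forall>\<^sub>F i in sequentially. a z - 1 / real (Suc i) \<le> ?a i z"
    proof (intro always_eventually allI)
      fix i
      have "a z - 1 / real (Suc i) = (real (Suc i) * a z - 1) / real (Suc i)" by (simp add: diff_divide_distrib)
      also have "\<dots> \<le> ?a i z" by (intro divide_right_mono *) simp
      finally show "a z - 1 / real (Suc i) \<le> ?a i z" .
    qed
    show "\<forall>\<^sub>F i in sequentially. ?a i z \<le> a z"
      using *(2) by (intro always_eventually allI) (auto simp: field_simps simp del: of_nat_Suc)
  qed simp
  moreover have "(\<Gamma> z \<longlongrightarrow> \<Gamma> z (a z)) (at (a z) within {0..})"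
    using cont[of z] a(2)[of z] by (auto simp: continuous_on_def)
  ultimately show "(\<lambda>i. \<Gamma> z (?a i z)) \<longlonglongrightarrow> \<Gamma> z (a z)"
    by (intro continuous_on_tendsto_compose[OF cont]) (use a(2) in auto)
next
  fix i
  show "(\<lambda>z. \<Gamma> z (real (nat \<lfloor>real (Suc i) * a z\<rfloor>) / real (Suc i))) \<in> borel_measurable M"
  proof (rule measurable_compose_countable[where f = "\<lambda>n z. \<Gamma> z (real n / real (Suc i))" and g = "\<lambda>z. nat \<lfloor>real (Suc i) * a z\<rfloor>"])
    show "(\<lambda>z. nat \<lfloor>real (Suc i) * a z\<rfloor>) \<in> M \<rightarrow>\<^sub>M count_space UNIV" using a(1) by measurable
  qed (intro \<Gamma>, simp)
qed

section \<open>The limit of the energies\<close>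

text \<open>The counterpart of \<open>H0\<close> with the cone measure. Its last argument is the gradient itself and not
  the norm, which is the form in which the limit of the energies arises.\<close>

definition H0_cone :: "(real^'n \<Rightarrow> real^'n \<Rightarrow> real \<Rightarrow> real) \<Rightarrow> real^'n \<Rightarrow> real^'n \<Rightarrow> ennreal" where
  "H0_cone G x a = (\<integral>\<^sup>+\<rho>\<in>{0<..<1}.
     (\<integral>\<^sup>+w. ennreal (G x x (\<rho> * \<bar>a \<bullet> w\<bar>)) \<partial>cone_measure) * ennreal (1 / \<rho>) \<partial>lborel)"

lemma measurable_completion_AE:
  fixes f f' :: "'a \<Rightarrow> ennreal"
  assumes [measurable]: "f' \<in> borel_measurable M" and eq: "AE x in M. f x = f' x"
  shows "f \<in> borel_measurable (completion M)"
proof (rule measurableI)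
  fix A :: "ennreal set" assume [measurable]: "A \<in> sets borel"
  have "AE x in completion M. x \<in> f' -` A \<inter> space M \<longleftrightarrow> x \<in> f -` A \<inter> space M"
    using eq by (intro AE_completion) (auto elim!: eventually_mono)
  moreover have "f' -` A \<inter> space M \<in> sets (completion M)"
    by (intro sets_completionI_sets) measurable
  ultimately have "f -` A \<inter> space M \<in> sets (completion M)"
    by (rule completion.in_sets_AE) simp
  then show "f -` A \<inter> space (completion M) \<in> sets (completion M)" by simp
qed simp

text \<open>Lebesgue measure on the product is the completion of the product measure, so Tonelli's theorem
  is applied to a Borel function that agrees almost everywhere with \<open>F\<close>; almost all of its sections have the same integral as those of \<open>F\<close>.\<close>

lemma nn_integral_lebesgue_pair:
  fixes F :: "'a::euclidean_space \<times> 'b::euclidean_space \<Rightarrow> ennreal"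
  assumes F: "F \<in> borel_measurable lebesgue"
  shows "(\<lambda>x. \<integral>\<^sup>+y. F (x, y) \<partial>lborel) \<in> borel_measurable lebesgue"
    and "(\<integral>\<^sup>+p. F p \<partial>lebesgue) = (\<integral>\<^sup>+x. \<integral>\<^sup>+y. F (x, y) \<partial>lborel \<partial>lebesgue)"
proof -
  obtain F' where F' [measurable]: "F' \<in> borel_measurable lborel" and eq: "AE p in lborel. F p = F' p"
    using completion_ex_borel_measurable[OF F] by auto
  have [measurable]: "F' \<in> borel_measurable (lborel \<Otimes>\<^sub>M lborel)" using F' by (simp add: lborel_prod)
  have "AE p in lborel \<Otimes>\<^sub>M lborel. F p = F' p" unfolding lborel_prod by (rule eq)
  then have "AE x in lborel. AE y in lborel. F (x, y) = F' (x, y)" by (rule lborel_pair.AE_pair)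
  then have ae: "AE x in lborel. (\<integral>\<^sup>+y. F (x, y) \<partial>lborel) = (\<integral>\<^sup>+y. F' (x, y) \<partial>lborel)"
    by eventually_elim (rule nn_integral_cong_AE)
  show "(\<lambda>x. \<integral>\<^sup>+y. F (x, y) \<partial>lborel) \<in> borel_measurable lebesgue"
    by (rule measurable_completion_AE[OF _ ae]) measurable
  have "(\<integral>\<^sup>+p. F p \<partial>lebesgue) = (\<integral>\<^sup>+p. F' p \<partial>lborel)"
    unfolding nn_integral_completion using eq by (rule nn_integral_cong_AE)
  also have "\<dots> = (\<integral>\<^sup>+p. F' p \<partial>(lborel \<Otimes>\<^sub>M lborel))" by (simp add: lborel_prod)
  also have "\<dots> = (\<integral>\<^sup>+x. \<integral>\<^sup>+y. F' (x, y) \<partial>lborel \<partial>lborel)"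
    by (rule lborel.nn_integral_fst[symmetric]) measurable
  also have "\<dots> = (\<integral>\<^sup>+x. \<integral>\<^sup>+y. F (x, y) \<partial>lborel \<partial>lebesgue)"
    unfolding nn_integral_completion using ae by (intro nn_integral_cong_AE) auto
  finally show "(\<integral>\<^sup>+p. F p \<partial>lebesgue) = (\<integral>\<^sup>+x. \<integral>\<^sup>+y. F (x, y) \<partial>lborel \<partial>lebesgue)" .
qed

lemma inner_left_measurable [measurable]: "(\<bullet>) b \<in> borel_measurable borel"
  by (intro borel_measurable_continuous_onI continuous_intros)

lemma difference_quotient_tendsto:
  fixes v :: "'a::euclidean_space \<Rightarrow> real"
  assumes der: "(v has_derivative (\<lambda>h. a \<bullet> h)) (at x)" and r: "r \<longlonglongrightarrow> 0" "\<And>i. 0 < r i"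
  shows "(\<lambda>i. \<bar>v x - v (x + r i *\<^sub>R w)\<bar> / r i) \<longlonglongrightarrow> \<bar>a \<bullet> w\<bar>"
proof -
  have "((\<lambda>t. v (x + t *\<^sub>R w)) has_derivative (\<lambda>t. a \<bullet> (t *\<^sub>R w))) (at 0)"
    by (rule has_derivative_compose[of "\<lambda>t. x + t *\<^sub>R w" _ 0 UNIV v])
      (auto intro!: derivative_eq_intros simp: der)
  then have "((\<lambda>t. v (x + t *\<^sub>R w)) has_real_derivative (a \<bullet> w)) (at 0)"
    by (simp add: has_field_derivative_def mult.commute[of _ "a \<bullet> w"])
  then have "(\<lambda>t. (v (x + t *\<^sub>R w) - v x) / t) \<midarrow>0\<rightarrow> a \<bullet> w" by (simp add: DERIV_def)
  moreover have "filterlim r (at 0) sequentially"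
    using r by (auto simp: filterlim_at intro!: always_eventually) (metis less_irrefl)
  ultimately have "(\<lambda>i. (v (x + r i *\<^sub>R w) - v x) / r i) \<longlonglongrightarrow> a \<bullet> w" by (rule filterlim_compose)
  then have "(\<lambda>i. \<bar>(v (x + r i *\<^sub>R w) - v x) / r i\<bar>) \<longlonglongrightarrow> \<bar>a \<bullet> w\<bar>" by (rule tendsto_rabs)
  then show ?thesis using r(2) by (simp add: abs_minus_commute less_imp_le)
qed

context
  fixes g G :: "real^'n \<Rightarrow> real^'n \<Rightarrow> real \<Rightarrow> real"
  assumes Y: "generalized_young g G" and H1: "cond_H1 G" and H2: "cond_H2 G" and H3: "cond_H3 g G"
begin

lemma young_measurable:
  assumes "a \<in> borel_measurable M" "\<And>z. 0 \<le> a z"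
  shows "(\<lambda>z. G x y (a z)) \<in> borel_measurable M"
  by (rule borel_measurable_caratheodory[where \<Gamma> = "\<lambda>_. G x y"]) (use assms young_continuous[OF Y H1 H3] in auto)

lemma young_measurable_snd:
  assumes [measurable]: "a \<in> borel_measurable M" and "\<And>z. 0 \<le> a z" and b [measurable]: "b \<in> borel_measurable M"
  shows "(\<lambda>z. G x (b z) (a z)) \<in> borel_measurable M"
proof (rule borel_measurable_caratheodory[where \<Gamma> = "\<lambda>z. G x (b z)"])
  fix t :: real assume "0 \<le> t"
  then have "continuous_on UNIV (\<lambda>y. G x y t)" using H2 by (simp add: cond_H2_def)
  then have "(\<lambda>y. G x y t) \<in> borel_measurable borel" by (rule borel_measurable_continuous_onI)
  from measurable_compose[OF b this] show "(\<lambda>z. G x (b z) t) \<in> borel_measurable M" .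
qed (use assms young_continuous[OF Y H1 H3] in auto)

lemma young_measurable_pair:
  assumes a: "a \<in> borel_measurable borel" "\<And>z. 0 \<le> a z"
  shows "(\<lambda>(x, y). G x y (a (x, y))) \<in> borel_measurable lebesgue"
proof -
  have "(\<lambda>z. (\<lambda>t. G (fst z) (snd z) t) (a z)) \<in> borel_measurable lebesgue"
  proof (rule borel_measurable_caratheodory[where \<Gamma> = "\<lambda>z t. G (fst z) (snd z) t"])
    show "(\<lambda>z. G (fst z) (snd z) t) \<in> borel_measurable lebesgue" if "0 \<le> t" for t
      using Y that by (auto simp: generalized_young_def case_prod_unfold)
    show "a \<in> borel_measurable lebesgue" using a(1) by (intro measurable_completion) simp
  qed (use a(2) young_continuous[OF Y H1 H3] in auto)
  then show ?thesis by (simp add: case_prod_unfold)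
qed

text \<open>A rotation takes \<open>norm a\<close> times the \<open>k\<close>-th unit vector to \<open>a\<close> and preserves the cone measure.\<close>

lemma H0_cone_le_H0: "H0_cone G x a \<le> H0 k G x (norm a)"
proof -
  have norm: "norm (axis k (norm a) :: real^'n) = norm a"
    by (simp add: norm_eq_sqrt_inner inner_axis_axis)
  obtain f where f: "orthogonal_transformation f" "f (axis k (norm a)) = a"
    by (rule orthogonal_transformation_exists[OF norm])
  note [measurable] = orthogonal_transformation_measurable[OF f(1)]
  have inner: "(\<integral>\<^sup>+w. ennreal (G x x (\<rho> * \<bar>a \<bullet> w\<bar>)) \<partial>cone_measure) \<le>
      (\<integral>\<^sup>+w\<in>sphere 0 1. ennreal (G x x (norm a * \<bar>w $ k\<bar> * \<rho>)) \<partial>hausdorff_measure (CARD('n) - 1))" if "0 < \<rho>" for \<rho>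
  proof -
    have meas [measurable]: "(\<lambda>w. ennreal (G x x (\<rho> * \<bar>b \<bullet> w\<bar>))) \<in> borel_measurable borel" for b
      by (rule measurable_compose[OF young_measurable measurable_ennreal], measurable) (use that in simp)
    have "(\<integral>\<^sup>+w. ennreal (G x x (\<rho> * \<bar>a \<bullet> w\<bar>)) \<partial>cone_measure) =
        (\<integral>\<^sup>+w. ennreal (G x x (\<rho> * \<bar>a \<bullet> w\<bar>)) \<partial>distr cone_measure borel f)"
      by (simp only: distr_cone_measure_orthogonal[OF f(1)])
    also have "\<dots> = (\<integral>\<^sup>+w. ennreal (G x x (\<rho> * \<bar>f (axis k (norm a)) \<bullet> f w\<bar>)) \<partial>cone_measure)"
      by (subst nn_integral_distr) (auto simp: f(2))
    also have "\<dots> = (\<integral>\<^sup>+w. ennreal (G x x (\<rho> * \<bar>axis k (norm a) \<bullet> w\<bar>)) \<partial>cone_measure)"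
      using f(1) by (simp add: orthogonal_transformation_def)
    also have "\<dots> \<le> (\<integral>\<^sup>+w\<in>sphere 0 1. ennreal (G x x (\<rho> * \<bar>axis k (norm a) \<bullet> w\<bar>)) \<partial>hausdorff_measure (CARD('n) - 1))"
      by (rule nn_integral_cone_measure_le_hausdorff[OF meas])
    finally show ?thesis by (simp add: inner_axis' abs_mult mult_ac)
  qed
  show ?thesis unfolding H0_cone_def H0_def nn_integral_completion
  proof (rule nn_integral_mono)
    fix \<rho> :: real
    show "(\<integral>\<^sup>+w. ennreal (G x x (\<rho> * \<bar>a \<bullet> w\<bar>)) \<partial>cone_measure) * ennreal (1 / \<rho>) * indicator {0<..<1} \<rho> \<le>
      (\<integral>\<^sup>+w\<in>sphere 0 1. ennreal (G x x (norm a * \<bar>w $ k\<bar> * \<rho>)) \<partial>hausdorff_measure (CARD('n) - 1)) *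
        ennreal (1 / \<rho>) * indicator {0<..<1} \<rho>"
      using inner[of \<rho>] by (cases "\<rho> \<in> {0<..<1}") (auto intro: mult_right_mono)
  qed
qed

lemma H0_cone_scale:
  assumes "0 \<le> \<theta>" "\<theta> \<le> 1"
  shows "H0_cone G x (\<theta> *\<^sub>R a) \<le> ennreal \<theta> * H0_cone G x a"
proof -
  \<comment> \<open>\<open>G x x\<close> is only controlled on nonnegative arguments, hence the absolute value of \<open>\<rho>\<close>.\<close>
  have meas: "(\<lambda>p. ennreal (G x x (\<bar>fst p\<bar> * \<bar>a \<bullet> snd p\<bar>))) \<in> borel_measurable (borel \<Otimes>\<^sub>M borel)"
    by (rule measurable_compose[OF young_measurable measurable_ennreal]) (measurable, simp?)
  have meas1: "(\<lambda>w. ennreal (G x x (\<bar>\<rho>\<bar> * \<bar>a \<bullet> w\<bar>))) \<in> borel_measurable borel" for \<rho>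
    by (rule measurable_compose[OF young_measurable measurable_ennreal]) (measurable, simp?)
  have meas2 [measurable]: "(\<lambda>\<rho>. \<integral>\<^sup>+w. ennreal (G x x (\<bar>\<rho>\<bar> * \<bar>a \<bullet> w\<bar>)) \<partial>cone_measure) \<in> borel_measurable borel"
    by (rule cone_measure.borel_measurable_nn_integral) (use meas in \<open>simp add: case_prod_unfold cong: measurable_cong_sets sets_pair_measure_cong\<close>)
  have abs: "H0_cone G x b = (\<integral>\<^sup>+\<rho>\<in>{0<..<1}.
     (\<integral>\<^sup>+w. ennreal (G x x (\<bar>\<rho>\<bar> * \<bar>b \<bullet> w\<bar>)) \<partial>cone_measure) * ennreal (1 / \<rho>) \<partial>lborel)" for b
    unfolding H0_cone_def by (intro nn_integral_cong) (auto simp: indicator_def)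
  have le: "(\<integral>\<^sup>+w. ennreal (G x x (\<bar>\<rho>\<bar> * \<bar>(\<theta> *\<^sub>R a) \<bullet> w\<bar>)) \<partial>cone_measure) \<le>
      ennreal \<theta> * (\<integral>\<^sup>+w. ennreal (G x x (\<bar>\<rho>\<bar> * \<bar>a \<bullet> w\<bar>)) \<partial>cone_measure)" for \<rho>
  proof -
    have "(\<integral>\<^sup>+w. ennreal (G x x (\<bar>\<rho>\<bar> * \<bar>(\<theta> *\<^sub>R a) \<bullet> w\<bar>)) \<partial>cone_measure) \<le>
        (\<integral>\<^sup>+w. ennreal \<theta> * ennreal (G x x (\<bar>\<rho>\<bar> * \<bar>a \<bullet> w\<bar>)) \<partial>cone_measure)"
    proof (rule nn_integral_mono)
      fix w
      have "G x x (\<theta> * (\<bar>\<rho>\<bar> * \<bar>a \<bullet> w\<bar>)) \<le> \<theta> * G x x (\<bar>\<rho>\<bar> * \<bar>a \<bullet> w\<bar>)"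
        using assms by (intro young_sublinear[OF Y H3]) auto
      then show "ennreal (G x x (\<bar>\<rho>\<bar> * \<bar>(\<theta> *\<^sub>R a) \<bullet> w\<bar>)) \<le> ennreal \<theta> * ennreal (G x x (\<bar>\<rho>\<bar> * \<bar>a \<bullet> w\<bar>))"
        using assms young_nonneg[OF Y H3, of "\<bar>\<rho>\<bar> * \<bar>a \<bullet> w\<bar>" x x]
        by (simp add: ennreal_mult[symmetric] abs_mult mult_ac ennreal_leI)
    qed
    also have "\<dots> = ennreal \<theta> * (\<integral>\<^sup>+w. ennreal (G x x (\<bar>\<rho>\<bar> * \<bar>a \<bullet> w\<bar>)) \<partial>cone_measure)"
      by (rule nn_integral_cmult) (use meas1 in \<open>simp cong: measurable_cong_sets\<close>)
    finally show ?thesis .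
  qed
  have "H0_cone G x (\<theta> *\<^sub>R a) \<le> (\<integral>\<^sup>+\<rho>. ennreal \<theta> * ((\<integral>\<^sup>+w. ennreal (G x x (\<bar>\<rho>\<bar> * \<bar>a \<bullet> w\<bar>)) \<partial>cone_measure)
      * ennreal (1 / \<rho>) * indicator {0<..<1} \<rho>) \<partial>lborel)"
    unfolding abs mult.assoc[symmetric] by (intro nn_integral_mono mult_right_mono le) simp_all
  also have "\<dots> = ennreal \<theta> * H0_cone G x a"
    unfolding abs by (rule nn_integral_cmult) measurable
  finally show ?thesis .
qed

context
  fixes v :: "real^'n \<Rightarrow> real" and Dv :: "real^'n \<Rightarrow> real^'n" and L R M :: real
  assumes lip: "\<And>x y. \<bar>v x - v y\<bar> \<le> L * norm (x - y)" and L: "0 < L"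
    and supp: "\<And>x. R < norm x \<Longrightarrow> v x = 0"
    and bnd: "\<And>x. \<bar>v x\<bar> \<le> M"
    and der: "\<And>x. (v has_derivative (\<lambda>h. Dv x \<bullet> h)) (at x)"
begin

lemma v_measurable [measurable]: "v \<in> borel_measurable borel"
  by (intro borel_measurable_continuous_onI continuous_at_imp_continuous_on ballI has_derivative_continuous[OF der])

abbreviation quotient :: "real \<Rightarrow> real^'n \<Rightarrow> real^'n \<Rightarrow> real" where
  "quotient s x y \<equiv> \<bar>v x - v y\<bar> / norm (x - y) powr s"

text \<open>The integral over \<open>x\<close> of this density is \<open>1 - s\<close> times the energy of the pairs at distance at
  most \<open>1\<close>.\<close>

definition near_density :: "real \<Rightarrow> real^'n \<Rightarrow> ennreal" where
  "near_density s x = ennreal (1 - s) *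
    (\<integral>\<^sup>+y\<in>{y. norm (x - y) \<le> 1}. ennreal (G x y (quotient s x y) / norm (x - y) ^ CARD('n)) \<partial>lborel)"

lemma near_polar:
  assumes s: "s < 1"
  shows "near_density s x = (\<integral>\<^sup>+\<rho>\<in>{0<..<1}. (\<integral>\<^sup>+w. ennreal (G x (x + (\<rho> powr (1 / (1 - s))) *\<^sub>R w)
      (quotient s x (x + (\<rho> powr (1 / (1 - s))) *\<^sub>R w))) \<partial>cone_measure) * ennreal (1 / \<rho>) \<partial>lborel)"
proof -
  let ?N = "\<lambda>h. ennreal (G x (x + h) (quotient s x (x + h)))"
  have N [measurable]: "?N \<in> borel_measurable borel"
    by (rule measurable_compose[OF young_measurable_snd measurable_ennreal]; (measurable | simp))
  have meas [measurable]: "(\<lambda>y. G x y (quotient s x y)) \<in> borel_measurable borel"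
    by (rule young_measurable_snd; (measurable | simp))
  have "near_density s x = ennreal (1 - s) *
    (\<integral>\<^sup>+h. ennreal (G x (x + h) (quotient s x (x + h)) / norm (x - (x + h)) ^ CARD('n)) * indicator {y. norm (x - y) \<le> 1} (x + h) \<partial>lborel)"
    unfolding near_density_def by (subst nn_integral_lborel_shift[symmetric, where c = x]) auto
  also have "\<dots> = (\<integral>\<^sup>+h. ennreal (1 - s) *
    (ennreal (G x (x + h) (quotient s x (x + h)) / norm (x - (x + h)) ^ CARD('n)) * indicator {y. norm (x - y) \<le> 1} (x + h)) \<partial>lborel)"
    by (rule nn_integral_cmult[symmetric]) measurable
  also have "\<dots> = (\<integral>\<^sup>+h\<in>{h. norm h \<le> 1}. ?N h * ennreal ((1 - s) / norm h ^ DIM(real^'n)) \<partial>lborel)"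
  proof (rule nn_integral_cong)
    fix h :: "real^'n"
    have "0 \<le> G x (x + h) (quotient s x (x + h))" by (intro young_nonneg[OF Y H3]) simp
    then show "ennreal (1 - s) * (ennreal (G x (x + h) (quotient s x (x + h)) / norm (x - (x + h)) ^ CARD('n)) * indicator {y. norm (x - y) \<le> 1} (x + h))
        = ?N h * ennreal ((1 - s) / norm h ^ DIM(real^'n)) * indicator {h. norm h \<le> 1} h"
      using s by (simp add: indicator_def ennreal_mult[symmetric] mult.commute)
  qed
  also have "\<dots> = (\<integral>\<^sup>+\<rho>\<in>{0<..<1}. (\<integral>\<^sup>+w. ?N ((\<rho> powr (1 / (1 - s))) *\<^sub>R w) \<partial>cone_measure) * ennreal (1 / \<rho>) \<partial>lborel)"
    by (rule nn_integral_punctured_ball_polar[OF N]) (use s in simp)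
  finally show ?thesis .
qed

text \<open>With \<open>r powr (1 - s) = \<rho>\<close> the fractional quotient becomes \<open>\<rho>\<close> times the ordinary difference
  quotient, for every \<open>s\<close>.\<close>

lemma quotient_substituted:
  assumes s: "s < 1" and \<rho>: "0 < \<rho>" and w: "norm w = 1"
  defines "r \<equiv> \<rho> powr (1 / (1 - s))"
  shows "quotient s x (x + r *\<^sub>R w) = \<rho> * (\<bar>v x - v (x + r *\<^sub>R w)\<bar> / r)"
proof -
  have r: "0 < r" using \<rho> by (simp add: r_def)
  have "r powr (1 - s) = \<rho>" using s \<rho> by (simp add: r_def powr_powr)
  then have "r powr s = r / \<rho>" using r \<rho> by (simp add: powr_diff field_simps)
  then show ?thesis using r w by simp
qed

lemma quotient_le:
  assumes "s < 1" "0 < \<rho>" "norm w = 1"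
  shows "quotient s x (x + (\<rho> powr (1 / (1 - s))) *\<^sub>R w) \<le> \<rho> * L"
  unfolding quotient_substituted[OF assms]
  using lip[of x "x + (\<rho> powr (1 / (1 - s))) *\<^sub>R w"] assms by (intro mult_left_mono) (auto simp: pos_divide_le_eq)

text \<open>The linear factor \<open>\<rho>\<close> cancels the singularity of \<open>d\<rho> / \<rho>\<close> at \<open>0\<close>; the bound is the same for all
  \<open>s\<close> and \<open>x\<close>.\<close>

lemma near_inner_bound:
  "\<exists>B\<ge>0. \<forall>s x \<rho> w. s < 1 \<longrightarrow> \<rho> \<in> {0<..<1} \<longrightarrow> norm w = 1 \<longrightarrow>
    G x (x + (\<rho> powr (1 / (1 - s))) *\<^sub>R w) (quotient s x (x + (\<rho> powr (1 / (1 - s))) *\<^sub>R w)) \<le> B * \<rho>"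
proof -
  obtain K where K: "0 \<le> K" "\<And>x y t. t \<in> {0..L} \<Longrightarrow> G x y t \<le> K * t" using young_linear_bound[OF Y H1 H3, of L] by blast
  have "G x (x + (\<rho> powr (1 / (1 - s))) *\<^sub>R w) (quotient s x (x + (\<rho> powr (1 / (1 - s))) *\<^sub>R w)) \<le> K * L * \<rho>"
    if "s < 1" "\<rho> \<in> {0<..<1}" "norm w = 1" for s x \<rho> w
  proof -
    let ?q = "quotient s x (x + (\<rho> powr (1 / (1 - s))) *\<^sub>R w)"
    have q: "?q \<le> \<rho> * L" using that by (intro quotient_le) auto
    moreover have "\<rho> * L \<le> L" using that L by simp
    ultimately have "G x (x + (\<rho> powr (1 / (1 - s))) *\<^sub>R w) ?q \<le> K * ?q" by (intro K) auto
    also have "\<dots> \<le> K * (\<rho> * L)" using q K by (intro mult_left_mono) auto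
    finally show ?thesis by (simp add: mult_ac)
  qed
  then show ?thesis using K L by (intro exI[of _ "K * L"]) auto
qed

lemma near_radial_bound:
  fixes \<rho> :: real
  assumes B: "0 \<le> B" and bound: "\<And>\<rho> w. \<rho> \<in> {0<..<1} \<Longrightarrow> norm w = 1 \<Longrightarrow> \<phi> \<rho> w \<le> B * \<rho>"
  shows "(\<integral>\<^sup>+w. ennreal (\<phi> \<rho> w) \<partial>(cone_measure :: (real^'n) measure)) * ennreal (1 / \<rho>) * indicator {0<..<1} \<rho>
    \<le> ennreal B * emeasure (cone_measure :: (real^'n) measure) UNIV * indicator {0<..<1} \<rho>"
    (is "?I * _ * _ \<le> ennreal B * ?\<sigma> * _")
proof (cases "\<rho> \<in> {0<..<1}")
  case True
  have "?I \<le> (\<integral>\<^sup>+w. ennreal (B * \<rho>) \<partial>(cone_measure :: (real^'n) measure))"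
    by (rule nn_integral_mono_AE, rule AE_mp[OF AE_cone_measure_sphere], rule AE_I2)
      (use bound[OF True] in \<open>auto intro!: ennreal_leI\<close>)
  also have "\<dots> = ennreal (B * \<rho>) * ?\<sigma>" by simp
  finally have "?I * ennreal (1 / \<rho>) \<le> ennreal (B * \<rho>) * ?\<sigma> * ennreal (1 / \<rho>)" by (rule mult_right_mono) simp
  also have "\<dots> = (ennreal (B * \<rho>) * ennreal (1 / \<rho>)) * ?\<sigma>" by (simp only: mult_ac)
  also have "ennreal (B * \<rho>) * ennreal (1 / \<rho>) = ennreal B"
    using True B by (simp add: ennreal_mult[symmetric])
  finally show ?thesis using True by simp
qed simp

lemma near_bounded: "\<exists>B<\<infinity>. \<forall>s<1. \<forall>x. near_density s x \<le> B"
proof -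
  obtain B where B: "0 \<le> B" "\<And>s x \<rho> w. s < 1 \<Longrightarrow> \<rho> \<in> {0<..<1} \<Longrightarrow> norm w = 1 \<Longrightarrow>
    G x (x + (\<rho> powr (1 / (1 - s))) *\<^sub>R w) (quotient s x (x + (\<rho> powr (1 / (1 - s))) *\<^sub>R w)) \<le> B * \<rho>"
    using near_inner_bound by blast
  let ?\<sigma> = "emeasure (cone_measure :: (real^'n) measure) UNIV"
  have "near_density s x \<le> ennreal B * ?\<sigma>" if s: "s < 1" for s x
  proof -
    have "near_density s x \<le> (\<integral>\<^sup>+\<rho>. ennreal B * ?\<sigma> * indicator {0<..<1::real} \<rho> \<partial>lborel)"
      unfolding near_polar[OF s]
      by (rule nn_integral_mono) (rule near_radial_bound[OF B(1) B(2)[OF s]])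
    also have "\<dots> = ennreal B * ?\<sigma>" by (subst nn_integral_cmult_indicator) auto
    finally show ?thesis .
  qed
  moreover have "ennreal B * ?\<sigma> < \<infinity>" using finite_cone_measure[where 'a = "real^'n"] by (simp add: ennreal_mult_less_top)
  ultimately show ?thesis by blast
qed

lemma near_outside:
  assumes "R + 1 < norm x" shows "near_density s x = 0"
proof -
  have "v x = 0" using assms by (intro supp) simp
  moreover have "v y = 0" if "norm (x - y) \<le> 1" for y
    using assms that norm_triangle_ineq2[of x "x - y"] by (intro supp) (simp add: norm_minus_commute)
  ultimately have "(\<integral>\<^sup>+y\<in>{y. norm (x - y) \<le> 1}. ennreal (G x y (quotient s x y) / norm (x - y) ^ CARD('n)) \<partial>lborel) =
      (\<integral>\<^sup>+y. 0 \<partial>(lborel :: (real^'n) measure))"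
    by (intro nn_integral_cong) (auto simp: indicator_def young_zero[OF Y])
  then show ?thesis by (simp add: near_density_def)
qed

text \<open>For fixed \<open>\<rho> < 1\<close> the radius tends to \<open>0\<close>, so the difference quotient converges to the modulus of
  the directional derivative and the second argument of \<open>G\<close> to \<open>x\<close>. Dominated convergence is applied
  first on the sphere and then in \<open>\<rho>\<close>.\<close>

lemma near_tendsto:
  assumes s: "\<And>i. s i < 1" "s \<longlonglongrightarrow> 1"
  shows "(\<lambda>i. near_density (s i) x) \<longlonglongrightarrow> H0_cone G x (Dv x)"
proof -
  obtain B where B: "0 \<le> B" "\<And>s x \<rho> w. s < 1 \<Longrightarrow> \<rho> \<in> {0<..<1} \<Longrightarrow> norm w = 1 \<Longrightarrow>
    G x (x + (\<rho> powr (1 / (1 - s))) *\<^sub>R w) (quotient s x (x + (\<rho> powr (1 / (1 - s))) *\<^sub>R w)) \<le> B * \<rho>"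
    using near_inner_bound by blast
  let ?\<sigma> = "emeasure (cone_measure :: (real^'n) measure) UNIV"
  let ?r = "\<lambda>i \<rho>. \<rho> powr (1 / (1 - s i))"
  let ?f = "\<lambda>i \<rho> w. ennreal (G x (x + ?r i \<rho> *\<^sub>R w) (quotient (s i) x (x + ?r i \<rho> *\<^sub>R w)))"
  let ?F = "\<lambda>w \<rho>. ennreal (G x x (\<rho> * \<bar>Dv x \<bullet> w\<bar>))"
  have f_meas: "(\<lambda>p. ?f i (fst p) (snd p)) \<in> borel_measurable (borel \<Otimes>\<^sub>M borel)" for i
    by (rule measurable_compose[OF young_measurable_snd measurable_ennreal]; (measurable | simp))
  have f_meas1: "?f i \<rho> \<in> borel_measurable borel" for i \<rho>
    by (rule measurable_compose[OF young_measurable_snd measurable_ennreal]; (measurable | simp))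
  have F_meas1: "(\<lambda>w. ?F w \<rho>) \<in> borel_measurable borel" if "0 < \<rho>" for \<rho>
    by (rule measurable_compose[OF young_measurable measurable_ennreal], measurable) (use that in simp)
  \<comment> \<open>\<open>G x x\<close> is only controlled on nonnegative arguments, hence the absolute value of \<open>\<rho>\<close>.\<close>
  have F_meas: "(\<lambda>p. ?F (snd p) \<bar>fst p\<bar>) \<in> borel_measurable (borel \<Otimes>\<^sub>M borel)"
    by (rule measurable_compose[OF young_measurable measurable_ennreal]) (measurable, simp?)
  have f_int [measurable]: "(\<lambda>\<rho>. \<integral>\<^sup>+w. ?f i \<rho> w \<partial>cone_measure) \<in> borel_measurable borel" for i
    by (rule cone_measure.borel_measurable_nn_integral)
      (use f_meas[of i] in \<open>simp add: case_prod_unfold cong: measurable_cong_sets sets_pair_measure_cong\<close>)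
  have F_int [measurable]: "(\<lambda>\<rho>. \<integral>\<^sup>+w. ?F w \<bar>\<rho>\<bar> \<partial>cone_measure) \<in> borel_measurable borel"
    by (rule cone_measure.borel_measurable_nn_integral)
      (use F_meas in \<open>simp add: case_prod_unfold cong: measurable_cong_sets sets_pair_measure_cong\<close>)
  have r_lim: "(\<lambda>i. ?r i \<rho>) \<longlonglongrightarrow> 0" if \<rho>: "\<rho> \<in> {0<..<1}" for \<rho>
  proof -
    have "filterlim (\<lambda>i. 1 - s i) (at_right 0) sequentially"
      using s tendsto_diff[OF tendsto_const[of 1] s(2)] by (auto simp: filterlim_at less_imp_neq[OF s(1)])
    then have "filterlim (\<lambda>i. 1 / (1 - s i)) at_top sequentially"
      by (simp add: divide_inverse) (rule filterlim_compose[OF filterlim_inverse_at_top_right])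
    then have "filterlim (\<lambda>i. ln \<rho> * (1 / (1 - s i))) at_bot sequentially"
      by (rule filterlim_tendsto_neg_mult_at_bot[OF tendsto_const, rotated]) (use \<rho> in simp)
    then have "(\<lambda>i. exp (ln \<rho> * (1 / (1 - s i)))) \<longlonglongrightarrow> 0" by (rule filterlim_compose[OF exp_at_bot])
    then show ?thesis using \<rho> by (simp add: powr_def mult.commute)
  qed
  have inner: "(\<lambda>i. \<integral>\<^sup>+w. ?f i \<rho> w \<partial>cone_measure) \<longlonglongrightarrow> (\<integral>\<^sup>+w. ?F w \<rho> \<partial>cone_measure)"
    if \<rho>: "\<rho> \<in> {0<..<1}" for \<rho>
  proof (rule nn_integral_dominated_convergence[where w = "\<lambda>_. ennreal (B * \<rho>)"])
    show "AE w in cone_measure. ?f i \<rho> w \<le> ennreal (B * \<rho>)" for i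
      by (rule AE_mp[OF AE_cone_measure_sphere], rule AE_I2)
        (use B(2)[OF s(1) \<rho>] in \<open>auto intro!: ennreal_leI\<close>)
    show "(\<integral>\<^sup>+w. ennreal (B * \<rho>) \<partial>(cone_measure :: (real^'n) measure)) < \<infinity>"
      using finite_cone_measure[where 'a = "real^'n"] by (simp add: ennreal_mult_less_top)
    show "AE w in cone_measure. (\<lambda>i. ?f i \<rho> w) \<longlonglongrightarrow> ?F w \<rho>"
    proof (rule AE_mp[OF AE_cone_measure_sphere], rule AE_I2, rule impI)
      fix w :: "real^'n" assume w: "norm w = 1"
      have "(\<lambda>i. \<rho> * (\<bar>v x - v (x + ?r i \<rho> *\<^sub>R w)\<bar> / ?r i \<rho>)) \<longlonglongrightarrow> \<rho> * \<bar>Dv x \<bullet> w\<bar>"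
        using \<rho> by (intro tendsto_mult tendsto_const difference_quotient_tendsto[OF der r_lim]) auto
      then have q: "(\<lambda>i. quotient (s i) x (x + ?r i \<rho> *\<^sub>R w)) \<longlonglongrightarrow> \<rho> * \<bar>Dv x \<bullet> w\<bar>"
        using \<rho> by (subst quotient_substituted[OF s(1) _ w]) auto
      have "(\<lambda>i. x + ?r i \<rho> *\<^sub>R w) \<longlonglongrightarrow> x + 0 *\<^sub>R w"
        by (intro tendsto_add tendsto_const tendsto_scaleR r_lim[OF \<rho>])
      then have "(\<lambda>i. x + ?r i \<rho> *\<^sub>R w) \<longlonglongrightarrow> x" by simp
      from young_tendsto[OF Y H1 H2 H3 this q]
      have "(\<lambda>i. G x (x + ?r i \<rho> *\<^sub>R w) (quotient (s i) x (x + ?r i \<rho> *\<^sub>R w))) \<longlonglongrightarrow> G x x (\<rho> * \<bar>Dv x \<bullet> w\<bar>)" by simp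
      then show "(\<lambda>i. ?f i \<rho> w) \<longlonglongrightarrow> ?F w \<rho>" by (rule tendsto_ennrealI)
    qed
  qed (use f_meas1 F_meas1 \<rho> in \<open>auto cong: measurable_cong_sets\<close>)
  have "(\<lambda>i. near_density (s i) x) \<longlonglongrightarrow> (\<integral>\<^sup>+\<rho>. (\<integral>\<^sup>+w. ?F w \<bar>\<rho>\<bar> \<partial>cone_measure) * ennreal (1 / \<rho>) * indicator {0<..<1} \<rho> \<partial>lborel)"
    unfolding near_polar[OF s(1)]
  proof (rule nn_integral_dominated_convergence[where w = "\<lambda>\<rho>. ennreal B * ?\<sigma> * indicator {0<..<1} \<rho>"])
    fix i
    show "AE \<rho> in lborel. (\<integral>\<^sup>+w. ?f i \<rho> w \<partial>cone_measure) * ennreal (1 / \<rho>) * indicator {0<..<1} \<rho>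
        \<le> ennreal B * ?\<sigma> * indicator {0<..<1} \<rho>"
      by (rule AE_I2) (rule near_radial_bound[OF B(1) B(2)[OF s(1)]])
  next
    have "(\<integral>\<^sup>+\<rho>. ennreal B * ?\<sigma> * indicator {0<..<1::real} \<rho> \<partial>lborel) = ennreal B * ?\<sigma>"
      by (subst nn_integral_cmult_indicator) auto
    then show "(\<integral>\<^sup>+\<rho>. ennreal B * ?\<sigma> * indicator {0<..<1::real} \<rho> \<partial>lborel) < \<infinity>"
      using finite_cone_measure[where 'a = "real^'n"] by (simp add: ennreal_mult_less_top)
  next
    show "AE \<rho> in lborel. (\<lambda>i. (\<integral>\<^sup>+w. ?f i \<rho> w \<partial>cone_measure) * ennreal (1 / \<rho>) * indicator {0<..<1} \<rho>)
        \<longlonglongrightarrow> (\<integral>\<^sup>+w. ?F w \<bar>\<rho>\<bar> \<partial>cone_measure) * ennreal (1 / \<rho>) * indicator {0<..<1} \<rho>"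
    proof (rule AE_I2)
      fix \<rho> :: real
      show "(\<lambda>i. (\<integral>\<^sup>+w. ?f i \<rho> w \<partial>cone_measure) * ennreal (1 / \<rho>) * indicator {0<..<1} \<rho>)
        \<longlonglongrightarrow> (\<integral>\<^sup>+w. ?F w \<bar>\<rho>\<bar> \<partial>cone_measure) * ennreal (1 / \<rho>) * indicator {0<..<1} \<rho>"
      proof (cases "\<rho> \<in> {0<..<1}")
        case True
        then have "(\<lambda>i. (\<integral>\<^sup>+w. ?f i \<rho> w \<partial>cone_measure) * ennreal (1 / \<rho>))
          \<longlonglongrightarrow> (\<integral>\<^sup>+w. ?F w \<rho> \<partial>cone_measure) * ennreal (1 / \<rho>)"
          by (intro tendsto_mult_ennreal tendsto_const inner) auto
        with True show ?thesis by simp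
      qed simp
    qed
  qed measurable
  also have "(\<integral>\<^sup>+\<rho>. (\<integral>\<^sup>+w. ?F w \<bar>\<rho>\<bar> \<partial>cone_measure) * ennreal (1 / \<rho>) * indicator {0<..<1} \<rho> \<partial>lborel) = H0_cone G x (Dv x)"
    unfolding H0_cone_def by (intro nn_integral_cong) (auto simp: indicator_def)
  finally show ?thesis .
qed

definition energy_integrand :: "real \<Rightarrow> (real^'n) \<times> (real^'n) \<Rightarrow> ennreal" where
  "energy_integrand s = (\<lambda>(x, y). ennreal (G x y (quotient s x y) / norm (x - y) ^ CARD('n)))"

lemma energy_integrand_measurable: "energy_integrand s \<in> borel_measurable lebesgue"
proof -
  have "(\<lambda>p. (\<lambda>(x, y). G x y ((\<lambda>p. quotient s (fst p) (snd p)) (x, y))) p / norm (fst p - snd p) ^ CARD('n)) \<in> borel_measurable lebesgue"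
  proof (rule borel_measurable_divide)
    show "(\<lambda>(x, y). G x y ((\<lambda>p. quotient s (fst p) (snd p)) (x, y))) \<in> borel_measurable lebesgue"
    proof (rule young_measurable_pair)
      show "(\<lambda>p. quotient s (fst p) (snd p)) \<in> borel_measurable borel"
        unfolding borel_prod[symmetric] by measurable
    qed simp
    have "(\<lambda>p :: (real^'n) \<times> (real^'n). norm (fst p - snd p) ^ CARD('n)) \<in> borel_measurable borel"
      by (intro borel_measurable_continuous_onI continuous_intros)
    then have "(\<lambda>p :: (real^'n) \<times> (real^'n). norm (fst p - snd p) ^ CARD('n)) \<in> borel_measurable lborel"
      by simp
    then show "(\<lambda>p :: (real^'n) \<times> (real^'n). norm (fst p - snd p) ^ CARD('n)) \<in> borel_measurable lebesgue"
      by (rule measurable_completion)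
  qed
  then show ?thesis unfolding energy_integrand_def by (simp add: case_prod_unfold)
qed

lemma near_set_measurable: "{p :: (real^'n) \<times> (real^'n). norm (fst p - snd p) \<le> 1} \<in> sets borel"
  by (intro borel_closed closed_Collect_le continuous_intros)

lemma near_energy:
  assumes s: "s < 1"
  shows "near_density s \<in> borel_measurable lebesgue"
    and "ennreal (1 - s) * (\<integral>\<^sup>+p\<in>{p. norm (fst p - snd p) \<le> 1}. energy_integrand s p \<partial>lebesgue) = (\<integral>\<^sup>+x. near_density s x \<partial>lebesgue)"
proof -
  let ?S = "{p :: (real^'n) \<times> (real^'n). norm (fst p - snd p) \<le> 1}"
  have "indicator ?S \<in> borel_measurable lebesgue"
    using near_set_measurable by (intro borel_measurable_indicator) simp
  with energy_integrand_measurable have meas: "(\<lambda>p. energy_integrand s p * indicator ?S p) \<in> borel_measurable lebesgue"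
    by (rule borel_measurable_times_ennreal)
  note pair = nn_integral_lebesgue_pair[OF meas]
  have near: "near_density s = (\<lambda>x. ennreal (1 - s) * (\<integral>\<^sup>+y. energy_integrand s (x, y) * indicator ?S (x, y) \<partial>lborel))"
    by (simp add: near_density_def energy_integrand_def indicator_def fun_eq_iff)
  show "near_density s \<in> borel_measurable lebesgue"
    unfolding near using pair(1) by (intro borel_measurable_times_ennreal) auto
  show "ennreal (1 - s) * (\<integral>\<^sup>+p\<in>?S. energy_integrand s p \<partial>lebesgue) = (\<integral>\<^sup>+x. near_density s x \<partial>lebesgue)"
    unfolding near pair(2) using pair(1) by (intro nn_integral_cmult[symmetric])
qed

text \<open>Measurability of \<open>G\<close> on pairs says nothing about the diagonal, so \<open>H0_cone\<close> is measurable in \<open>x\<close>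
  because it is a pointwise limit of densities whose integrands are measurable off the diagonal.\<close>

lemma near_energy_tendsto:
  assumes s: "\<And>i. s i < 1" "s \<longlonglongrightarrow> 1"
  shows "(\<lambda>x. H0_cone G x (Dv x)) \<in> borel_measurable lebesgue"
    and "(\<lambda>i. \<integral>\<^sup>+x. near_density (s i) x \<partial>lebesgue) \<longlonglongrightarrow> (\<integral>\<^sup>+x. H0_cone G x (Dv x) \<partial>lebesgue)"
proof -
  note lim = near_tendsto[OF s]
  show meas: "(\<lambda>x. H0_cone G x (Dv x)) \<in> borel_measurable lebesgue"
    by (rule borel_measurable_LIMSEQ_order[OF lim]) (use near_energy(1)[OF s(1)] in auto)
  obtain B where B: "B < \<infinity>" "\<And>s x. s < 1 \<Longrightarrow> near_density s x \<le> B" using near_bounded by blast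
  let ?C = "cball 0 (R + 1) :: (real^'n) set"
  show "(\<lambda>i. \<integral>\<^sup>+x. near_density (s i) x \<partial>lebesgue) \<longlonglongrightarrow> (\<integral>\<^sup>+x. H0_cone G x (Dv x) \<partial>lebesgue)"
  proof (rule nn_integral_dominated_convergence[where w = "\<lambda>x. B * indicator ?C x"])
    show "AE x in lebesgue. near_density (s i) x \<le> B * indicator ?C x" for i
    proof (rule AE_I2)
      fix x show "near_density (s i) x \<le> B * indicator ?C x"
        using B(2)[OF s(1)] near_outside[of x "s i"] by (cases "R + 1 < norm x") (auto simp: indicator_def)
    qed
    have "(\<integral>\<^sup>+x. B * indicator ?C x \<partial>lebesgue) = B * emeasure lborel ?C"
      by (subst nn_integral_cmult_indicator) auto
    also have "\<dots> < \<infinity>"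
      using B(1) emeasure_bounded_finite[of ?C] by (simp add: ennreal_mult_less_top)
    finally show "(\<integral>\<^sup>+x. B * indicator ?C x \<partial>lebesgue) < \<infinity>" .
    show "AE x in lebesgue. (\<lambda>i. near_density (s i) x) \<longlonglongrightarrow> H0_cone G x (Dv x)" using lim by simp
  qed (use meas near_energy(1)[OF s(1)] in \<open>auto intro!: borel_measurable_times_ennreal borel_measurable_indicator\<close>)
qed

text \<open>The quotient is at most \<open>2 * M\<close> at distance more than \<open>1\<close>, so \<open>G\<close> is dominated by a multiple of
  \<open>\<bar>v x\<bar> + \<bar>v y\<bar>\<close> times \<open>norm (x - y) powr (-1/2)\<close>, by \<open>1 / 2 \<le> s\<close>. This exponent makes the kernel
  integrable at infinity, uniformly in \<open>s\<close>.\<close>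

lemma far_energy_bounded:
  "\<exists>C<\<infinity>. \<forall>s\<in>{1/2..<1}. (\<integral>\<^sup>+p\<in>{p. 1 < norm (fst p - snd p)}. energy_integrand s p \<partial>lebesgue) \<le> C"
proof -
  obtain K where K: "0 \<le> K" "\<And>x y t. t \<in> {0..2 * M} \<Longrightarrow> G x y t \<le> K * t" using young_linear_bound[OF Y H1 H3, of "2 * M"] by blast
  define \<kappa> where "\<kappa> h = ennreal (norm h powr (-1/2) / norm h ^ DIM(real^'n)) * indicator {h. 1 < norm h} h" for h :: "real^'n"
  define I where "I = (\<integral>\<^sup>+h. \<kappa> h \<partial>lborel)"
  have [measurable]: "\<kappa> \<in> borel_measurable borel" unfolding \<kappa>_def by measurable
  have I: "I < \<infinity>" unfolding I_def \<kappa>_def by (rule nn_integral_tail_finite)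
  define N where "N = (\<integral>\<^sup>+x. ennreal \<bar>v x\<bar> \<partial>lborel)"
  have "N \<le> (\<integral>\<^sup>+x. ennreal M * indicator (cball 0 R :: (real^'n) set) x \<partial>lborel)"
    unfolding N_def
  proof (rule nn_integral_mono)
    fix x show "ennreal \<bar>v x\<bar> \<le> ennreal M * indicator (cball 0 R) x"
      using bnd[of x] supp[of x] by (cases "R < norm x") (auto simp: ennreal_leI)
  qed
  also have "\<dots> = ennreal M * emeasure lborel (cball 0 R :: (real^'n) set)" by (subst nn_integral_cmult_indicator) auto
  also have "\<dots> < \<infinity>" using emeasure_bounded_finite[of "cball 0 R :: (real^'n) set"] by (simp add: ennreal_mult_less_top)
  finally have N: "N < \<infinity>" .
  let ?b = "\<lambda>x y. ennreal (K * \<bar>v x\<bar>) * \<kappa> (x - y) + ennreal (K * \<bar>v y\<bar>) * \<kappa> (x - y)"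
  have bound: "(\<integral>\<^sup>+p\<in>{p. 1 < norm (fst p - snd p)}. energy_integrand s p \<partial>lebesgue) \<le> ennreal K * N * I + ennreal K * N * I"
    if s: "s \<in> {1/2..<1}" for s
  proof -
    have pt: "energy_integrand s p * indicator {p. 1 < norm (fst p - snd p)} p \<le> (case p of (x, y) \<Rightarrow> ?b x y)" for p
    proof (cases p)
      case (Pair x y)
      show ?thesis
      proof (cases "1 < norm (x - y)")
        case True
        let ?d = "norm (x - y)"
        \<comment> \<open>The distance is at least \<open>1\<close>, so dividing by its power does not increase the numerator.\<close>
        have "1 \<le> ?d powr s" using True s by (intro ge_one_powr_ge_zero) auto
        then have "quotient s x y \<le> \<bar>v x - v y\<bar> / 1" using True by (intro divide_left_mono) auto
        moreover have "\<bar>v x - v y\<bar> \<le> \<bar>v x\<bar> + \<bar>v y\<bar>" by (rule abs_triangle_ineq4)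
        ultimately have "quotient s x y \<le> 2 * M" using bnd[of x] bnd[of y] by simp
        then have "G x y (quotient s x y) \<le> K * quotient s x y" by (intro K) auto
        also have "\<dots> \<le> K * ((\<bar>v x\<bar> + \<bar>v y\<bar>) * ?d powr (-1/2))"
        proof (intro mult_left_mono K)
          have "quotient s x y = \<bar>v x - v y\<bar> * ?d powr (-s)" using True by (simp add: powr_minus divide_inverse)
          also have "\<dots> \<le> (\<bar>v x\<bar> + \<bar>v y\<bar>) * ?d powr (-1/2)"
            using True s by (intro mult_mono abs_triangle_ineq4 powr_mono) auto
          finally show "quotient s x y \<le> (\<bar>v x\<bar> + \<bar>v y\<bar>) * ?d powr (-1/2)" .
        qed
        finally have "G x y (quotient s x y) / ?d ^ CARD('n) \<le> K * ((\<bar>v x\<bar> + \<bar>v y\<bar>) * ?d powr (-1/2)) / ?d ^ CARD('n)"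
          by (intro divide_right_mono) auto
        also have "\<dots> = (K * \<bar>v x\<bar>) * (?d powr (-1/2) / ?d ^ CARD('n)) + (K * \<bar>v y\<bar>) * (?d powr (-1/2) / ?d ^ CARD('n))"
          by (simp add: distrib_left distrib_right add_divide_distrib mult.assoc)
        finally have "energy_integrand s p \<le> ennreal ((K * \<bar>v x\<bar>) * (?d powr (-1/2) / ?d ^ CARD('n)) + (K * \<bar>v y\<bar>) * (?d powr (-1/2) / ?d ^ CARD('n)))"
          unfolding Pair energy_integrand_def by (simp add: ennreal_leI)
        also have "\<dots> = ?b x y" using True K(1) by (simp add: \<kappa>_def ennreal_mult[symmetric] ennreal_plus)
        finally show ?thesis using Pair by (simp add: indicator_def)
      qed (simp add: Pair)
    qed
    have "(\<integral>\<^sup>+p\<in>{p. 1 < norm (fst p - snd p)}. energy_integrand s p \<partial>lebesgue) \<le> (\<integral>\<^sup>+p. (case p of (x, y) \<Rightarrow> ?b x y) \<partial>lebesgue)"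
      by (rule nn_integral_mono) (rule pt)
    also have "\<dots> = (\<integral>\<^sup>+p. (case p of (x, y) \<Rightarrow> ?b x y) \<partial>(lborel \<Otimes>\<^sub>M lborel))"
      unfolding nn_integral_completion lborel_prod ..
    also have "\<dots> = (\<integral>\<^sup>+p. (case p of (x, y) \<Rightarrow> ennreal (K * \<bar>v x\<bar>) * \<kappa> (x - y)) \<partial>(lborel \<Otimes>\<^sub>M lborel)) +
        (\<integral>\<^sup>+p. (case p of (x, y) \<Rightarrow> ennreal (K * \<bar>v y\<bar>) * \<kappa> (x - y)) \<partial>(lborel \<Otimes>\<^sub>M lborel))"
      unfolding case_prod_unfold by (rule nn_integral_add) measurable
    also have "(\<integral>\<^sup>+p. (case p of (x, y) \<Rightarrow> ennreal (K * \<bar>v x\<bar>) * \<kappa> (x - y)) \<partial>(lborel \<Otimes>\<^sub>M lborel)) =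
        (\<integral>\<^sup>+x. \<integral>\<^sup>+y. ennreal (K * \<bar>v x\<bar>) * \<kappa> (x - y) \<partial>lborel \<partial>lborel)"
      by (subst lborel.nn_integral_fst[symmetric]) auto
    also have "\<dots> = (\<integral>\<^sup>+x. ennreal (K * \<bar>v x\<bar>) * I \<partial>lborel)"
      unfolding I_def by (simp add: nn_integral_cmult nn_integral_lborel_reflect)
    also have "\<dots> = ennreal K * N * I"
      unfolding N_def using K(1) by (simp add: nn_integral_multc nn_integral_cmult ennreal_mult)
    also have "(\<integral>\<^sup>+p. (case p of (x, y) \<Rightarrow> ennreal (K * \<bar>v y\<bar>) * \<kappa> (x - y)) \<partial>(lborel \<Otimes>\<^sub>M lborel)) =
        (\<integral>\<^sup>+y. \<integral>\<^sup>+x. ennreal (K * \<bar>v y\<bar>) * \<kappa> (x - y) \<partial>lborel \<partial>lborel)"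
      by (subst lborel_pair.nn_integral_snd[symmetric]) auto
    also have "\<dots> = (\<integral>\<^sup>+y. ennreal (K * \<bar>v y\<bar>) * I \<partial>lborel)"
    proof (rule nn_integral_cong)
      fix y
      have "(\<integral>\<^sup>+x. \<kappa> (x - y) \<partial>lborel) = I"
        using nn_integral_lborel_shift[of \<kappa> "- y"] by (simp add: I_def)
      then show "(\<integral>\<^sup>+x. ennreal (K * \<bar>v y\<bar>) * \<kappa> (x - y) \<partial>lborel) = ennreal (K * \<bar>v y\<bar>) * I"
        by (simp add: nn_integral_cmult)
    qed
    also have "\<dots> = ennreal K * N * I"
      unfolding N_def using K(1) by (simp add: nn_integral_multc nn_integral_cmult ennreal_mult)
    finally show ?thesis .
  qed
  show ?thesis
    using bound N I by (intro exI[of _ "ennreal K * N * I + ennreal K * N * I"]) (auto simp: ennreal_mult_less_top)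
qed

text \<open>The Bourgain-Brezis-Mironescu limit for \<open>G\<close>, with the surface integral written with the cone
  measure.\<close>

theorem energy_tendsto:
  assumes s: "\<And>i. 1 / 2 \<le> s i" "\<And>i. s i < 1" "s \<longlonglongrightarrow> 1"
  shows "(\<lambda>i. ennreal (1 - s i) * energy (s i) G v) \<longlonglongrightarrow> (\<integral>\<^sup>+x. H0_cone G x (Dv x) \<partial>lebesgue)"
proof -
  let ?far = "\<lambda>i. ennreal (1 - s i) * (\<integral>\<^sup>+p\<in>{p. 1 < norm (fst p - snd p)}. energy_integrand (s i) p \<partial>lebesgue)"
  have split: "ennreal (1 - s i) * energy (s i) G v = (\<integral>\<^sup>+x. near_density (s i) x \<partial>lebesgue) + ?far i" for i
  proof -
    let ?S = "{p :: (real^'n) \<times> (real^'n). norm (fst p - snd p) \<le> 1}"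
    have S: "?S \<in> sets lebesgue" using near_set_measurable by simp
    then have "- ?S \<in> sets lebesgue" using sets.compl_sets[OF S] by (simp add: Compl_eq_Diff_UNIV)
    then have meas: "(\<lambda>p. energy_integrand (s i) p * indicator ?S p) \<in> borel_measurable lebesgue"
      "(\<lambda>p. energy_integrand (s i) p * indicator (- ?S) p) \<in> borel_measurable lebesgue"
      using S energy_integrand_measurable by (auto intro!: borel_measurable_times_ennreal borel_measurable_indicator)
    have "energy (s i) G v = (\<integral>\<^sup>+p. energy_integrand (s i) p * indicator ?S p + energy_integrand (s i) p * indicator (- ?S) p \<partial>lebesgue)"
      unfolding energy_def by (intro nn_integral_cong) (auto simp: energy_integrand_def indicator_def)
    also have "\<dots> = (\<integral>\<^sup>+p\<in>?S. energy_integrand (s i) p \<partial>lebesgue) + (\<integral>\<^sup>+p\<in>- ?S. energy_integrand (s i) p \<partial>lebesgue)"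
      by (rule nn_integral_add) (fact meas)+
    also have "- ?S = {p. 1 < norm (fst p - snd p)}" by auto
    finally show ?thesis by (simp only: distrib_left near_energy(2)[OF s(2)])
  qed
  obtain C where C: "C < \<infinity>" "\<And>s. s \<in> {1/2..<1} \<Longrightarrow>
      (\<integral>\<^sup>+p\<in>{p. 1 < norm (fst p - snd p)}. energy_integrand s p \<partial>lebesgue) \<le> C"
    using far_energy_bounded by blast
  have "?far \<longlonglongrightarrow> 0"
  proof (rule tendsto_sandwich[OF always_eventually always_eventually tendsto_const])
    show "\<forall>i. ?far i \<le> ennreal (1 - s i) * C" using C(2) s by (auto intro!: mult_left_mono)
    have "(\<lambda>i. ennreal (1 - s i) * C) \<longlonglongrightarrow> ennreal (1 - 1) * C"
      using C(1) by (intro tendsto_mult_ennreal tendsto_const tendsto_ennrealI tendsto_diff s) auto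
    then show "(\<lambda>i. ennreal (1 - s i) * C) \<longlonglongrightarrow> 0" by simp
  qed simp
  from tendsto_add[OF near_energy_tendsto(2)[OF s(2,3)] this] show ?thesis by (simp add: split)
qed

end

end

section \<open>Test functions and the Luxemburg quantities\<close>

text \<open>The derivative vanishes outside the support and is bounded on it, which is what makes \<open>u\<close>
  Lipschitz.\<close>

lemma C2_compact_support_regular:
  fixes u :: "'a::euclidean_space \<Rightarrow> real"
  assumes "C2_compact_support u"
  obtains L R M where "0 < L" "\<And>x y. \<bar>u x - u y\<bar> \<le> L * norm (x - y)" "\<And>x. R < norm x \<Longrightarrow> u x = 0"
    "\<And>x. \<bar>u x\<bar> \<le> M" "\<And>x. (u has_derivative (\<lambda>h. gradient u x \<bullet> h)) (at x)"
proof -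
  define S where "S = closure {x. u x \<noteq> 0}"
  obtain u' :: "'a \<Rightarrow> 'a \<Rightarrow>\<^sub>L real" and u'' where S: "compact S"
    and u': "\<And>x. (u has_derivative blinfun_apply (u' x)) (at x)"
    and u'': "\<And>x. (u' has_derivative blinfun_apply (u'' x)) (at x)"
    using assms unfolding C2_compact_support_def S_def by blast
  have cont: "continuous_on A u" "continuous_on A u'" for A
    by (intro continuous_at_imp_continuous_on ballI has_derivative_continuous[OF u'] has_derivative_continuous[OF u''])+
  have zero: "u x = 0" if "x \<notin> S" for x
    using that subsetD[OF closure_subset, of x "{x. u x \<noteq> 0}"] by (auto simp: S_def)
  have zero': "u' x = 0" if x: "x \<notin> S" for x
  proof -
    have "((\<lambda>_. 0) has_derivative blinfun_apply (u' x)) (at x)"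
      by (rule has_derivative_transform_within_open[OF u', of "- S"])
        (use x zero compact_imp_closed[OF S] in auto)
    then have "blinfun_apply (u' x) = (\<lambda>_. 0)" by (rule has_derivative_unique) (rule has_derivative_const)
    then show ?thesis by (intro blinfun_eqI) simp
  qed
  obtain M where M: "0 < M" "\<And>x. x \<in> S \<Longrightarrow> \<bar>u x\<bar> \<le> M"
    using compact_imp_bounded[OF compact_continuous_image[OF cont(1) S]] by (auto simp: bounded_pos)
  obtain L where L: "0 < L" "\<And>x. x \<in> S \<Longrightarrow> norm (u' x) \<le> L"
    using compact_imp_bounded[OF compact_continuous_image[OF cont(2) S]] by (auto simp: bounded_pos)
  obtain R where R: "\<And>x. x \<in> S \<Longrightarrow> norm x \<le> R"
    using compact_imp_bounded[OF S] by (auto simp: bounded_iff)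
  have "norm (u' x) \<le> L" for x using L zero'[of x] by (cases "x \<in> S") auto
  then have lip: "\<bar>u x - u y\<bar> \<le> L * norm (x - y)" for x y
    using differentiable_bound[of UNIV u "\<lambda>x. blinfun_apply (u' x)" L x y] u' by (simp add: norm_blinfun.rep_eq)
  have grad: "(u has_derivative (\<lambda>h. gradient u x \<bullet> h)) (at x)" for x
  proof -
    define D where "D = (\<Sum>b\<in>Basis. blinfun_apply (u' x) b *\<^sub>R b)"
    have "blinfun_apply (u' x) = (\<lambda>h. h \<bullet> D)"
    proof
      fix h
      have "blinfun_apply (u' x) h = blinfun_apply (u' x) (\<Sum>b\<in>Basis. (h \<bullet> b) *\<^sub>R b)"
        by (simp add: euclidean_representation)
      also have "\<dots> = h \<bullet> D" by (simp add: D_def blinfun.sum_right blinfun.scaleR_right inner_sum_right mult.commute)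
      finally show "blinfun_apply (u' x) h = h \<bullet> D" .
    qed
    with u'[of x] have D: "GDERIV u x :> D" by (simp add: gderiv_def)
    have "E = D" if "GDERIV u x :> E" for E
    proof -
      have "(\<lambda>h. h \<bullet> E) = (\<lambda>h. h \<bullet> D)"
        using that D unfolding gderiv_def by (rule has_derivative_unique)
      then have "(E - D) \<bullet> (E - D) = 0" by (metis inner_diff_right cancel_comm_monoid_add_class.diff_cancel)
      then show ?thesis by simp
    qed
    with D have "gradient u x = D" unfolding gradient_def by (intro the_equality)
    with D show ?thesis by (simp add: gderiv_def inner_commute)
  qed
  show ?thesis
  proof (rule that[OF L(1) lip _ _ grad])
    show "u x = 0" if "R < norm x" for x using R[of x] zero[of x] that by force
    show "\<bar>u x\<bar> \<le> M" for x using M zero[of x] by (cases "x \<in> S") auto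
  qed
qed

lemma energy_tendsto_scaled:
  fixes g G :: "real^'n \<Rightarrow> real^'n \<Rightarrow> real \<Rightarrow> real"
  assumes G: "generalized_young g G" "cond_H1 G" "cond_H2 G" "cond_H3 g G"
    and u: "C2_compact_support u" and l: "0 < l"
    and s: "\<And>i. 1 / 2 \<le> s i" "\<And>i. s i < 1" "s \<longlonglongrightarrow> 1"
  shows "(\<lambda>x. H0_cone G x (gradient u x /\<^sub>R l)) \<in> borel_measurable lebesgue"
    and "(\<lambda>i. ennreal (1 - s i) * energy (s i) G (\<lambda>x. u x / l)) \<longlonglongrightarrow>
      (\<integral>\<^sup>+x. H0_cone G x (gradient u x /\<^sub>R l) \<partial>lebesgue)"
proof -
  obtain L R M where u: "0 < L" "\<And>x y. \<bar>u x - u y\<bar> \<le> L * norm (x - y)" "\<And>x. R < norm x \<Longrightarrow> u x = 0"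
    "\<And>x. \<bar>u x\<bar> \<le> M" "\<And>x. (u has_derivative (\<lambda>h. gradient u x \<bullet> h)) (at x)"
    using C2_compact_support_regular[OF u] by metis
  have lip: "\<bar>u x / l - u y / l\<bar> \<le> L / l * norm (x - y)" for x y
    using u(2)[of x y] l by (simp add: diff_divide_distrib[symmetric] divide_right_mono)
  have L: "0 < L / l" using u(1) l by simp
  have supp: "u x / l = 0" if "R < norm x" for x using u(3)[OF that] by simp
  have bnd: "\<bar>u x / l\<bar> \<le> M / l" for x using u(4)[of x] l by (simp add: divide_right_mono)
  have der: "((\<lambda>x. u x / l) has_derivative (\<lambda>h. (gradient u x /\<^sub>R l) \<bullet> h)) (at x)" for x
    using has_derivative_mult_left[OF u(5)[of x], of "inverse l"] by (simp add: divide_inverse mult.commute)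
  note scaled = G lip L supp bnd der
  show "(\<lambda>x. H0_cone G x (gradient u x /\<^sub>R l)) \<in> borel_measurable lebesgue"
    by (rule near_energy_tendsto(1)[OF scaled s(2,3)])
  show "(\<lambda>i. ennreal (1 - s i) * energy (s i) G (\<lambda>x. u x / l)) \<longlonglongrightarrow>
      (\<integral>\<^sup>+x. H0_cone G x (gradient u x /\<^sub>R l) \<partial>lebesgue)"
    by (rule energy_tendsto[OF scaled s])
qed

theorem corollary3p5:
  fixes g G :: "real^'n \<Rightarrow> real^'n \<Rightarrow> real \<Rightarrow> real"
    and u :: "real^'n \<Rightarrow> real"
    and k :: 'n
  assumes "generalized_young g G"
    and "cond_H1 G"
    and "cond_H2 G"
    and "cond_H3 g G"
    and "C2_compact_support u"
  shows "Limsup (at_left 1) (\<lambda>s. luxemburg_frac s G u) \<le> luxemburg_grad (H0 k G) u"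
  unfolding luxemburg_grad_def
proof (rule Inf_greatest, clarify)
  fix l :: real
  assume l: "0 < l" and H0_le: "(\<integral>\<^sup>+x. H0 k G x (norm (gradient u x) / l) \<partial>lebesgue) \<le> 1"
  note G = assms(1-4)
  show "Limsup (at_left 1) (\<lambda>s. luxemburg_frac s G u) \<le> ennreal l"
  \<comment> \<open>The room between \<open>l\<close> and \<open>m = l + \<epsilon>\<close> makes the limit of the energies strictly less than \<open>1\<close>.\<close>
  proof (rule ennreal_le_epsilon)
    fix \<epsilon> :: real assume \<epsilon>: "0 < \<epsilon>"
    define m where "m = l + \<epsilon>"
    define \<theta> where "\<theta> = l / m"
    have m: "0 < m" "l < m" using l \<epsilon> by (auto simp: m_def)
    have \<theta>: "0 \<le> \<theta>" "\<theta> < 1" using l m by (auto simp: \<theta>_def)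
    have "\<forall>\<^sub>F s in at_left 1. ennreal (1 - s) * energy s G (\<lambda>x. u x / m) \<le> 1"
    proof (rule sequentially_imp_eventually_at_left[of "1/2"])
      fix s :: "nat \<Rightarrow> real"
      assume "\<And>i. 1 / 2 < s i" "\<And>i. s i < 1" "incseq s" "s \<longlonglongrightarrow> 1"
      then have s: "\<And>i. 1 / 2 \<le> s i" "\<And>i. s i < 1" "s \<longlonglongrightarrow> 1" by (auto intro: less_imp_le)
      have "(\<integral>\<^sup>+x. H0_cone G x (gradient u x /\<^sub>R m) \<partial>lebesgue) \<le>
          (\<integral>\<^sup>+x. ennreal \<theta> * H0_cone G x (gradient u x /\<^sub>R l) \<partial>lebesgue)"
      proof (rule nn_integral_mono)
        fix x
        have "\<theta> *\<^sub>R (gradient u x /\<^sub>R l) = gradient u x /\<^sub>R m" using l by (simp add: \<theta>_def divide_inverse)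
        moreover have "H0_cone G x (\<theta> *\<^sub>R (gradient u x /\<^sub>R l)) \<le> ennreal \<theta> * H0_cone G x (gradient u x /\<^sub>R l)"
          using \<theta> by (intro H0_cone_scale[OF G]) auto
        ultimately show "H0_cone G x (gradient u x /\<^sub>R m) \<le> ennreal \<theta> * H0_cone G x (gradient u x /\<^sub>R l)"
          by (simp only:)
      qed
      also have "\<dots> = ennreal \<theta> * (\<integral>\<^sup>+x. H0_cone G x (gradient u x /\<^sub>R l) \<partial>lebesgue)"
        by (rule nn_integral_cmult) (rule energy_tendsto_scaled(1)[OF G assms(5) l s])
      also have "\<dots> \<le> ennreal \<theta> * (\<integral>\<^sup>+x. H0 k G x (norm (gradient u x) / l) \<partial>lebesgue)"
      proof (intro mult_left_mono nn_integral_mono)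
        fix x
        show "H0_cone G x (gradient u x /\<^sub>R l) \<le> H0 k G x (norm (gradient u x) / l)"
          using H0_cone_le_H0[OF G, of x "gradient u x /\<^sub>R l" k] l by (simp add: divide_inverse mult.commute)
      qed simp
      also have "\<dots> \<le> ennreal \<theta> * 1" using H0_le by (rule mult_left_mono) simp
      also have "\<dots> < 1" using \<theta> by (simp add: ennreal_less_one_iff)
      finally have lt: "(\<integral>\<^sup>+x. H0_cone G x (gradient u x /\<^sub>R m) \<partial>lebesgue) < 1" .
      show "\<forall>\<^sub>F i in sequentially. ennreal (1 - s i) * energy (s i) G (\<lambda>x. u x / m) \<le> 1"
        by (rule eventually_mono[OF order_tendstoD(2)[OF energy_tendsto_scaled(2)[OF G assms(5) m(1) s] lt]]) simp
    qed simp
    then have "\<forall>\<^sub>F s in at_left 1. luxemburg_frac s G u \<le> ennreal m"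
      by (rule eventually_mono) (use m(1) in \<open>auto simp: luxemburg_frac_def intro!: Inf_lower\<close>)
    then have "Limsup (at_left 1) (\<lambda>s. luxemburg_frac s G u) \<le> ennreal m" by (rule Limsup_bounded)
    then show "Limsup (at_left 1) (\<lambda>s. luxemburg_frac s G u) \<le> ennreal l + ennreal \<epsilon>"
      using l \<epsilon> by (simp add: m_def ennreal_plus)
  qed
qed

end
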